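(* Let $H$ be a trigraph tree, i.e., a trigraph whose underlying graph is a tree. Then the problem L-HOM$(H)$ is polynomially equivalent to the problem L-HOM$(H^-)$.
   Context: A trigraph $H$ consists of a finite vertex set $V(H)$ and two disjoint sets $W(H)$ (weak edges) and $S(H)$ (strong edges) of ordered pairs of vertices (loops $xx$ are allowed). An edge of $H$ is an element of $W(H)\cup S(H)$. A digraph is regarded as a trigraph with no strong edges. The underlying graph of $H$ is the undirected graph on $V(H)$ in which distinct $x,y$ are adjacent iff $xy$ or $yx$ is an edge of $H$. For a digraph $G$ and trigraph $H$, a homomorphism (an $H$-colouring) of $G$ to $H$ is a map $f:V(G)\to V(H)$ such that for all $u\neq v$: if $uv\in E(G)$ then $f(u)f(v)\in W(H)\cup S(H)$, and if $uv\notin E(G)$ then $f(u)f(v)\notin S(H)$. Given lists $L(u)\subseteq V(H)$ for $u\in V(G)$, a list $H$-colouring of $G$ with respect to $L$ is a homomorphism $f$ with $f(u)\in L(u)$ for all $u$. L-HOM$(H)$ is the decision problem: given a digraph $G$ with lists $L$, does $G$ admit a list $H$-colouring with respect to $L$? $H^-$ is the digraph obtained from $H$ by removing every edge $xy$ such that at least one of $xy,yx$ is a strong edge of $H$, and removing every vertex $x$ such that $xx$ is a strong loop of $H$. Two problems are polynomially equivalent if each is polynomial-time reducible to the other. *)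

theory Defs
  imports "HOL-Library.Countable_Set" "HOL-Computational_Algebra.Polynomial"
begin

section \<open>Trigraphs\<close>

record 'a trigraph =
  verts :: "'a set"
  weak :: "('a \<times> 'a) set"
  strong :: "('a \<times> 'a) set"

definition edges :: "'a trigraph \<Rightarrow> ('a \<times> 'a) set" where
  "edges H = weak H \<union> strong H"

definition is_trigraph :: "'a trigraph \<Rightarrow> bool" where
  "is_trigraph H \<longleftrightarrow> finite (verts H) \<and> edges H \<subseteq> verts H \<times> verts H \<and> weak H \<inter> strong H = {}"

definition is_digraph :: "'a trigraph \<Rightarrow> bool" where
  "is_digraph G \<longleftrightarrow> is_trigraph G \<and> strong G = {}"

text \<open>Adjacency in the underlying (simple, undirected) graph; its vertex set is \<open>verts H\<close>.\<close>

definition underlying_adj :: "'a trigraph \<Rightarrow> 'a \<Rightarrow> 'a \<Rightarrow> bool" where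
  "underlying_adj H x y \<longleftrightarrow> x \<noteq> y \<and> ((x, y) \<in> edges H \<or> (y, x) \<in> edges H)"

definition underlying_connected :: "'a trigraph \<Rightarrow> bool" where
  "underlying_connected H \<longleftrightarrow>
     verts H \<noteq> {} \<and> (\<forall>x\<in>verts H. \<forall>y\<in>verts H. (underlying_adj H)\<^sup>*\<^sup>* x y)"

definition underlying_cycle :: "'a trigraph \<Rightarrow> 'a list \<Rightarrow> bool" where
  "underlying_cycle H xs \<longleftrightarrow> length xs \<ge> 3 \<and> distinct xs \<and>
     successively (underlying_adj H) xs \<and> underlying_adj H (last xs) (hd xs)"

definition trigraph_tree :: "'a trigraph \<Rightarrow> bool" where
  "trigraph_tree H \<longleftrightarrow>
     is_trigraph H \<and> underlying_connected H \<and> (\<nexists>xs. underlying_cycle H xs)"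

definition is_hom :: "'b trigraph \<Rightarrow> 'a trigraph \<Rightarrow> ('b \<Rightarrow> 'a) \<Rightarrow> bool" where
  "is_hom G H f \<longleftrightarrow> (\<forall>u\<in>verts G. f u \<in> verts H) \<and>
     (\<forall>u\<in>verts G. \<forall>v\<in>verts G. u \<noteq> v \<longrightarrow>
        ((u, v) \<in> edges G \<longrightarrow> (f u, f v) \<in> weak H \<union> strong H) \<and>
        ((u, v) \<notin> edges G \<longrightarrow> (f u, f v) \<notin> strong H))"

definition is_list_hom :: "'b trigraph \<Rightarrow> ('b \<Rightarrow> 'a set) \<Rightarrow> 'a trigraph \<Rightarrow> ('b \<Rightarrow> 'a) \<Rightarrow> bool" where
  "is_list_hom G L H f \<longleftrightarrow> is_hom G H f \<and> (\<forall>u\<in>verts G. f u \<in> L u)"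

text \<open>The digraph \<open>H\<^sup>-\<close>. Removing a vertex also removes the edges at that vertex.\<close>

definition minus_digraph :: "'a trigraph \<Rightarrow> 'a trigraph" where
  "minus_digraph H =
     (let V = {x \<in> verts H. (x, x) \<notin> strong H} in
      \<lparr> verts = V,
        weak = {(x, y) \<in> edges H. x \<in> V \<and> y \<in> V \<and> (x, y) \<notin> strong H \<and> (y, x) \<notin> strong H},
        strong = {} \<rparr>)"


section \<open>Decision problems and polynomial-time reducibility\<close>

text \<open>
  The machine model is the language WHILE over binary trees (N. D. Jones, Computability and
  Complexity from a Programming Perspective), extended by oracle queries. Computing a value costs
  the size of that value (plus one), and a query costs the size of the queried word (plus one).
  Hence all values occurring in a run are bounded in size by the input size plus the running time,
  each command can be simulated by a Turing machine in time polynomial in the sizes of the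
  registers, and conversely a Turing machine step takes a bounded number of commands on a
  tree representation of the tapes. Up to polynomials this is therefore Turing machine time.
\<close>

datatype val = Atom | Pair val val

text \<open>The automatically generated function \<open>size :: val \<Rightarrow> nat\<close> counts the \<open>Pair\<close> nodes.\<close>

record problem =
  instances :: "val set"
  yes_instances :: "val set"

datatype expr =
    AtomE
  | Var nat
  | PairE nat nat
  | FstE nat
  | SndE nat

datatype com =
    Skip
  | Assign nat expr
  | Query nat nat
  | Seq com com
  | If nat com com
  | While nat com

type_synonym state = "nat \<Rightarrow> val"

fun fst_val :: "val \<Rightarrow> val" where
  "fst_val Atom = Atom"
| "fst_val (Pair a b) = a"

fun snd_val :: "val \<Rightarrow> val" where
  "snd_val Atom = Atom"
| "snd_val (Pair a b) = b"

fun eval_expr :: "state \<Rightarrow> expr \<Rightarrow> val" where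
  "eval_expr s AtomE = Atom"
| "eval_expr s (Var x) = s x"
| "eval_expr s (PairE x y) = Pair (s x) (s y)"
| "eval_expr s (FstE x) = fst_val (s x)"
| "eval_expr s (SndE x) = snd_val (s x)"

definition bool_val :: "bool \<Rightarrow> val" where
  "bool_val b = (if b then Pair Atom Atom else Atom)"

text \<open>
  \<open>exec B c s k t\<close>: with an oracle for the problem \<open>B\<close>, the program \<open>c\<close> started in state \<open>s\<close>
  terminates in state \<open>t\<close> after time \<open>k\<close>. The oracle may only be asked about instances of \<open>B\<close>;
  a program asking about anything else is stuck. \<open>Atom\<close> counts as false, every other value as true.
\<close>

inductive exec :: "problem \<Rightarrow> com \<Rightarrow> state \<Rightarrow> nat \<Rightarrow> state \<Rightarrow> bool" for B where
  Skip: "exec B Skip s 1 s"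
| Assign: "exec B (Assign x e) s (Suc (size (eval_expr s e))) (s(x := eval_expr s e))"
| Query: "s y \<in> instances B \<Longrightarrow>
    exec B (Query x y) s (Suc (size (s y))) (s(x := bool_val (s y \<in> yes_instances B)))"
| Seq: "exec B c s k t \<Longrightarrow> exec B d t l u \<Longrightarrow> exec B (Seq c d) s (k + l) u"
| IfTrue: "s x \<noteq> Atom \<Longrightarrow> exec B c s k t \<Longrightarrow> exec B (If x c d) s (Suc k) t"
| IfFalse: "s x = Atom \<Longrightarrow> exec B d s k t \<Longrightarrow> exec B (If x c d) s (Suc k) t"
| WhileFalse: "s x = Atom \<Longrightarrow> exec B (While x c) s 1 s"
| WhileTrue: "s x \<noteq> Atom \<Longrightarrow> exec B c s k t \<Longrightarrow> exec B (While x c) t l u \<Longrightarrow>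
    exec B (While x c) s (Suc (k + l)) u"

text \<open>Input and output are in register 0; all other registers are initially \<open>Atom\<close>.\<close>

definition initial :: "val \<Rightarrow> state" where
  "initial a = (\<lambda>_. Atom)(0 := a)"

text \<open>Polynomial-time (Turing) reducibility of \<open>A\<close> to \<open>B\<close>.\<close>

definition poly_time_reducible :: "problem \<Rightarrow> problem \<Rightarrow> bool" where
  "poly_time_reducible A B \<longleftrightarrow>
     (\<exists>(c :: com) (p :: nat poly). \<forall>a\<in>instances A. \<exists>k t.
        exec B c (initial a) k t \<and> k \<le> poly p (size a) \<and>
        (t 0 \<noteq> Atom \<longleftrightarrow> a \<in> yes_instances A))"

definition polynomially_equivalent :: "problem \<Rightarrow> problem \<Rightarrow> bool" where
  "polynomially_equivalent A B \<longleftrightarrow> poly_time_reducible A B \<and> poly_time_reducible B A"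


section \<open>The problem L-HOM(H)\<close>

text \<open>
  An input digraph has vertex set \<open>{..<n}\<close> and is given by its adjacency matrix; a list is given
  by its characteristic vector with respect to the enumeration \<open>from_nat_into (verts H)\<close> of the
  (fixed) finite vertex set of \<open>H\<close>.
\<close>

fun list_val :: "val list \<Rightarrow> val" where
  "list_val [] = Atom"
| "list_val (v # vs) = Pair v (list_val vs)"

definition encode :: "'a trigraph \<Rightarrow> nat trigraph \<Rightarrow> (nat \<Rightarrow> 'a set) \<Rightarrow> val" where
  "encode H G L =
     (let n = card (verts G); m = card (verts H) in
      Pair
        (list_val (map (\<lambda>u. list_val (map (\<lambda>v. bool_val ((u, v) \<in> edges G)) [0..<n])) [0..<n]))
        (list_val (map (\<lambda>u. list_val
           (map (\<lambda>i. bool_val (from_nat_into (verts H) i \<in> L u)) [0..<m])) [0..<n])))"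

definition lhom_input :: "'a trigraph \<Rightarrow> nat trigraph \<Rightarrow> (nat \<Rightarrow> 'a set) \<Rightarrow> bool" where
  "lhom_input H G L \<longleftrightarrow>
     is_digraph G \<and> (\<exists>n. verts G = {..<n}) \<and> (\<forall>u\<in>verts G. L u \<subseteq> verts H)"

definition L_HOM :: "'a trigraph \<Rightarrow> problem" where
  "L_HOM H =
     \<lparr> instances = {encode H G L | G L. lhom_input H G L},
       yes_instances = {encode H G L | G L. lhom_input H G L \<and> (\<exists>f. is_list_hom G L H f)} \<rparr>"

end

theory Submission
  imports Defs
begin

text \<open>
  In a tree, an edge \<open>xy\<close> is the only connection between its two sides. Hence a component of the
  reduct contains no strong edge, and for the reduction from the reduct it suffices to
  ask, for every component of the input, whether it maps to some component of the reduct.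

  Conversely, strong edges and loops are removed from \<open>H\<close> one at a time. First guess a representative for each
  colour that is used; it restricts the lists of all other vertices. If \<open>x \<noteq> y\<close> and \<open>xy\<close> is a strong edge, the colour of a
  vertex that may be coloured \<open>x\<close> or \<open>y\<close> is determined by the side of \<open>xy\<close> it is mapped to. The
  constraints across \<open>xy\<close> are then 2-clauses in the sides, and whether a connected piece of the input fits on
  a given side is a question for \<open>H\<close> without the edge \<open>xy\<close>.

  If only strong loops remain, the vertices coloured with a strong loop \<open>x\<close> form a clique \<open>Q\<close>. It lies in a
  maximal set \<open>R\<close> no two vertices of which are separated by an admissible clique. There are few
  such sets, because inseparability is a chordal graph. All of \<open>R - Q\<close> is coloured from one component of
  \<open>H - x\<close>, whose vertex next to \<open>x\<close> is called \<open>z\<close>, say. If \<open>z\<close> has no loop, \<open>R\<close> yields a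
  split graph, for which there are few choices of \<open>Q\<close>. If \<open>z\<close> has a weak loop, \<open>Q\<close> may be taken minimal and is
  computed as a fixed point. If \<open>z\<close> has a strong loop, continue with \<open>z\<close> in place of \<open>x\<close>; in a tree this
  walk has to turn back along some edge \<open>xz\<close>, which is then removed like a strong edge.
\<close>

section \<open>Polynomial time\<close>

text \<open>The obstacle is that strong edges and loops constrain non-adjacent vertices, so choices
  in distant parts of the input interact. Representatives make this local: if \<open>c\<close> and
  \<open>d\<close> are joined by a strong edge, a vertex that may still get \<open>d\<close> is
  adjacent to the representative of \<open>c\<close> (or is that representative), so all its
  remaining colours are joined to \<open>c\<close>. Maximal inseparable sets can be enumerated
  because a chordal graph is dismantled by deleting its simplicial vertices in rounds: each maximal
  clique is the surviving neighbourhood of its first deleted vertex, so a round and a vertex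
  determine it. All guesses are verified by solving a smaller problem, so accepting is sound for
  arbitrary guesses; only completeness needs an analysis of an unknown solution. \<open>H\<close> is
  fixed. Hence there are polynomially many choices of representatives, and the nested calls for
  smaller trigraphs have constant depth. The calls are many and their answers are combined, which is
  why reductions are programs with an oracle.\<close>

definition polybd :: "(nat \<Rightarrow> nat) \<Rightarrow> bool" where
  "polybd q \<longleftrightarrow> (\<exists>d. \<forall>n. q n \<le> (n + 2) ^ d)"

lemma polybdI: "(\<And>n. q n \<le> (n + 2) ^ d) \<Longrightarrow> polybd q"
  unfolding polybd_def by blast

lemma polybd_power: "polybd (\<lambda>n. (n + 2) ^ d)"
  unfolding polybd_def by blast

lemma polybd_id: "polybd (\<lambda>n. n)"
  by (rule polybdI[where d = 1]) simp

text \<open>The base n + 2 is at least 2 even for n = 0, so a constant or a factor 2 is absorbed by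
  raising the exponent. This is why the bounds carry no coefficients.\<close>

lemma polybd_const: "polybd (\<lambda>n. c)"
proof (rule polybdI[where d = c])
  fix n :: nat
  have "c < 2 ^ c" by (rule less_exp)
  also have "(2::nat) ^ c \<le> (n + 2) ^ c" by (rule power_mono) auto
  finally show "c \<le> (n + 2) ^ c" by simp
qed

lemma polybd_add:
  assumes "polybd p" "polybd q"
  shows "polybd (\<lambda>n. p n + q n)"
proof -
  obtain d e where d: "\<And>n. p n \<le> (n + 2) ^ d" and e: "\<And>n. q n \<le> (n + 2) ^ e"
    using assms unfolding polybd_def by blast
  show ?thesis
  proof (rule polybdI[where d = "Suc (max d e)"])
    fix n :: nat
    have "(n + 2) ^ d \<le> (n + 2) ^ max d e" "(n + 2) ^ e \<le> (n + 2) ^ max d e"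
      by (auto intro: power_increasing)
    then have "p n + q n \<le> 2 * (n + 2) ^ max d e"
      using d[of n] e[of n] by linarith
    also have "\<dots> \<le> (n + 2) ^ Suc (max d e)" by simp
    finally show "p n + q n \<le> (n + 2) ^ Suc (max d e)" .
  qed
qed

lemma polybd_Suc: "polybd p \<Longrightarrow> polybd (\<lambda>n. Suc (p n))"
  using polybd_add[OF _ polybd_const[of 1]] by simp

lemma polybd_mult:
  assumes "polybd p" "polybd q"
  shows "polybd (\<lambda>n. p n * q n)"
proof -
  obtain d e where d: "\<And>n. p n \<le> (n + 2) ^ d" and e: "\<And>n. q n \<le> (n + 2) ^ e"
    using assms unfolding polybd_def by blast
  show ?thesis
    by (rule polybdI[where d = "d + e"]) (unfold power_add, rule mult_le_mono[OF d e])
qed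

lemma polybd_comp:
  assumes "polybd p" "polybd q"
  shows "polybd (\<lambda>n. q (p n))"
proof -
  obtain d e where d: "\<And>n. p n \<le> (n + 2) ^ d" and e: "\<And>n. q n \<le> (n + 2) ^ e"
    using assms unfolding polybd_def by blast
  show ?thesis
  proof (rule polybdI[where d = "(d + 2) * e"])
    fix n :: nat
    have "1 \<le> (n + 2) ^ d" by simp
    moreover have "(n + 2) ^ (d + 2) = (n + 2) ^ d * ((n + 2) * (n + 2))"
      unfolding power_add power2_eq_square ..
    moreover have "(n + 2) ^ d * 4 \<le> (n + 2) ^ d * ((n + 2) * (n + 2))"
      by (rule mult_le_mono2) simp
    ultimately have "p n + 2 \<le> (n + 2) ^ (d + 2)" using d[of n] by linarith
    then have "(p n + 2) ^ e \<le> ((n + 2) ^ (d + 2)) ^ e" by (rule power_mono) simp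
    then show "q (p n) \<le> (n + 2) ^ ((d + 2) * e)"
      using e[of "p n"] unfolding power_mult by (rule order_trans[rotated])
  qed
qed

lemmas polybd_intros = polybd_id polybd_const polybd_add polybd_Suc polybd_mult

text \<open>Time bounds are composed with bounds on the size of intermediate results; estimating
  inside such a composition needs monotonicity.\<close>

lemma polybd_obtain_mono:
  assumes "polybd q"
  obtains p where "polybd p" "mono p" "\<And>n. q n \<le> p n"
proof -
  obtain d where "\<And>n. q n \<le> (n + 2) ^ d" using assms unfolding polybd_def by blast
  then show ?thesis
    by (intro that[of "\<lambda>n. (n + 2) ^ d"] polybd_power) (auto simp: mono_def intro: power_mono)
qed

text \<open>An assignment costs more than the size of the value it stores, and a query stores a
  value of size at most 1. So a time bound is also a bound on the size of the output.\<close>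

lemma exec_size: "exec B c s k t \<Longrightarrow> size (t i) \<le> size (s i) + k"
proof (induction arbitrary: i rule: exec.induct)
  case (Query s y x)
  then show ?case by (cases "i = x") (auto simp: bool_val_def)
next
  case (Seq c s k t d l u)
  from Seq.IH(1)[of i] Seq.IH(2)[of i] show ?case by linarith
next
  case (WhileTrue s x c k t l u)
  from WhileTrue.IH(1)[of i] WhileTrue.IH(2)[of i] show ?case by linarith
qed (auto intro: le_SucI)

section \<open>Encoded data and functions computable in polynomial time with an oracle\<close>

class enc = fixes enc :: "'a \<Rightarrow> val"

instantiation unit :: enc begin
definition enc_unit :: "unit \<Rightarrow> val" where "enc_unit u = Atom"
instance ..
end

instantiation bool :: enc begin
definition enc_bool :: "bool \<Rightarrow> val" where "enc_bool b = bool_val b"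
instance ..
end

instantiation prod :: (enc, enc) enc begin
definition enc_prod :: "'a \<times> 'b \<Rightarrow> val" where "enc_prod p = Pair (enc (fst p)) (enc (snd p))"
instance ..
end

instantiation list :: (enc) enc begin
definition enc_list :: "'a list \<Rightarrow> val" where "enc_list xs = list_val (map enc xs)"
instance ..
end

text \<open>Unary notation: numbers serve as vertices, positions and round counters, which are
  polynomial in the input size, and operations on them become list processing.\<close>

instantiation nat :: enc begin
definition enc_nat :: "nat \<Rightarrow> val" where "enc_nat n = enc (replicate n ())"
instance ..
end

lemma enc_Nil: "enc [] = Atom" and enc_Cons: "enc (x # xs) = Pair (enc x) (enc xs)"
  by (simp_all add: enc_list_def)

lemma enc_Pair: "enc (x, y) = Pair (enc x) (enc y)"
  by (simp add: enc_prod_def)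

lemma enc_True: "enc True = Pair Atom Atom" and enc_False: "enc False = Atom"
  by (simp_all add: enc_bool_def bool_val_def)

lemma enc_bool_eq_Atom: "enc b = Atom \<longleftrightarrow> \<not> b"
  by (cases b) (simp_all add: enc_True enc_False)

text \<open>
  The program may start with arbitrary values in its scratch registers and leaves all registers
  from \<open>r\<close> on untouched; this makes programs composable.
\<close>

definition computes :: "problem \<Rightarrow> com \<Rightarrow> nat \<Rightarrow> (nat \<Rightarrow> nat) \<Rightarrow> ('a::enc \<Rightarrow> 'b::enc) \<Rightarrow> bool" where
  "computes B c r q f \<longleftrightarrow> (\<forall>a s. s 0 = enc a \<longrightarrow>
     (\<exists>k t. exec B c s k t \<and> t 0 = enc (f a) \<and> k \<le> q (size (enc a)) \<and> (\<forall>i\<ge>r. t i = s i)))"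

lemma computesI:
  assumes "\<And>a s. s 0 = enc a \<Longrightarrow>
      \<exists>k t. exec B c s k t \<and> t 0 = enc (f a) \<and> k \<le> q (size (enc a)) \<and> (\<forall>i\<ge>r. t i = s i)"
  shows "computes B c r q f"
  unfolding computes_def using assms by blast

lemma computesD:
  assumes "computes B c r q f" "s 0 = enc a"
  shows "\<exists>k t. exec B c s k t \<and> t 0 = enc (f a) \<and> k \<le> q (size (enc a)) \<and> (\<forall>i\<ge>r. t i = s i)"
  using assms unfolding computes_def by blast

definition ptime :: "problem \<Rightarrow> ('a::enc \<Rightarrow> 'b::enc) \<Rightarrow> bool" where
  "ptime B f \<longleftrightarrow> (\<exists>c r q. polybd q \<and> computes B c r q f)"

lemma ptimeI:
  fixes f :: "'a::enc \<Rightarrow> 'b::enc"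
  assumes "polybd q"
    and "\<And>a s. s 0 = enc a \<Longrightarrow>
      \<exists>k t. exec B c s k t \<and> t 0 = enc (f a) \<and> k \<le> q (size (enc a)) \<and> (\<forall>i\<ge>r. t i = s i)"
  shows "ptime B f"
  unfolding ptime_def computes_def using assms by blast

text \<open>Besides a monotone bound this gives a positive scratch limit: callers save data in
  registers from \<open>r\<close> on, and these must differ from the input and output register
  0.\<close>

lemma ptimeE:
  fixes f :: "'a::enc \<Rightarrow> 'b::enc"
  assumes "ptime B f"
  obtains c r q where "polybd q" "mono q" "0 < r" "computes B c r q f"
proof -
  obtain c r q where q: "polybd q" and c: "computes B c r q f"
    using assms unfolding ptime_def by blast
  obtain p where p: "polybd p" "mono p" "\<And>n. q n \<le> p n" using polybd_obtain_mono[OF q] by blast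
  have "computes B c (Suc r) p f"
  proof (rule computesI)
    fix a :: 'a and s :: state assume "s 0 = enc a"
    from computesD[OF c, where s = s, OF this] show "\<exists>k t. exec B c s k t \<and> t 0 = enc (f a) \<and> k \<le> p (size (enc a)) \<and> (\<forall>i\<ge>Suc r. t i = s i)"
      using p(3) by (meson Suc_leD order_trans)
  qed
  then show ?thesis using that[of p "Suc r" c] p by simp
qed

lemma ptime_size:
  fixes f :: "'a::enc \<Rightarrow> 'b::enc"
  assumes "ptime B f"
  obtains q where "polybd q" "mono q" "\<And>a. size (enc (f a)) \<le> q (size (enc a))"
proof -
  obtain c r q where q: "polybd q" "mono q" "0 < r" and Cc: "computes B c r q f"
    by (rule ptimeE[OF assms])
  note c = computesD[OF Cc]
  show ?thesis
  proof (rule that[of "\<lambda>n. n + q n"])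
    show "polybd (\<lambda>n. n + q n)" by (intro polybd_intros q)
    show "mono (\<lambda>n. n + q n)" using q(2) by (auto simp: mono_def intro: add_mono)
    fix a :: 'a
    obtain k t where "exec B c (\<lambda>_. enc a) k t" "t 0 = enc (f a)" "k \<le> q (size (enc a))"
      using c[of "\<lambda>_. enc a" a] by auto
    then show "size (enc (f a)) \<le> size (enc a) + q (size (enc a))"
      using exec_size[of B c "\<lambda>_. enc a" k t 0] by simp
  qed
qed

text \<open>A program sees only encodings. Thus \<open>(x, xs)\<close> and \<open>x # xs\<close>, or
  \<open>n\<close> and \<open>replicate n ()\<close>, are the same datum and need no conversion
  code.\<close>

lemma ptime_cong_enc:
  assumes "ptime B f" "\<And>a. enc (g a) = enc (f a)"
  shows "ptime B g"
  using assms(1) unfolding ptime_def computes_def assms(2) .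

lemma exec_Assign: "t = s(x := eval_expr s e) \<Longrightarrow> k = Suc (size (eval_expr s e)) \<Longrightarrow> exec B (Assign x e) s k t"
  using exec.Assign by blast

lemma ptime_basic:
  fixes f :: "'a::enc \<Rightarrow> 'b::enc"
  assumes "\<And>a s. s 0 = enc a \<Longrightarrow> eval_expr s e = enc (f a)"
  shows "ptime B f"
proof (rule ptimeI[where c = "Assign 0 e" and r = 1 and q = "\<lambda>n. n + n + 3"])
  show "polybd (\<lambda>n. n + n + 3)" by (intro polybd_intros)
  fix a :: 'a and s :: state assume s: "s 0 = enc a"
  have *: "eval_expr s e = eval_expr (\<lambda>_. enc a) e"
    using assms[of "\<lambda>_. enc a" a] assms[of s a, OF s] by simp
  \<comment> \<open>The extreme case is \<open>PairE\<close>, with both registers holding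
    \<open>enc a\<close>.\<close>
  have "size (eval_expr s e) \<le> 2 * size (enc a) + 1"
    unfolding * by (cases e; cases "enc a") auto
  then show "\<exists>k t. exec B (Assign 0 e) s k t \<and> t 0 = enc (f a) \<and> k \<le> size (enc a) + size (enc a) + 3 \<and> (\<forall>i\<ge>1. t i = s i)"
    by (intro exI[of _ "Suc (size (eval_expr s e))"] exI[of _ "s(0 := eval_expr s e)"] conjI exec.Assign)
       (use assms[of s a, OF s] in auto)
qed

lemma ptime_id: "ptime B (\<lambda>a. a)"
  by (rule ptime_basic[where e = "Var 0"]) simp

lemma ptime_comp:
  fixes f :: "'a::enc \<Rightarrow> 'b::enc" and g :: "'b \<Rightarrow> 'c::enc"
  assumes "ptime B f" "ptime B g"
  shows "ptime B (\<lambda>a. g (f a))"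
proof -
  obtain c1 r1 q1 where q1: "polybd q1" "mono q1" "0 < r1" and Cc1: "computes B c1 r1 q1 f"
    by (rule ptimeE[OF assms(1)])
  note c1 = computesD[OF Cc1]
  obtain c2 r2 q2 where q2: "polybd q2" "mono q2" "0 < r2" and Cc2: "computes B c2 r2 q2 g"
    by (rule ptimeE[OF assms(2)])
  note c2 = computesD[OF Cc2]
  obtain p where p: "polybd p" "\<And>a. size (enc (f a)) \<le> p (size (enc a))"
    using ptime_size[OF assms(1)] by blast
  show ?thesis
  proof (rule ptimeI[where c = "Seq c1 c2" and r = "max r1 r2" and q = "\<lambda>n. q1 n + q2 (p n)"])
    show "polybd (\<lambda>n. q1 n + q2 (p n))" by (intro polybd_add polybd_comp[of p q2] p q1 q2)
    fix a :: 'a and s :: state assume "s 0 = enc a"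
    then obtain k t where 1: "exec B c1 s k t" "t 0 = enc (f a)" "k \<le> q1 (size (enc a))" "\<forall>i\<ge>r1. t i = s i"
      using c1 by blast
    then obtain l u where 2: "exec B c2 t l u" "u 0 = enc (g (f a))" "l \<le> q2 (size (enc (f a)))" "\<forall>i\<ge>r2. u i = t i"
      using c2 by blast
    have "q2 (size (enc (f a))) \<le> q2 (p (size (enc a)))" using p(2) q2(2) by (simp add: monoD)
    then show "\<exists>k t. exec B (Seq c1 c2) s k t \<and> t 0 = enc (g (f a)) \<and>
        k \<le> q1 (size (enc a)) + q2 (p (size (enc a))) \<and> (\<forall>i\<ge>max r1 r2. t i = s i)"
      using 1 2 by (intro exI[of _ "k + l"] exI[of _ u]) (auto intro!: exec.Seq)
  qed
qed

lemma const_program: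
  "\<exists>c r k. \<forall>s. \<exists>t. exec B c s k t \<and> t 0 = v \<and> (\<forall>i\<ge>r. t i = s i)"
proof (induction v)
  case Atom
  show ?case
    by (intro exI[of _ "Assign 0 AtomE"] exI[of _ 1] exI[of _ "1::nat"])
       (auto intro!: exI exec_Assign)
next
  case (Pair v w)
  obtain c r k where c: "\<And>s. \<exists>t. exec B c s k t \<and> t 0 = v \<and> (\<forall>i\<ge>r. t i = s i)" using Pair(1) by blast
  obtain d q l where d: "\<And>s. \<exists>t. exec B d s l t \<and> t 0 = w \<and> (\<forall>i\<ge>q. t i = s i)" using Pair(2) by blast
  let ?R = "Suc (max r q)"
  let ?prog = "Seq c (Seq (Assign ?R (Var 0)) (Seq d (Assign 0 (PairE ?R 0))))"
  let ?time = "k + (Suc (size v) + (l + Suc (size (val.Pair v w))))"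
  have "\<exists>t. exec B ?prog s ?time t \<and> t 0 = val.Pair v w \<and> (\<forall>i\<ge>Suc ?R. t i = s i)" for s
  proof -
    obtain t where t: "exec B c s k t" "t 0 = v" "\<forall>i\<ge>r. t i = s i" using c by blast
    obtain u where u: "exec B d (t(?R := v)) l u" "u 0 = w" "\<forall>i\<ge>q. u i = (t(?R := v)) i" using d by blast
    have "u ?R = v" using u(3) by simp
    then show ?thesis
      using t u
      by (intro exI[of _ "u(0 := val.Pair v w)"] conjI exec.Seq[OF t(1)] exec.Seq[OF _ exec.Seq[OF u(1)]] exec_Assign) auto
  qed
  then show ?case by blast
qed

lemma ptime_const: "ptime B (\<lambda>_. v)"
proof -
  obtain c r k where c: "\<And>s. \<exists>t. exec B c s k t \<and> t 0 = enc v \<and> (\<forall>i\<ge>r. t i = s i)"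
    using const_program by blast
  show ?thesis
    by (rule ptimeI[where c = c and r = r and q = "\<lambda>_. k"]) (use c polybd_const in blast)+
qed

lemma ptime_pair:
  fixes f :: "'a::enc \<Rightarrow> 'b::enc" and g :: "'a \<Rightarrow> 'c::enc"
  assumes "ptime B f" "ptime B g"
  shows "ptime B (\<lambda>a. (f a, g a))"
proof -
  obtain c1 r1 q1 where q1: "polybd q1" "mono q1" "0 < r1" and Cc1: "computes B c1 r1 q1 f"
    by (rule ptimeE[OF assms(1)])
  note c1 = computesD[OF Cc1]
  obtain c2 r2 q2 where q2: "polybd q2" "mono q2" "0 < r2" and Cc2: "computes B c2 r2 q2 g"
    by (rule ptimeE[OF assms(2)])
  note c2 = computesD[OF Cc2]
  obtain p1 where p1: "polybd p1" "\<And>a. size (enc (f a)) \<le> p1 (size (enc a))"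
    using ptime_size[OF assms(1)] by blast
  obtain p2 where p2: "polybd p2" "\<And>a. size (enc (g a)) \<le> p2 (size (enc a))"
    using ptime_size[OF assms(2)] by blast
  let ?R = "max r1 r2"
  \<comment> \<open>Register \<open>?R\<close> keeps the input for the second program and
    \<open>Suc ?R\<close> the first result; both lie beyond the scratch registers of
    \<open>c1\<close> and \<open>c2\<close>.\<close>
  let ?c = "Seq (Assign ?R (Var 0)) (Seq c1 (Seq (Assign (Suc ?R) (Var 0))
    (Seq (Assign 0 (Var ?R)) (Seq c2 (Assign 0 (PairE (Suc ?R) 0))))))"
  let ?q = "\<lambda>n. n + q1 n + p1 n + n + q2 n + (p1 n + p2 n) + 5"
  show ?thesis
  proof (rule ptimeI[where c = ?c and r = "?R + 2" and q = ?q])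
    show "polybd ?q" by (intro polybd_intros q1 q2 p1 p2)
    fix a :: 'a and s :: state assume s: "s 0 = enc a"
    let ?s1 = "s(?R := enc a)"
    have "?s1 0 = enc a" using s by simp
    then obtain k t where 1: "exec B c1 ?s1 k t" "t 0 = enc (f a)" "k \<le> q1 (size (enc a))" "\<forall>i\<ge>r1. t i = ?s1 i"
      using c1 by blast
    let ?t1 = "t(Suc ?R := enc (f a), 0 := enc a)"
    obtain l u where 2: "exec B c2 ?t1 l u" "u 0 = enc (g a)" "l \<le> q2 (size (enc a))" "\<forall>i\<ge>r2. u i = ?t1 i"
      using c2[of ?t1 a] by auto
    have tR: "t ?R = enc a" using 1(4) by simp
    have uR: "u (Suc ?R) = enc (f a)" using 2(4) by simp
    let ?time = "Suc (size (enc a)) + (k + (Suc (size (enc (f a))) + (Suc (size (enc a)) + (l + Suc (size (enc (f a, g a)))))))"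
    have "exec B ?c s ?time (u(0 := enc (f a, g a)))"
    proof (intro exec.Seq)
      show "exec B (Assign ?R (Var 0)) s (Suc (size (enc a))) ?s1" by (rule exec_Assign) (use s in auto)
      show "exec B c1 ?s1 k t" by fact
      show "exec B (Assign (Suc ?R) (Var 0)) t (Suc (size (enc (f a)))) (t(Suc ?R := enc (f a)))"
        by (rule exec_Assign) (use 1 in auto)
      show "exec B (Assign 0 (Var ?R)) (t(Suc ?R := enc (f a))) (Suc (size (enc a))) ?t1"
        by (rule exec_Assign) (use tR in auto)
      show "exec B c2 ?t1 l u" by fact
      show "exec B (Assign 0 (PairE (Suc ?R) 0)) u (Suc (size (enc (f a, g a)))) (u(0 := enc (f a, g a)))"
        by (rule exec_Assign) (use 2(2) uR in \<open>auto simp: enc_Pair\<close>)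
    qed
    moreover have "\<forall>i\<ge>?R + 2. u i = s i" using 1(4) 2(4) by auto
    moreover have "?time \<le> ?q (size (enc a))"
      using 1(3) 2(3) p1(2)[of a] p2(2)[of a] by (simp add: enc_Pair)
    ultimately show "\<exists>k t. exec B ?c s k t \<and> t 0 = enc (f a, g a) \<and> k \<le> ?q (size (enc a)) \<and> (\<forall>i\<ge>?R + 2. t i = s i)"
      using q1(3) by (intro exI[of _ ?time] exI[of _ "u(0 := enc (f a, g a))"]) auto
  qed
qed

lemma ptime_fst: "ptime B f \<Longrightarrow> ptime B (\<lambda>a. fst (f a))"
  by (rule ptime_comp[where g = fst], assumption, rule ptime_basic[where e = "FstE 0"])
     (simp add: enc_prod_def)

lemma ptime_snd: "ptime B f \<Longrightarrow> ptime B (\<lambda>a. snd (f a))"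
  by (rule ptime_comp[where g = snd], assumption, rule ptime_basic[where e = "SndE 0"])
     (simp add: enc_prod_def)

lemma ptime_Cons: "ptime B f \<Longrightarrow> ptime B g \<Longrightarrow> ptime B (\<lambda>a. f a # g a)"
  by (rule ptime_cong_enc[OF ptime_pair]) (auto simp: enc_Pair enc_Cons)

lemma ptime_tl: "ptime B f \<Longrightarrow> ptime B (\<lambda>a. tl (f a))"
proof (rule ptime_comp[where g = tl], assumption, rule ptime_basic[where e = "SndE 0"])
  fix a :: "'b list" and s :: state
  assume "s 0 = enc a"
  then show "eval_expr s (SndE 0) = enc (tl a)" by (cases a) (auto simp: enc_Nil enc_Cons)
qed

lemma ptime_if:
  fixes f :: "'a::enc \<Rightarrow> 'b::enc" and g :: "'a \<Rightarrow> 'b::enc"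
  assumes "ptime B b" "ptime B f" "ptime B g"
  shows "ptime B (\<lambda>a. if b a then f a else g a)"
proof -
  obtain c0 r0 q0 where q0: "polybd q0" "mono q0" "0 < r0" and Cc0: "computes B c0 r0 q0 b"
    by (rule ptimeE[OF assms(1)])
  note c0 = computesD[OF Cc0]
  obtain c1 r1 q1 where q1: "polybd q1" "mono q1" "0 < r1" and Cc1: "computes B c1 r1 q1 f"
    by (rule ptimeE[OF assms(2)])
  note c1 = computesD[OF Cc1]
  obtain c2 r2 q2 where q2: "polybd q2" "mono q2" "0 < r2" and Cc2: "computes B c2 r2 q2 g"
    by (rule ptimeE[OF assms(3)])
  note c2 = computesD[OF Cc2]
  let ?R = "max r0 (max r1 r2)"
  let ?c = "Seq (Assign ?R (Var 0)) (Seq c0 (Seq (Assign (Suc ?R) (Var 0))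
    (Seq (Assign 0 (Var ?R)) (If (Suc ?R) c1 c2))))"
  let ?q = "\<lambda>n. n + q0 n + n + q1 n + q2 n + 7"
  show ?thesis
  proof (rule ptimeI[where c = ?c and r = "?R + 2" and q = ?q])
    show "polybd ?q" by (intro polybd_intros q0 q1 q2)
    fix a :: 'a and s :: state assume s: "s 0 = enc a"
    let ?s1 = "s(?R := enc a)"
    have "?s1 0 = enc a" using s by simp
    then obtain k t where 1: "exec B c0 ?s1 k t" "t 0 = enc (b a)" "k \<le> q0 (size (enc a))" "\<forall>i\<ge>r0. t i = ?s1 i"
      using c0 by blast
    let ?t1 = "t(Suc ?R := enc (b a), 0 := enc a)"
    let ?h = "if b a then f a else g a"
    have "\<exists>l u. exec B (If (Suc ?R) c1 c2) ?t1 (Suc l) u \<and> u 0 = enc ?h \<and>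
      l \<le> q1 (size (enc a)) + q2 (size (enc a)) \<and> (\<forall>i\<ge>?R. u i = ?t1 i)"
    proof (cases "b a")
      case True
      obtain l u where "exec B c1 ?t1 l u" "u 0 = enc (f a)" "l \<le> q1 (size (enc a))" "\<forall>i\<ge>r1. u i = ?t1 i"
        using c1[of ?t1 a] by auto
      moreover have "?t1 (Suc ?R) \<noteq> Atom" using True by (simp add: enc_True)
      ultimately show ?thesis using True
        by (intro exI[of _ l] exI[of _ u] conjI exec.IfTrue) auto
    next
      case False
      obtain l u where "exec B c2 ?t1 l u" "u 0 = enc (g a)" "l \<le> q2 (size (enc a))" "\<forall>i\<ge>r2. u i = ?t1 i"
        using c2[of ?t1 a] by auto
      moreover have "?t1 (Suc ?R) = Atom" using False by (simp add: enc_False)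
      ultimately show ?thesis using False
        by (intro exI[of _ l] exI[of _ u] conjI exec.IfFalse) auto
    qed
    then obtain l u where 2: "exec B (If (Suc ?R) c1 c2) ?t1 (Suc l) u" "u 0 = enc ?h"
      "l \<le> q1 (size (enc a)) + q2 (size (enc a))" "\<forall>i\<ge>?R. u i = ?t1 i" by blast
    have tR: "t ?R = enc a" using 1(4) by simp
    let ?time = "Suc (size (enc a)) + (k + (Suc (size (enc (b a))) + (Suc (size (enc a)) + Suc l)))"
    have "exec B ?c s ?time u"
    proof (intro exec.Seq)
      show "exec B (Assign ?R (Var 0)) s (Suc (size (enc a))) ?s1" by (rule exec_Assign) (use s in auto)
      show "exec B c0 ?s1 k t" by fact
      show "exec B (Assign (Suc ?R) (Var 0)) t (Suc (size (enc (b a)))) (t(Suc ?R := enc (b a)))"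
        by (rule exec_Assign) (use 1 in auto)
      show "exec B (Assign 0 (Var ?R)) (t(Suc ?R := enc (b a))) (Suc (size (enc a))) ?t1"
        by (rule exec_Assign) (use tR in auto)
      show "exec B (If (Suc ?R) c1 c2) ?t1 (Suc l) u" by fact
    qed
    moreover have "\<forall>i\<ge>?R + 2. u i = s i"
    proof (intro allI impI)
      fix i assume "?R + 2 \<le> i"
      then have "?R \<le> i" "i \<noteq> 0" "i \<noteq> Suc ?R" "i \<noteq> ?R" "r0 \<le> i" by auto
      then show "u i = s i" using 1(4) 2(4) by simp
    qed
    moreover have "size (enc (b a)) \<le> 1" by (cases "b a") (simp_all add: enc_True enc_False)
    then have "?time \<le> ?q (size (enc a))" using 1(3) 2(3) by linarith
    ultimately show "\<exists>k t. exec B ?c s k t \<and> t 0 = enc ?h \<and> k \<le> ?q (size (enc a)) \<and> (\<forall>i\<ge>?R + 2. t i = s i)"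
      using 2(2) by (intro exI[of _ ?time] exI[of _ u]) auto
  qed
qed

text \<open>The single place where a \<open>While\<close> program is written; all later iteration is
  derived from it. The accumulator must be bounded after every prefix, because a polynomial-time
  step could double it in each round.\<close>

lemma ptime_foldl:
  fixes h :: "'e::enc \<Rightarrow> 'acc::enc \<Rightarrow> 'x::enc \<Rightarrow> 'acc"
  assumes h: "ptime B (\<lambda>p. h (fst p) (fst (snd p)) (snd (snd p)))" and i: "ptime B i" and xs: "ptime B xs"
    and bd: "polybd b" "\<And>e ys zs. xs e = ys @ zs \<Longrightarrow> size (enc (foldl (h e) (i e) ys)) \<le> b (size (enc e))"
  shows "ptime B (\<lambda>e. foldl (h e) (i e) (xs e))"
proof -
  obtain c0 r0 q0 where q0: "polybd q0" "mono q0" "0 < r0" and Cc0: "computes B c0 r0 q0 i"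
    by (rule ptimeE[OF i])
  note c0 = computesD[OF Cc0]
  obtain c1 r1 q1 where q1: "polybd q1" "mono q1" "0 < r1" and Cc1: "computes B c1 r1 q1 xs"
    by (rule ptimeE[OF xs])
  note c1 = computesD[OF Cc1]
  obtain c2 r2 q2 where q2: "polybd q2" "mono q2" "0 < r2" and Cc2: "computes B c2 r2 q2 (\<lambda>p. h (fst p) (fst (snd p)) (snd (snd p)))"
    by (rule ptimeE[OF h])
  note c2 = computesD[OF Cc2]
  obtain p where p: "polybd p" "\<And>a. size (enc (xs a)) \<le> p (size (enc a))"
    using ptime_size[OF xs] by blast
  obtain b' where b': "polybd b'" "mono b'" "\<And>n. b n \<le> b' n" using polybd_obtain_mono[OF bd(1)] by blast
  define R where "R = max r0 (max r1 r2)"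
  have R: "r0 \<le> R" "r1 \<le> R" "r2 \<le> R" "0 < R" using q0(3) by (auto simp: R_def)
  define A X where "A = Suc R" and "X = Suc (Suc R)"
  \<comment> \<open>registers: \<open>R\<close> environment, \<open>A\<close> accumulator, \<open>X\<close> remaining list\<close>
  define body where "body = Seq (Assign 0 (FstE X)) (Seq (Assign 0 (PairE A 0)) (Seq (Assign 0 (PairE R 0))
    (Seq c2 (Seq (Assign A (Var 0)) (Assign X (SndE X))))))"
  define cc where "cc = Seq (Assign R (Var 0)) (Seq c0 (Seq (Assign A (Var 0)) (Seq (Assign 0 (Var R))
    (Seq c1 (Seq (Assign X (Var 0)) (Seq (While X body) (Assign 0 (Var A))))))))"
  \<comment> \<open>\<open>w\<close> bounds the triple handed to the loop body, \<open>m\<close> the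
    time of one round and \<open>q\<close> the total time.\<close>
  define w where "w n = n + b' n + p n + 2" for n
  define m where "m n = 4 * w n + q2 (w n) + b' n + p n + 10" for n
  define q where "q n = n + q0 n + b' n + n + q1 n + p n + (Suc (p n) * m n) + b' n + 10" for n
  have polybd_w: "polybd w" unfolding w_def by (intro polybd_intros b' p)
  have "polybd (\<lambda>n. q2 (w n))" by (rule polybd_comp[OF polybd_w q2(1)])
  then have "polybd m" unfolding m_def by (intro polybd_intros polybd_w b' p)
  then have polybd_q: "polybd q" unfolding q_def by (intro polybd_intros q0 b' q1 p)
  have len: "length zs \<le> size (enc zs)" for zs :: "'x list"
    by (induction zs) (auto simp: enc_Cons)
  have loop: "\<exists>k t. exec B (While X body) s k t \<and> t A = enc (foldl (h e) (i e) (ys @ zs)) \<and>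
      k \<le> Suc (length zs * m (size (enc e))) \<and> (\<forall>j\<ge>Suc X. t j = s j)"
    if "s R = enc e" "s A = enc (foldl (h e) (i e) ys)" "s X = enc zs" "xs e = ys @ zs" for s e ys zs
    using that
  proof (induction zs arbitrary: s ys)
    case Nil
    then have "exec B (While X body) s 1 s" by (intro exec.WhileFalse) (simp add: enc_Nil)
    then show ?case using Nil by (intro exI[of _ 1] exI[of _ s]) auto
  next
    case (Cons z zs)
    let ?acc = "foldl (h e) (i e) ys"
    let ?n = "size (enc e)"
    have acc: "size (enc ?acc) \<le> b' ?n" using bd(2)[OF Cons.prems(4)] b'(3) le_trans by blast
    have acc2: "size (enc (h e ?acc z)) \<le> b' ?n"
      using bd(2)[of e "ys @ [z]" zs] Cons.prems(4) b'(3)[of ?n] by simp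
    have "size (enc (z # zs)) \<le> size (enc (ys @ z # zs))" for ys
      by (induction ys) (auto simp: enc_Cons)
    then have zs: "size (enc (z # zs)) \<le> p ?n"
      using p(2)[of e] Cons.prems(4) by (metis order_trans)
    let ?s1 = "s(0 := enc (e, ?acc, z))"
    obtain k t where 1: "exec B c2 ?s1 k t" "t 0 = enc (h e ?acc z)" "k \<le> q2 (size (enc (e, ?acc, z)))"
      "\<forall>i\<ge>r2. t i = ?s1 i"
      using c2[of ?s1 "(e, ?acc, z)"] by auto
    have "size (enc (e, ?acc, z)) \<le> w ?n" using acc zs by (simp add: w_def enc_Pair enc_Cons)
    note sz = this
    then have k: "k \<le> q2 (w ?n)" using 1(3) q2(2) by (meson monoD order_trans)
    let ?t1 = "t(A := enc (h e ?acc z), X := enc zs)"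
    have tX: "t R = enc e" "t A = enc ?acc" "t X = enc (z # zs)"
      using 1(4) R Cons.prems by (auto simp: A_def X_def)
    have nz: "A \<noteq> 0" "X \<noteq> 0" "R \<noteq> 0" "A \<noteq> X" "A \<noteq> R" "X \<noteq> R" using R by (auto simp: A_def X_def)
    let ?time = "Suc (size (enc z)) + (Suc (size (enc (?acc, z))) + (Suc (size (enc (e, ?acc, z))) +
      (k + (Suc (size (enc (h e ?acc z))) + Suc (size (enc zs))))))"
    have body: "exec B body s ?time ?t1"
      unfolding body_def
    proof (intro exec.Seq)
      show "exec B (Assign 0 (FstE X)) s (Suc (size (enc z))) (s(0 := enc z))"
        by (rule exec_Assign) (use Cons.prems in \<open>auto simp: enc_Cons\<close>)
      show "exec B (Assign 0 (PairE A 0)) (s(0 := enc z)) (Suc (size (enc (?acc, z)))) (s(0 := enc (?acc, z)))"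
        by (rule exec_Assign) (use Cons.prems nz in \<open>auto simp: enc_Pair\<close>)
      show "exec B (Assign 0 (PairE R 0)) (s(0 := enc (?acc, z))) (Suc (size (enc (e, ?acc, z)))) ?s1"
        by (rule exec_Assign) (use Cons.prems nz in \<open>auto simp: enc_Pair\<close>)
      show "exec B c2 ?s1 k t" by fact
      show "exec B (Assign A (Var 0)) t (Suc (size (enc (h e ?acc z)))) (t(A := enc (h e ?acc z)))"
        by (rule exec_Assign) (use 1 in auto)
      show "exec B (Assign X (SndE X)) (t(A := enc (h e ?acc z))) (Suc (size (enc zs))) ?t1"
        by (rule exec_Assign) (use tX nz in \<open>auto simp: enc_Cons\<close>)
    qed
    have time: "Suc ?time \<le> m ?n"
      using sz k acc acc2 zs by (simp add: m_def enc_Pair enc_Cons)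
    have "?t1 R = enc e" "?t1 A = enc (foldl (h e) (i e) (ys @ [z]))" "?t1 X = enc zs" "xs e = (ys @ [z]) @ zs"
      using tX nz Cons.prems(4) by auto
    from Cons.IH[OF this] obtain l u where 2: "exec B (While X body) ?t1 l u"
      "u A = enc (foldl (h e) (i e) (ys @ z # zs))" "l \<le> Suc (length zs * m ?n)" "\<forall>j\<ge>Suc X. u j = ?t1 j"
      unfolding append_assoc append_Cons append_Nil by blast
    have "exec B (While X body) s (Suc (?time + l)) u"
      by (rule exec.WhileTrue[OF _ body 2(1)]) (use Cons.prems in \<open>auto simp: enc_Cons\<close>)
    moreover have "\<forall>j\<ge>Suc X. u j = s j" using 1(4) 2(4) R by (auto simp: A_def X_def)
    moreover have "Suc (?time + l) \<le> Suc (length (z # zs) * m ?n)" using time 2(3) by simp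
    ultimately show ?case using 2(2) by blast
  qed
  show ?thesis
  proof (rule ptimeI[where c = cc and r = "Suc X" and q = q])
    show "polybd q" by fact
    fix e :: 'e and s :: state assume s: "s 0 = enc e"
    let ?n = "size (enc e)"
    let ?s1 = "s(R := enc e)"
    have nz: "A \<noteq> 0" "X \<noteq> 0" "R \<noteq> 0" "A \<noteq> X" "A \<noteq> R" "X \<noteq> R" using R by (auto simp: A_def X_def)
    obtain k t where 1: "exec B c0 ?s1 k t" "t 0 = enc (i e)" "k \<le> q0 ?n" "\<forall>i\<ge>r0. t i = ?s1 i"
      using c0[of ?s1 e] s nz by auto
    let ?t1 = "t(A := enc (i e), 0 := enc e)"
    have tR: "t R = enc e" using 1(4) R by simp
    obtain l u where 2: "exec B c1 ?t1 l u" "u 0 = enc (xs e)" "l \<le> q1 ?n" "\<forall>i\<ge>r1. u i = ?t1 i"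
      using c1[of ?t1 e] by auto
    let ?u1 = "u(X := enc (xs e))"
    have "?u1 R = enc e" "?u1 A = enc (foldl (h e) (i e) [])" "?u1 X = enc (xs e)" "xs e = [] @ xs e"
      using 2(4) R tR nz by (auto simp: A_def X_def)
    from loop[OF this] obtain j v where 3: "exec B (While X body) ?u1 j v"
      "v A = enc (foldl (h e) (i e) (xs e))" "j \<le> Suc (length (xs e) * m ?n)" "\<forall>i\<ge>Suc X. v i = ?u1 i"
      unfolding append_Nil by blast
    let ?res = "foldl (h e) (i e) (xs e)"
    have ie: "size (enc (i e)) \<le> b' ?n" using bd(2)[of e "[]"] b'(3)[of ?n] by (auto intro: order_trans)
    have re: "size (enc ?res) \<le> b' ?n" using bd(2)[of e "xs e" "[]"] b'(3)[of ?n] by (auto intro: order_trans)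
    let ?time = "Suc ?n + (k + (Suc (size (enc (i e))) + (Suc ?n + (l + (Suc (size (enc (xs e))) + (j + Suc (size (enc ?res))))))))"
    have ex: "exec B cc s ?time (v(0 := enc ?res))"
      unfolding cc_def
    proof (intro exec.Seq)
      show "exec B (Assign R (Var 0)) s (Suc ?n) ?s1" by (rule exec_Assign) (use s in auto)
      show "exec B c0 ?s1 k t" by fact
      show "exec B (Assign A (Var 0)) t (Suc (size (enc (i e)))) (t(A := enc (i e)))"
        by (rule exec_Assign) (use 1 in auto)
      show "exec B (Assign 0 (Var R)) (t(A := enc (i e))) (Suc ?n) ?t1"
        by (rule exec_Assign) (use tR nz in auto)
      show "exec B c1 ?t1 l u" by fact
      show "exec B (Assign X (Var 0)) u (Suc (size (enc (xs e)))) ?u1"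
        by (rule exec_Assign) (use 2 in auto)
      show "exec B (While X body) ?u1 j v" by fact
      show "exec B (Assign 0 (Var A)) v (Suc (size (enc ?res))) (v(0 := enc ?res))"
        by (rule exec_Assign) (use 3 in auto)
    qed
    have "length (xs e) * m ?n \<le> p ?n * m ?n" using len[of "xs e"] p(2)[of e] by (intro mult_le_mono1) linarith
    then have "j \<le> Suc (p ?n * m ?n)" using 3(3) by linarith
    then have "?time \<le> q ?n"
      using 1(3) 2(3) ie re p(2)[of e] unfolding q_def m_def by simp
    moreover have "\<forall>i\<ge>Suc X. (v(0 := enc ?res)) i = s i" using 1(4) 2(4) 3(4) R by (auto simp: A_def X_def)
    ultimately show "\<exists>k t. exec B cc s k t \<and> t 0 = enc ?res \<and> k \<le> q ?n \<and> (\<forall>i\<ge>Suc X. t i = s i)"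
      using ex by (intro exI[of _ ?time] exI[of _ "v(0 := enc ?res)"]) auto
  qed
qed

text \<open>The second hypothesis ranges over the whole input type, since a query outside
  \<open>instances B\<close> leaves the machine stuck. Algorithms therefore have to produce legal
  queries even from malformed tables.\<close>

lemma ptime_query:
  fixes f :: "'a::enc \<Rightarrow> 'b::enc"
  assumes "ptime B f" "\<And>a. enc (f a) \<in> instances B"
  shows "ptime B (\<lambda>a. enc (f a) \<in> yes_instances B)"
proof -
  obtain c r q where q: "polybd q" "mono q" "0 < r" and Cc: "computes B c r q f"
    by (rule ptimeE[OF assms(1)])
  obtain p where p: "polybd p" "\<And>a. size (enc (f a)) \<le> p (size (enc a))"
    using ptime_size[OF assms(1)] by blast
  show ?thesis
  proof (rule ptimeI[where c = "Seq c (Query 0 0)" and r = r and q = "\<lambda>n. q n + Suc (p n)"])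
    show "polybd (\<lambda>n. q n + Suc (p n))" by (intro polybd_intros q p)
    fix a :: 'a and s :: state assume "s 0 = enc a"
    from computesD[OF Cc, where s = s, OF this]
    obtain k t where 1: "exec B c s k t" "t 0 = enc (f a)" "k \<le> q (size (enc a))" "\<forall>i\<ge>r. t i = s i"
      by blast
    let ?u = "t(0 := bool_val (t 0 \<in> yes_instances B))"
    have "exec B (Query 0 0) t (Suc (size (t 0))) ?u"
      by (intro exec.Query) (simp add: assms(2) 1)
    then have "exec B (Seq c (Query 0 0)) s (k + Suc (size (t 0))) ?u"
      by (rule exec.Seq[OF 1(1)])
    moreover have "k + Suc (size (t 0)) \<le> q (size (enc a)) + Suc (p (size (enc a)))"
      using 1 p(2)[of a] by simp
    moreover have "?u 0 = enc (enc (f a) \<in> yes_instances B)" using 1 by (simp add: enc_bool_def)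
    moreover have "\<forall>i\<ge>r. ?u i = s i" using 1(4) q(3) by simp
    ultimately show "\<exists>k t. exec B (Seq c (Query 0 0)) s k t \<and> t 0 = enc (enc (f a) \<in> yes_instances B) \<and>
          k \<le> q (size (enc a)) + Suc (p (size (enc a))) \<and> (\<forall>i\<ge>r. t i = s i)"
      by blast
  qed
qed

text \<open>\<open>poly_time_reducible\<close> speaks about instances only, so \<open>f\<close> may
  return anything on values that encode no instance.\<close>

lemma ptime_imp_poly_time_reducible:
  fixes f :: "'b::enc \<Rightarrow> bool"
  assumes "ptime B f" "instances A \<subseteq> range (enc :: 'b \<Rightarrow> val)"
    and "\<And>a. enc a \<in> instances A \<Longrightarrow> f a \<longleftrightarrow> enc a \<in> yes_instances A"
  shows "poly_time_reducible A B"
proof -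
  obtain c r q where q: "polybd q" "mono q" "0 < r" and Cc: "computes B c r q f"
    by (rule ptimeE[OF assms(1)])
  note c = computesD[OF Cc]
  obtain d where d: "\<And>n. q n \<le> (n + 2) ^ d" using q unfolding polybd_def by blast
  \<comment> \<open>\<open>[:2, 1:]\<close> is the polynomial n + 2.\<close>
  have "\<exists>k t. exec B c (initial v) k t \<and> k \<le> poly ([:2, 1:] ^ d) (size v) \<and> (t 0 \<noteq> Atom \<longleftrightarrow> v \<in> yes_instances A)"
    if v: "v \<in> instances A" for v
  proof -
    obtain a :: 'b where a: "v = enc a" using assms(2) v by blast
    have "initial v 0 = enc a" by (simp add: initial_def a)
    from c[where s = "initial v", OF this] obtain k t where "exec B c (initial v) k t" "t 0 = enc (f a)" "k \<le> q (size v)"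
      using a by auto
    moreover have "poly ([:2, 1:] ^ d) (size v) = (size v + 2) ^ d" by (simp add: poly_power add.commute)
    ultimately show ?thesis
      using d[of "size v"] assms(3)[of a] v a by (intro exI[of _ k] exI[of _ t]) (auto simp: enc_bool_eq_Atom)
  qed
  then show ?thesis unfolding poly_time_reducible_def by blast
qed

section \<open>Closure properties: connectives, bounded quantifiers, list operations,
  iteration\<close>

named_theorems ptime_intros

lemmas [ptime_intros] = ptime_id ptime_const ptime_pair ptime_fst ptime_snd ptime_Cons ptime_tl ptime_if

lemma ptime_not [ptime_intros]: "ptime B P \<Longrightarrow> ptime B (\<lambda>a. \<not> P a)"
proof -
  assume "ptime B P"
  then have "ptime B (\<lambda>a. if P a then False else True)" by (intro ptime_intros)
  moreover have "(\<lambda>a. \<not> P a) = (\<lambda>a. if P a then False else True)" by auto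
  ultimately show ?thesis by simp
qed

lemma ptime_conj [ptime_intros]: "ptime B P \<Longrightarrow> ptime B Q \<Longrightarrow> ptime B (\<lambda>a. P a \<and> Q a)"
proof -
  assume "ptime B P" "ptime B Q"
  then have "ptime B (\<lambda>a. if P a then Q a else False)" by (intro ptime_intros)
  moreover have "(\<lambda>a. P a \<and> Q a) = (\<lambda>a. if P a then Q a else False)" by auto
  ultimately show ?thesis by simp
qed

lemma ptime_disj [ptime_intros]: "ptime B P \<Longrightarrow> ptime B Q \<Longrightarrow> ptime B (\<lambda>a. P a \<or> Q a)"
proof -
  assume "ptime B P" "ptime B Q"
  then have "ptime B (\<lambda>a. if P a then True else Q a)" by (intro ptime_intros)
  moreover have "(\<lambda>a. P a \<or> Q a) = (\<lambda>a. if P a then True else Q a)" by auto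
  ultimately show ?thesis by simp
qed

lemma ptime_imp [ptime_intros]: "ptime B P \<Longrightarrow> ptime B Q \<Longrightarrow> ptime B (\<lambda>a. P a \<longrightarrow> Q a)"
proof -
  assume "ptime B P" "ptime B Q"
  then have "ptime B (\<lambda>a. if P a then Q a else True)" by (intro ptime_intros)
  moreover have "(\<lambda>a. P a \<longrightarrow> Q a) = (\<lambda>a. if P a then Q a else True)" by auto
  ultimately show ?thesis by simp
qed

lemma size_enc_list: "size (enc xs) = (\<Sum>x\<leftarrow>xs. Suc (size (enc x)))"
  by (induction xs) (auto simp: enc_Nil enc_Cons)

lemma size_enc_append: "size (enc (xs @ ys)) = size (enc xs) + size (enc ys)"
  by (simp add: size_enc_list)

lemma size_enc_rev: "size (enc (rev xs)) = size (enc xs)"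
  by (simp add: size_enc_list rev_map[symmetric])

lemma size_enc_nat: "size (enc (n::nat)) = n"
  by (simp add: enc_nat_def size_enc_list enc_unit_def sum_list_replicate)

lemma size_enc_bool: "size (enc (b::bool)) \<le> 1"
  by (cases b) (simp_all add: enc_True enc_False)

lemma size_enc_filter: "size (enc (filter P xs)) \<le> size (enc xs)"
  by (induction xs) (auto simp: enc_Nil enc_Cons)

lemma size_enc_member: "x \<in> set xs \<Longrightarrow> size (enc x) \<le> size (enc xs)"
  by (induction xs) (auto simp: enc_Cons)

lemma length_le_size_enc: "length xs \<le> size (enc xs)"
  by (induction xs) (auto simp: enc_Cons)

text \<open>The body is a predicate on the pair of environment and bound element, because one
  program must serve all elements. All rules with bound variables follow this convention.\<close>

lemma ptime_bex [ptime_intros]: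
  assumes "ptime B xs" "ptime B (\<lambda>p. P (fst p) (snd p))"
  shows "ptime B (\<lambda>e. \<exists>x\<in>set (xs e). P e x)"
proof -
  have eq: "foldl (\<lambda>acc x. acc \<or> P e x) b ys \<longleftrightarrow> b \<or> (\<exists>x\<in>set ys. P e x)" for e b ys
    by (induction ys arbitrary: b) auto
  have "ptime B (\<lambda>e. foldl (\<lambda>acc x. acc \<or> P e x) False (xs e))"
  proof (rule ptime_foldl)
    have "ptime B (\<lambda>p. P (fst p) (snd (snd p)))" 
      using ptime_comp[OF ptime_pair[OF ptime_fst[OF ptime_id] ptime_snd[OF ptime_snd[OF ptime_id]]] assms(2)] by simp
    then show "ptime B (\<lambda>p. fst (snd p) \<or> P (fst p) (snd (snd p)))" by (intro ptime_intros)
    show "polybd (\<lambda>n. 1)" by (rule polybd_const)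
  qed (use size_enc_bool in \<open>auto intro: ptime_const assms\<close>)
  then show ?thesis by (simp add: eq)
qed

lemma ptime_ball [ptime_intros]:
  assumes "ptime B xs" "ptime B (\<lambda>p. P (fst p) (snd p))"
  shows "ptime B (\<lambda>e. \<forall>x\<in>set (xs e). P e x)"
proof -
  have "ptime B (\<lambda>e. \<not> (\<exists>x\<in>set (xs e). \<not> P e x))" by (intro ptime_intros assms)
  then show ?thesis by simp
qed

lemma ptime_subst2:
  assumes "ptime B (\<lambda>p. P (fst p) (snd p))" "ptime B f" "ptime B g"
  shows "ptime B (\<lambda>e. P (f e) (g e))"
  using ptime_comp[OF ptime_pair[OF assms(2,3)] assms(1)] by simp

lemma ptime_subst3:
  assumes "ptime B (\<lambda>p. P (fst p) (fst (snd p)) (snd (snd p)))" "ptime B f" "ptime B g" "ptime B h"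
  shows "ptime B (\<lambda>e. P (f e) (g e) (h e))"
  using ptime_comp[OF ptime_pair[OF assms(2) ptime_pair[OF assms(3,4)]] assms(1)] by simp

lemma foldl_Cons: "foldl (\<lambda>acc x. f x # acc) ys xs = rev (map f xs) @ ys"
  by (induction xs arbitrary: ys) auto

lemma ptime_rev [ptime_intros]:
  assumes "ptime B xs"
  shows "ptime B (\<lambda>e. rev (xs e))"
proof -
  obtain p where p: "polybd p" "\<And>a. size (enc (xs a)) \<le> p (size (enc a))"
    using ptime_size[OF assms] by blast
  have "ptime B (\<lambda>e. foldl (\<lambda>acc x. x # acc) [] (xs e))"
  proof (rule ptime_foldl)
    show "polybd p" by fact
    fix e ys zs assume e: "xs e = ys @ zs"
    have "size (enc (rev ys)) \<le> size (enc (xs e))" by (simp add: e size_enc_rev size_enc_append)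
    then show "size (enc (foldl (\<lambda>acc x. x # acc) [] ys)) \<le> p (size (enc e))"
      using p(2)[of e] by (simp add: foldl_Cons[of "\<lambda>x. x", simplified])
  qed (intro ptime_intros assms)+
  then show ?thesis by (simp add: foldl_Cons[of "\<lambda>x. x", simplified])
qed

lemma ptime_append [ptime_intros]:
  assumes "ptime B xs" "ptime B ys"
  shows "ptime B (\<lambda>e. xs e @ ys e)"
proof -
  obtain p where p: "polybd p" "\<And>a. size (enc (xs a)) \<le> p (size (enc a))"
    using ptime_size[OF assms(1)] by blast
  obtain q where q: "polybd q" "\<And>a. size (enc (ys a)) \<le> q (size (enc a))"
    using ptime_size[OF assms(2)] by blast
  have "ptime B (\<lambda>e. foldl (\<lambda>acc x. x # acc) (ys e) (rev (xs e)))"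
  proof (rule ptime_foldl)
    show "polybd (\<lambda>n. p n + q n)" by (intro polybd_intros p q)
    fix e us vs assume e: "rev (xs e) = us @ vs"
    have "size (enc (rev us)) \<le> size (enc (rev (xs e)))" by (simp only: e size_enc_rev size_enc_append)
    then show "size (enc (foldl (\<lambda>acc x. x # acc) (ys e) us)) \<le> p (size (enc e)) + q (size (enc e))"
      using p(2)[of e] q(2)[of e] by (simp add: foldl_Cons[of "\<lambda>x. x", simplified] size_enc_append size_enc_rev)
  qed (intro ptime_intros assms)+
  then show ?thesis by (simp add: foldl_Cons[of "\<lambda>x. x", simplified])
qed

lemma ptime_map [ptime_intros]:
  assumes "ptime B xs" "ptime B (\<lambda>p. h (fst p) (snd p))"
  shows "ptime B (\<lambda>e. map (h e) (xs e))"
proof -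
  obtain p where p: "polybd p" "\<And>a. size (enc (xs a)) \<le> p (size (enc a))"
    using ptime_size[OF assms(1)] by blast
  obtain q where q: "polybd q" "mono q" "\<And>a. size (enc (h (fst a) (snd a))) \<le> q (size (enc a))"
    using ptime_size[OF assms(2)] by blast
  have "ptime B (\<lambda>e. foldl (\<lambda>acc x. h e x # acc) [] (xs e))"
  proof (rule ptime_foldl)
    have "ptime B (\<lambda>p. h (fst p) (snd (snd p)))" by (intro ptime_subst2[OF assms(2)] ptime_intros)
    then show "ptime B (\<lambda>p. h (fst p) (snd (snd p)) # fst (snd p))" by (intro ptime_intros)
    show "polybd (\<lambda>n. p n * Suc (q (Suc (n + p n))))"
      by (intro polybd_intros p polybd_comp[of "\<lambda>n. Suc (n + p n)" q] q)
    fix e ys zs assume e: "xs e = ys @ zs"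
    let ?n = "size (enc e)"
    have "size (enc (h e x)) \<le> q (Suc (?n + p ?n))" if "x \<in> set ys" for x
    proof -
      have "x \<in> set (xs e)" using that e by simp
      from size_enc_member[OF this] have "size (enc (e, x)) \<le> Suc (?n + p ?n)"
        using p(2)[of e] by (simp add: enc_Pair)
      then show ?thesis using q(3)[of "(e, x)"] q(2) by (auto intro: order_trans dest: monoD)
    qed
    then have "(\<Sum>x\<leftarrow>ys. Suc (size (enc (h e x)))) \<le> (\<Sum>x\<leftarrow>ys. Suc (q (Suc (?n + p ?n))))"
      by (intro sum_list_mono) auto
    also have "\<dots> = length ys * Suc (q (Suc (?n + p ?n)))" by (simp add: sum_list_triv)
    also have "\<dots> \<le> p ?n * Suc (q (Suc (?n + p ?n)))"
      using length_le_size_enc[of "xs e"] p(2)[of e] e by (intro mult_le_mono1) simp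
    finally show "size (enc (foldl (\<lambda>acc x. h e x # acc) [] ys)) \<le> p ?n * Suc (q (Suc (?n + p ?n)))"
      by (simp add: foldl_Cons size_enc_rev) (simp add: size_enc_list o_def)
  qed (intro ptime_intros assms)+
  then have "ptime B (\<lambda>e. rev (foldl (\<lambda>acc x. h e x # acc) [] (xs e)))" by (intro ptime_intros)
  then show ?thesis by (simp add: foldl_Cons)
qed

lemma ptime_filter [ptime_intros]:
  assumes "ptime B xs" "ptime B (\<lambda>p. P (fst p) (snd p))"
  shows "ptime B (\<lambda>e. filter (P e) (xs e))"
proof -
  have eq: "foldl (\<lambda>acc x. if P e x then x # acc else acc) us ys = rev (filter (P e) ys) @ us" for e us ys
    by (induction ys arbitrary: us) auto
  obtain p where p: "polybd p" "\<And>a. size (enc (xs a)) \<le> p (size (enc a))"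
    using ptime_size[OF assms(1)] by blast
  have "ptime B (\<lambda>e. foldl (\<lambda>acc x. if P e x then x # acc else acc) [] (xs e))"
  proof (rule ptime_foldl)
    have "ptime B (\<lambda>p. P (fst p) (snd (snd p)))" by (intro ptime_subst2[OF assms(2)] ptime_intros)
    then show "ptime B (\<lambda>p. if P (fst p) (snd (snd p)) then snd (snd p) # fst (snd p) else fst (snd p))"
      by (intro ptime_intros)
    show "polybd p" by fact
    fix e ys zs assume e: "xs e = ys @ zs"
    have "size (enc (filter (P e) ys)) \<le> size (enc (xs e))"
      using size_enc_filter[of "P e" ys] by (simp add: e size_enc_append)
    then show "size (enc (foldl (\<lambda>acc x. if P e x then x # acc else acc) [] ys)) \<le> p (size (enc e))"
      using p(2)[of e] by (simp add: eq size_enc_rev)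
  qed (intro ptime_intros assms)+
  then have "ptime B (\<lambda>e. rev (foldl (\<lambda>acc x. if P e x then x # acc else acc) [] (xs e)))" by (intro ptime_intros)
  then show ?thesis by (simp add: eq)
qed

lemma ptime_concat [ptime_intros]:
  assumes "ptime B xss"
  shows "ptime B (\<lambda>e. concat (xss e))"
proof -
  have eq: "foldl (\<lambda>acc x. acc @ x) us ys = us @ concat ys" for us :: "'z list" and ys
    by (induction ys arbitrary: us) auto
  have sz: "size (enc (concat ys)) \<le> size (enc ys)" for ys :: "'b list list"
    by (induction ys) (auto simp: enc_Nil enc_Cons size_enc_append)
  obtain p where p: "polybd p" "\<And>a. size (enc (xss a)) \<le> p (size (enc a))"
    using ptime_size[OF assms(1)] by blast
  have "ptime B (\<lambda>e. foldl (\<lambda>acc x. acc @ x) [] (xss e))"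
  proof (rule ptime_foldl)
    show "polybd p" by fact
    fix e ys zs assume e: "xss e = ys @ zs"
    have "size (enc (concat ys)) \<le> size (enc (xss e))"
      using sz[of ys] by (simp add: e size_enc_append)
    then show "size (enc (foldl (\<lambda>acc x. acc @ x) [] ys)) \<le> p (size (enc e))"
      using p(2)[of e] by (simp add: eq)
  qed (intro ptime_intros assms)+
  then show ?thesis by (simp add: eq)
qed

lemma ptime_replicate: "ptime B n \<Longrightarrow> ptime B (\<lambda>e. replicate (n e) ())"
  by (erule ptime_cong_enc) (simp add: enc_nat_def)

lemma ptime_of_replicate: "ptime B (\<lambda>e. replicate (n e) ()) \<Longrightarrow> ptime B n"
  by (erule ptime_cong_enc) (simp add: enc_nat_def)

lemma ptime_length [ptime_intros]: "ptime B xs \<Longrightarrow> ptime B (\<lambda>e. length (xs e))"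
proof (rule ptime_of_replicate)
  assume "ptime B xs"
  then have "ptime B (\<lambda>e. map (\<lambda>x. ()) (xs e))" by (intro ptime_intros)
  then show "ptime B (\<lambda>e. replicate (length (xs e)) ())" by (simp add: map_replicate_const)
qed

lemma ptime_Suc [ptime_intros]: "ptime B n \<Longrightarrow> ptime B (\<lambda>e. Suc (n e))"
  by (rule ptime_of_replicate) (auto intro!: ptime_intros ptime_replicate)

lemma foldl_funpow: "foldl (\<lambda>S _. f S) S (replicate k u) = (f ^^ k) S"
  by (induction k arbitrary: S) (auto simp: funpow_swap1)

lemma ptime_funpow:
  fixes step :: "'e::enc \<Rightarrow> 's::enc \<Rightarrow> 's"
  assumes "ptime B (\<lambda>p. step (fst p) (snd p))" "ptime B i" "ptime B k"
    and bd: "polybd b" "\<And>e j. j \<le> k e \<Longrightarrow> size (enc ((step e ^^ j) (i e))) \<le> b (size (enc e))"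
  shows "ptime B (\<lambda>e. (step e ^^ k e) (i e))"
proof -
  have "ptime B (\<lambda>e. foldl (\<lambda>S _. step e S) (i e) (replicate (k e) ()))"
  proof (rule ptime_foldl)
    show "ptime B (\<lambda>p. step (fst p) (fst (snd p)))" by (intro ptime_subst2[OF assms(1)] ptime_intros)
    show "polybd b" by fact
    fix e ys zs assume "replicate (k e) () = ys @ zs"
    then have "length ys \<le> k e" "ys = replicate (length ys) ()"
      by (metis length_append length_replicate le_add1) (auto simp: list_eq_iff_nth_eq)
    then show "size (enc (foldl (\<lambda>S _. step e S) (i e) ys)) \<le> b (size (enc e))"
      using bd(2)[of "length ys" e] by (metis foldl_funpow)
  qed (intro assms ptime_replicate)+
  then show ?thesis by (simp add: foldl_funpow)
qed

text \<open>Every iterate after the start is a sublist of the fixed list \<open>xs e\<close>, so the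
  size bound demanded by \<open>ptime_funpow\<close> is automatic. For this reason closures and
  fixed points are phrased as repeated filtering of a ground set.\<close>

lemma ptime_funpow_filter [ptime_intros]:
  fixes xs :: "'e::enc \<Rightarrow> 'x::enc list" and P :: "'e \<Rightarrow> 'x list \<Rightarrow> 'x \<Rightarrow> bool"
  assumes "ptime B (\<lambda>p. P (fst p) (fst (snd p)) (snd (snd p)))" "ptime B xs" "ptime B i" "ptime B k"
  shows "ptime B (\<lambda>e. ((\<lambda>S. filter (\<lambda>y. P e S y) (xs e)) ^^ k e) (i e))"
proof -
  obtain p where p: "polybd p" "\<And>a. size (enc (xs a)) \<le> p (size (enc a))"
    using ptime_size[OF assms(2)] by blast
  obtain q where q: "polybd q" "\<And>a. size (enc (i a)) \<le> q (size (enc a))"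
    using ptime_size[OF assms(3)] by blast
  show ?thesis
  proof (rule ptime_funpow[where step = "\<lambda>e S. filter (P e S) (xs e)"])
    show "ptime B (\<lambda>p. filter (P (fst p) (snd p)) (xs (fst p)))"
      by (intro ptime_filter ptime_subst3[OF assms(1)] ptime_intros ptime_comp[OF _ assms(2)])
    show "polybd (\<lambda>n. p n + q n)" by (intro polybd_intros p q)
    fix e j
    show "size (enc (((\<lambda>S. filter (P e S) (xs e)) ^^ j) (i e))) \<le> p (size (enc e)) + q (size (enc e))"
    proof (cases j)
      case 0 then show ?thesis using q(2)[of e] by simp
    next
      case (Suc j')
      then show ?thesis using p(2)[of e] size_enc_filter[of _ "xs e"]
        by (auto intro: order_trans trans_le_add1)
    qed
  qed (intro assms)+
qed

lemma ptime_drop [ptime_intros]: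
  assumes "ptime B n" "ptime B xs"
  shows "ptime B (\<lambda>e. drop (n e) (xs e))"
proof -
  have eq: "(tl ^^ k) ys = drop k ys" for k and ys :: "'z list"
    by (induction k) (auto simp: drop_Suc tl_drop)
  obtain p where p: "polybd p" "\<And>a. size (enc (xs a)) \<le> p (size (enc a))"
    using ptime_size[OF assms(2)] by blast
  have "ptime B (\<lambda>e. (tl ^^ n e) (xs e))"
  proof (rule ptime_funpow)
    show "polybd p" by fact
    fix e j
    have "size (enc (drop j (xs e))) \<le> size (enc (take j (xs e) @ drop j (xs e)))"
      unfolding size_enc_append by simp
    then show "size (enc ((tl ^^ j) (xs e))) \<le> p (size (enc e))"
      using p(2)[of e] by (simp add: eq)
  qed (intro ptime_intros assms)+
  then show ?thesis by (simp add: eq)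
qed

lemma ptime_is_Nil [ptime_intros]: "ptime B xs \<Longrightarrow> ptime B (\<lambda>e. xs e = [])"
proof -
  assume "ptime B xs"
  then have "ptime B (\<lambda>e. \<not> (\<exists>x\<in>set (xs e). True))" by (intro ptime_intros)
  then show ?thesis by simp
qed

lemma ptime_le [ptime_intros]:
  fixes m n :: "'e::enc \<Rightarrow> nat"
  assumes "ptime B m" "ptime B n"
  shows "ptime B (\<lambda>e. m e \<le> n e)"
proof -
  have "ptime B (\<lambda>e. drop (n e) (replicate (m e) ()) = [])" by (intro ptime_intros ptime_replicate assms)
  then show ?thesis by simp
qed

lemma ptime_eq [ptime_intros]:
  fixes m n :: "'e::enc \<Rightarrow> nat"
  assumes "ptime B m" "ptime B n"
  shows "ptime B (\<lambda>e. m e = n e)"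
  using ptime_conj[OF ptime_le[OF assms] ptime_le[OF assms(2,1)]] by (simp add: eq_iff)

lemma ptime_eq_bool [ptime_intros]:
  fixes P Q :: "'e::enc \<Rightarrow> bool"
  assumes "ptime B P" "ptime B Q"
  shows "ptime B (\<lambda>e. P e = Q e)"
  using ptime_conj[OF ptime_imp[OF assms] ptime_imp[OF assms(2,1)]] by (simp add: iff_conv_conj_imp)

lemma ptime_mem [ptime_intros]:
  fixes x :: "'e::enc \<Rightarrow> nat"
  assumes "ptime B x" "ptime B xs"
  shows "ptime B (\<lambda>e. x e \<in> set (xs e))"
proof -
  have "ptime B (\<lambda>e. \<exists>y\<in>set (xs e). y = x e)"
    by (intro ptime_intros assms ptime_comp[OF _ assms(1)])
  then show ?thesis by simp
qed

lemma ptime_upt [ptime_intros]: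
  assumes "ptime B n"
  shows "ptime B (\<lambda>e. [0..<n e])"
proof -
  have eq: "((\<lambda>l. l @ [length l]) ^^ k) [] = [0..<k]" for k by (induction k) auto
  obtain q where q: "polybd q" "\<And>a. size (enc (n a)) \<le> q (size (enc a))"
    using ptime_size[OF assms] by blast
  have sz: "size (enc [0..<k]) \<le> k * k" for k
    by (induction k) (auto simp: enc_Nil size_enc_append enc_Cons size_enc_nat)
  have "ptime B (\<lambda>e. ((\<lambda>l. l @ [length l]) ^^ n e) [])"
  proof (rule ptime_funpow)
    show "polybd (\<lambda>n. q n * q n)" by (intro polybd_intros q)
    fix e j assume "j \<le> n e"
    then have "j \<le> q (size (enc e))" using q(2)[of e] by (simp add: size_enc_nat)
    then have "j * j \<le> q (size (enc e)) * q (size (enc e))" by (intro mult_le_mono)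
    then show "size (enc (((\<lambda>l. l @ [length l]) ^^ j) [])) \<le> q (size (enc e)) * q (size (enc e))"
      using sz[of j] by (simp add: eq)
  qed (intro ptime_intros assms)+
  then show ?thesis by (simp add: eq)
qed

text \<open>Lookup is total. A default with encoding \<open>Atom\<close> makes it agree with
  \<open>FstE\<close> applied to an exhausted list.\<close>

definition nthd :: "'x \<Rightarrow> 'x list \<Rightarrow> nat \<Rightarrow> 'x" where
  "nthd d xs i = (if i < length xs then xs ! i else d)"

lemma ptime_nthd:
  fixes d :: "'x::enc"
  assumes d: "enc d = Atom" and "ptime B xs" "ptime B i"
  shows "ptime B (\<lambda>e. nthd d (xs e) (i e))"
proof -
  have "ptime B (\<lambda>ys :: 'x list. case ys of [] \<Rightarrow> d | y # _ \<Rightarrow> y)"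
  proof (rule ptime_basic[where e = "FstE 0"])
    fix ys :: "'x list" and s :: state assume "s 0 = enc ys"
    then show "eval_expr s (FstE 0) = enc (case ys of [] \<Rightarrow> d | y # _ \<Rightarrow> y)"
      by (cases ys) (auto simp: enc_Nil enc_Cons d)
  qed
  from ptime_comp[OF ptime_drop[OF assms(3,2)] this]
  have "ptime B (\<lambda>e. case drop (i e) (xs e) of [] \<Rightarrow> d | y # _ \<Rightarrow> y)" .
  moreover have "(case drop k ys of [] \<Rightarrow> d | y # _ \<Rightarrow> y) = nthd d ys k" for k and ys :: "'x list"
    by (cases "k < length ys") (auto simp: nthd_def Cons_nth_drop_Suc[symmetric])
  ultimately show ?thesis by simp
qed

lemma ptime_nth_bool [ptime_intros]: "ptime B xs \<Longrightarrow> ptime B i \<Longrightarrow> ptime B (\<lambda>e. nthd False (xs e) (i e))"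
  by (rule ptime_nthd) (simp_all add: enc_False)

lemma ptime_nth_nat [ptime_intros]: "ptime B xs \<Longrightarrow> ptime B i \<Longrightarrow> ptime B (\<lambda>e. nthd (0::nat) (xs e) (i e))"
  by (rule ptime_nthd) (simp_all add: enc_nat_def enc_Nil)

lemma ptime_nth_list [ptime_intros]: "ptime B xs \<Longrightarrow> ptime B i \<Longrightarrow> ptime B (\<lambda>e. nthd [] (xs e) (i e))"
  by (rule ptime_nthd) (simp_all add: enc_Nil)

text \<open>\<open>k\<close> is a constant, not an input: the induction builds a different program
  for each \<open>k\<close>, and the degree of its time bound may grow with
  \<open>k\<close>.\<close>

lemma ptime_n_lists [ptime_intros]:
  assumes "ptime B xs"
  shows "ptime B (\<lambda>e. List.n_lists k (xs e))"
proof (induction k)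
  case (Suc k)
  show ?case unfolding List.n_lists.simps by (intro ptime_intros Suc assms ptime_comp[OF _ assms])
qed (simp add: ptime_const)

lemma ptime_map_const:
  "(\<And>c. c \<in> set cs \<Longrightarrow> ptime B (f c)) \<Longrightarrow> ptime B (\<lambda>e. map (\<lambda>c. f c e) cs)"
  by (induction cs) (auto intro: ptime_intros)

lemma ptime_bex_finite:
  assumes "finite C" "\<And>c. c \<in> C \<Longrightarrow> ptime B (P c)"
  shows "ptime B (\<lambda>e. \<exists>c\<in>C. P c e)"
  using assms by induction (auto intro: ptime_intros)

lemma ptime_ball_finite:
  assumes "finite C" "\<And>c. c \<in> C \<Longrightarrow> ptime B (P c)"
  shows "ptime B (\<lambda>e. \<forall>c\<in>C. P c e)"
  using assms by induction (auto intro: ptime_intros)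

section \<open>Satisfiability with two values\<close>

text \<open>\<open>(v, b)\<close> is the literal saying that \<open>v\<close> takes the value
  \<open>b\<close>, and \<open>inc l m\<close> is a 2-clause forbidding \<open>l\<close> and
  \<open>m\<close> together. The relation is the usual implication graph; \<open>inc l l\<close>
  acts as a unit clause and gives an arrow from \<open>l\<close> to its negation.\<close>

definition imp_step :: "'v set \<Rightarrow> ('v \<times> bool \<Rightarrow> 'v \<times> bool \<Rightarrow> bool) \<Rightarrow> 'v \<times> bool \<Rightarrow> 'v \<times> bool \<Rightarrow> bool" where
  "imp_step V inc l m \<longleftrightarrow> fst l \<in> V \<and> fst m \<in> V \<and> inc l (fst m, \<not> snd m)"

lemma imp_step_contrapos:
  assumes sym: "\<And>l m. inc l m \<Longrightarrow> inc m l" and "(imp_step V inc)\<^sup>*\<^sup>* l m"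
  shows "(imp_step V inc)\<^sup>*\<^sup>* (fst m, \<not> snd m) (fst l, \<not> snd l)"
  using assms(2)
proof induction
  case (step m n)
  then have "imp_step V inc (fst n, \<not> snd n) (fst m, \<not> snd m)"
    by (auto simp: imp_step_def dest: sym)
  then show ?case using step.IH by (rule converse_rtranclp_into_rtranclp)
qed simp

lemma two_sat:
  fixes inc :: "'v \<times> bool \<Rightarrow> 'v \<times> bool \<Rightarrow> bool"
  assumes fin: "finite V" and sym: "\<And>l m. inc l m \<Longrightarrow> inc m l"
  shows "(\<exists>\<sigma>. \<forall>v\<in>V. \<forall>w\<in>V. \<not> inc (v, \<sigma> v) (w, \<sigma> w)) \<longleftrightarrow>
    (\<forall>v\<in>V. \<not> ((imp_step V inc)\<^sup>*\<^sup>* (v, True) (v, False) \<and> (imp_step V inc)\<^sup>*\<^sup>* (v, False) (v, True)))"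
    (is "?L \<longleftrightarrow> ?R")
proof
  assume ?L
  then obtain \<sigma> where \<sigma>: "\<And>v w. v \<in> V \<Longrightarrow> w \<in> V \<Longrightarrow> \<not> inc (v, \<sigma> v) (w, \<sigma> w)" by blast
  have *: "\<sigma> (fst m) = snd m" if "(imp_step V inc)\<^sup>*\<^sup>* l m" "\<sigma> (fst l) = snd l" for l m
    using that
  proof induction
    case (step m n)
    then have "inc (fst m, \<sigma> (fst m)) (fst n, \<not> snd n)" "fst m \<in> V" "fst n \<in> V"
      by (auto simp: imp_step_def)
    then show ?case using \<sigma>[of "fst m" "fst n"] by (cases "snd n"; cases "\<sigma> (fst n)") auto
  qed
  show ?R
  proof (intro ballI notI)
    fix v assume "v \<in> V" "(imp_step V inc)\<^sup>*\<^sup>* (v, True) (v, False) \<and> (imp_step V inc)\<^sup>*\<^sup>* (v, False) (v, True)"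
    then show False using *[of "(v, True)" "(v, False)"] *[of "(v, False)" "(v, True)"] by (cases "\<sigma> v") auto
  qed
next
  assume R: ?R
  let ?step = "imp_step V inc"
  \<comment> \<open>Partial assignments are sets of literals, closed under implication and free of
    contradiction, that are extended one variable at a time.\<close>
  have "\<exists>S. (\<forall>l\<in>S. \<forall>m. ?step l m \<longrightarrow> m \<in> S) \<and> (\<forall>v. \<not> ((v, True) \<in> S \<and> (v, False) \<in> S)) \<and>
      (\<forall>v\<in>W. (v, True) \<in> S \<or> (v, False) \<in> S)" if "W \<subseteq> V" for W
    using finite_subset[OF that fin] that
  proof (induction W rule: finite_induct)
    case empty
    show ?case by (rule exI[of _ "{}"]) simp
  next
    case (insert v W)
    from insert.prems have "W \<subseteq> V" by simp
    from insert.IH[OF this] obtain S where S': "\<forall>l\<in>S. \<forall>m. ?step l m \<longrightarrow> m \<in> S"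
      "\<forall>v. \<not> ((v, True) \<in> S \<and> (v, False) \<in> S)" "\<forall>v\<in>W. (v, True) \<in> S \<or> (v, False) \<in> S" by blast
    have S: "\<And>l m. l \<in> S \<Longrightarrow> ?step l m \<Longrightarrow> m \<in> S" "\<And>v. \<not> ((v, True) \<in> S \<and> (v, False) \<in> S)"
      "\<And>v. v \<in> W \<Longrightarrow> (v, True) \<in> S \<or> (v, False) \<in> S"
      using S' by blast+
    have closed: "m \<in> S" if "?step\<^sup>*\<^sup>* l m" "l \<in> S" for l m
      using that by induction (auto intro: S(1))
    show ?case
    proof (cases "(v, True) \<in> S \<or> (v, False) \<in> S")
      case True
      then show ?thesis using S by (intro exI[of _ S]) auto
    next
      case False
      have "v \<in> V" using insert.prems by simp
      then obtain b where b: "\<not> ?step\<^sup>*\<^sup>* (v, b) (v, \<not> b)" using R by (metis (full_types))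
      let ?S = "S \<union> {m. ?step\<^sup>*\<^sup>* (v, b) m}"
      have rev: "?step\<^sup>*\<^sup>* (w, \<not> c) (v, \<not> b)" if "?step\<^sup>*\<^sup>* (v, b) (w, c)" for w c
        using imp_step_contrapos[OF sym that] by simp
      \<comment> \<open>By contraposition a clash would lead from \<open>(w, c)\<close> to
        \<open>(v, \<not> b)\<close>, which is neither in the closed set \<open>S\<close> nor
        reachable from \<open>(v, b)\<close>.\<close>
      have cons: False if "(w, c) \<in> ?S" "(w, \<not> c) \<in> {m. ?step\<^sup>*\<^sup>* (v, b) m}" for w c
      proof -
        have "?step\<^sup>*\<^sup>* (w, c) (v, \<not> b)" using rev[of w "\<not> c"] that(2) by simp
        then have "(v, \<not> b) \<in> S \<or> ?step\<^sup>*\<^sup>* (v, b) (v, \<not> b)"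
          using that(1) closed by (auto intro: rtranclp_trans)
        then show False using b False by (cases b) auto
      qed
      have "\<forall>w. \<not> ((w, True) \<in> ?S \<and> (w, False) \<in> ?S)"
        using S(2) cons[of _ True] cons[of _ False] by auto
      moreover have "\<forall>l\<in>?S. \<forall>m. ?step l m \<longrightarrow> m \<in> ?S"
        using S(1) by (auto intro: rtranclp.rtrancl_into_rtrancl)
      moreover have "\<forall>u\<in>insert v W. (u, True) \<in> ?S \<or> (u, False) \<in> ?S"
        using S(3) by (cases b) auto
      ultimately show ?thesis by blast
    qed
  qed
  from this[OF subset_refl] obtain S where S': "\<forall>l\<in>S. \<forall>m. ?step l m \<longrightarrow> m \<in> S"
      "\<forall>v. \<not> ((v, True) \<in> S \<and> (v, False) \<in> S)" "\<forall>v\<in>V. (v, True) \<in> S \<or> (v, False) \<in> S" by blast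
  have S: "\<And>l m. l \<in> S \<Longrightarrow> ?step l m \<Longrightarrow> m \<in> S" "\<And>v. \<not> ((v, True) \<in> S \<and> (v, False) \<in> S)"
      "\<And>v. v \<in> V \<Longrightarrow> (v, True) \<in> S \<or> (v, False) \<in> S"
    using S' by blast+
  define \<sigma> where "\<sigma> v \<longleftrightarrow> (v, True) \<in> S" for v
  have \<sigma>: "(v, \<sigma> v) \<in> S" "(v, \<not> \<sigma> v) \<notin> S" if "v \<in> V" for v
    using S(2)[of v] S(3)[OF that] by (cases "(v, True) \<in> S"; simp add: \<sigma>_def)+
  show ?L
  proof (intro exI[of _ \<sigma>] ballI notI)
    fix v w assume "v \<in> V" "w \<in> V" "inc (v, \<sigma> v) (w, \<sigma> w)"
    then have "?step (v, \<sigma> v) (w, \<not> \<sigma> w)" by (simp add: imp_step_def)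
    then show False using S(1) \<sigma> \<open>v \<in> V\<close> \<open>w \<in> V\<close> by blast
  qed
qed


section \<open>Constraint satisfaction with two sides\<close>

definition csp :: "('v \<Rightarrow> 'v \<Rightarrow> 'a \<Rightarrow> 'a \<Rightarrow> bool) \<Rightarrow> 'v set \<Rightarrow> ('v \<Rightarrow> 'a set) \<Rightarrow> bool" where
  "csp ok V L \<longleftrightarrow> (\<exists>f. (\<forall>v\<in>V. f v \<in> L v) \<and> (\<forall>u\<in>V. \<forall>v\<in>V. u \<noteq> v \<longrightarrow> ok u v (f u) (f v)))"

text \<open>
  The domain is split into two sides with one distinguished value \<open>sp b\<close> on each side \<open>b\<close>. If a
  variable takes side \<open>b\<close>, then the variables that it reaches by \<open>side_step\<close> have to take side \<open>b\<close>, too.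
\<close>

definition side_step ::
  "('v \<Rightarrow> 'v \<Rightarrow> 'a \<Rightarrow> 'a \<Rightarrow> bool) \<Rightarrow> 'v set \<Rightarrow> (bool \<Rightarrow> 'v \<Rightarrow> 'a set) \<Rightarrow> (bool \<Rightarrow> 'a) \<Rightarrow> bool \<Rightarrow> 'v \<Rightarrow> 'v \<Rightarrow> bool" where
  "side_step ok V L sp b u v \<longleftrightarrow> u \<in> V \<and> v \<in> V \<and> u \<noteq> v \<and> sp b \<notin> L b u \<and>
     (\<exists>c\<in>L b u. \<exists>d\<in>L b v. \<not> ok u v c d)"

definition side_cluster ::
  "('v \<Rightarrow> 'v \<Rightarrow> 'a \<Rightarrow> 'a \<Rightarrow> bool) \<Rightarrow> 'v set \<Rightarrow> (bool \<Rightarrow> 'v \<Rightarrow> 'a set) \<Rightarrow> (bool \<Rightarrow> 'a) \<Rightarrow> bool \<Rightarrow> 'v \<Rightarrow> 'v set" where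
  "side_cluster ok V L sp b v = {w. (side_step ok V L sp b)\<^sup>*\<^sup>* v w}"

text \<open>The 2-clauses for the choice of sides. Equal variables: a unit clause forbidding a side
  on which the cluster is unsolvable. Equal sides: only a clash of two special values, as all other
  same-side conflicts are inside clusters. Different sides: one bad pair of values suffices, since
  compatibility across the cut will not depend on the values.\<close>

definition side_inc ::
  "('v \<Rightarrow> 'v \<Rightarrow> 'a \<Rightarrow> 'a \<Rightarrow> bool) \<Rightarrow> 'v set \<Rightarrow> (bool \<Rightarrow> 'v \<Rightarrow> 'a set) \<Rightarrow> (bool \<Rightarrow> 'a) \<Rightarrow> 'v \<times> bool \<Rightarrow> 'v \<times> bool \<Rightarrow> bool" where
  "side_inc ok V L sp l m \<longleftrightarrow>
     (if fst l = fst m then snd l = snd m \<and> \<not> csp ok (side_cluster ok V L sp (snd l) (fst l)) (L (snd l))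
      else if snd l = snd m then sp (snd l) \<in> L (snd l) (fst l) \<and> sp (snd l) \<in> L (snd l) (fst m) \<and>
        \<not> ok (fst l) (fst m) (sp (snd l)) (sp (snd l))
      else \<exists>c\<in>L (snd l) (fst l). \<exists>d\<in>L (snd m) (fst m). \<not> ok (fst l) (fst m) c d)"

text \<open>\<open>special\<close> determines the value of a variable that admits
  \<open>sp b\<close>, once it takes side \<open>b\<close>; \<open>cross\<close> makes compatibility
  between the sides a matter of the variables alone; \<open>forced\<close> says that a conflict on
  one side that involves a non-special variable cannot be evaded by moving the other variable
  across.\<close>

locale two_sides =
  fixes ok :: "'v \<Rightarrow> 'v \<Rightarrow> 'a \<Rightarrow> 'a \<Rightarrow> bool" and V :: "'v set"
    and L :: "bool \<Rightarrow> 'v \<Rightarrow> 'a set" and sp :: "bool \<Rightarrow> 'a"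
  assumes fin: "finite V"
    and ok_sym: "ok u v c d \<longleftrightarrow> ok v u d c"
    and disj: "v \<in> V \<Longrightarrow> L True v \<inter> L False v = {}"
    and special: "v \<in> V \<Longrightarrow> sp b \<in> L b v \<Longrightarrow> L b v = {sp b}"
    and cross: "u \<in> V \<Longrightarrow> v \<in> V \<Longrightarrow> u \<noteq> v \<Longrightarrow> c \<in> L b u \<Longrightarrow> c' \<in> L b u \<Longrightarrow> d \<in> L (\<not> b) v \<Longrightarrow> d' \<in> L (\<not> b) v \<Longrightarrow>
      ok u v c d \<Longrightarrow> ok u v c' d'"
    and forced: "side_step ok V L sp b u v \<Longrightarrow> c \<in> L b u \<Longrightarrow> d \<in> L (\<not> b) v \<Longrightarrow> \<not> ok u v c d"
begin

abbreviation "step \<equiv> side_step ok V L sp"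
abbreviation "cluster \<equiv> side_cluster ok V L sp"
abbreviation "inc \<equiv> side_inc ok V L sp"

lemma inc_sym: "inc l m \<Longrightarrow> inc m l"
proof -
  assume inc: "inc l m"
  consider "fst l = fst m" | "fst l \<noteq> fst m" "snd l = snd m" | "fst l \<noteq> fst m" "snd l \<noteq> snd m" by blast
  then show "inc m l"
  proof cases
    case 1 then show ?thesis using inc by (auto simp: side_inc_def)
  next
    case 2 then show ?thesis using inc ok_sym[of "fst l" "fst m"] by (simp add: side_inc_def)
  next
    case 3
    then obtain c d where "c \<in> L (snd l) (fst l)" "d \<in> L (snd m) (fst m)" "\<not> ok (fst l) (fst m) c d"
      using inc by (auto simp: side_inc_def)
    then show ?thesis using 3 ok_sym[of "fst l" "fst m" c d] by (auto simp: side_inc_def)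
  qed
qed

text \<open>Propagation stops at special variables, so symmetry is available only among the
  others.\<close>

lemma step_sym: "step b u v \<Longrightarrow> sp b \<notin> L b v \<Longrightarrow> step b v u"
proof -
  assume s: "step b u v" and v: "sp b \<notin> L b v"
  then obtain c d where "c \<in> L b u" "d \<in> L b v" "\<not> ok u v c d" by (auto simp: side_step_def)
  moreover from this have "\<not> ok v u d c" by (subst ok_sym)
  ultimately have "\<exists>d\<in>L b v. \<exists>c\<in>L b u. \<not> ok v u d c" by (intro bexI)
  moreover have "u \<in> V" "v \<in> V" "v \<noteq> u" using s by (auto simp: side_step_def)
  ultimately show "step b v u" using v unfolding side_step_def by (intro conjI)
qed

lemma cluster_subset: "v \<in> V \<Longrightarrow> cluster b v \<subseteq> V"
proof
  fix w assume v: "v \<in> V" and "w \<in> cluster b v"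
  then have "(step b)\<^sup>*\<^sup>* v w" by (simp add: side_cluster_def)
  then show "w \<in> V" using v by induction (auto simp: side_step_def)
qed

text \<open>From right to left, solutions of clusters are glued. Clusters with a common non-special
  variable that starts or is reached in them coincide, so it can take its value from a solution
  chosen once per cluster. A special variable may belong to several clusters, but has only one
  value.\<close>

lemma solvable_iff:
  "csp ok V (\<lambda>v. L True v \<union> L False v) \<longleftrightarrow> (\<exists>\<sigma>. \<forall>v\<in>V. \<forall>w\<in>V. \<not> inc (v, \<sigma> v) (w, \<sigma> w))"
proof
  assume "csp ok V (\<lambda>v. L True v \<union> L False v)"
  then obtain f where f: "\<And>v. v \<in> V \<Longrightarrow> f v \<in> L True v \<union> L False v"
    and ok: "\<And>u v. u \<in> V \<Longrightarrow> v \<in> V \<Longrightarrow> u \<noteq> v \<Longrightarrow> ok u v (f u) (f v)" unfolding csp_def by blast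
  define \<sigma> where "\<sigma> v \<longleftrightarrow> f v \<in> L True v" for v
  have fL: "f v \<in> L (\<sigma> v) v" if "v \<in> V" for v
    using f[OF that] by (cases "\<sigma> v") (auto simp: \<sigma>_def)
  have stay: "\<sigma> w = \<sigma> v" if "(step (\<sigma> v))\<^sup>*\<^sup>* v w" for v w
    using that
  proof induction
    case (step w x)
    show ?case
    proof (rule ccontr)
      assume "\<sigma> x \<noteq> \<sigma> v"
      then have eq: "\<sigma> x = (\<not> \<sigma> v)" by simp
      have "w \<in> V" "x \<in> V" "w \<noteq> x" using step.hyps by (auto simp: side_step_def)
      then show False
        using forced[OF step.hyps(2), of "f w" "f x"] ok fL[of w] fL[of x] step.IH eq by simp
    qed
  qed simp
  show "\<exists>\<sigma>. \<forall>v\<in>V. \<forall>w\<in>V. \<not> inc (v, \<sigma> v) (w, \<sigma> w)"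
  proof (intro exI[of _ \<sigma>] ballI notI)
    fix v w assume v: "v \<in> V" and w: "w \<in> V" and inc: "inc (v, \<sigma> v) (w, \<sigma> w)"
    consider "v = w" | "v \<noteq> w" "\<sigma> v = \<sigma> w" | "v \<noteq> w" "\<sigma> v \<noteq> \<sigma> w" by blast
    then show False
    proof cases
      case 1
      have "csp ok (cluster (\<sigma> v) v) (L (\<sigma> v))"
        unfolding csp_def
      proof (intro exI[of _ f] conjI ballI impI)
        fix u assume u: "u \<in> cluster (\<sigma> v) v"
        then have "\<sigma> u = \<sigma> v" using stay by (simp add: side_cluster_def)
        moreover have uV: "u \<in> V" using cluster_subset[OF v] u by (rule subsetD)
        ultimately show "f u \<in> L (\<sigma> v) u" using fL[OF uV] by simp
        fix x assume "x \<in> cluster (\<sigma> v) v" and ne: "u \<noteq> x"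
        then have "x \<in> V" using cluster_subset[OF v] by blast
        then show "ok u x (f u) (f x)" using ok uV ne by simp
      qed
      then show False using inc 1 by (simp add: side_inc_def)
    next
      case 2
      then have "f v = sp (\<sigma> v)" "f w = sp (\<sigma> v)" "\<not> ok v w (sp (\<sigma> v)) (sp (\<sigma> v))"
        using inc fL[OF v] fL[OF w] special[OF v, of "\<sigma> v"] special[OF w, of "\<sigma> w"]
        by (auto simp: side_inc_def)
      then show False using ok[OF v w 2(1)] by simp
    next
      case 3
      then have "\<sigma> w = (\<not> \<sigma> v)" by simp
      moreover obtain c d where "c \<in> L (\<sigma> v) v" "d \<in> L (\<sigma> w) w" "\<not> ok v w c d"
        using inc 3 by (auto simp: side_inc_def)
      ultimately show False
        using cross[OF v w 3(1) fL[OF v], of c "f w" d] fL[OF w] ok[OF v w 3(1)] by simp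
    qed
  qed
next
  assume "\<exists>\<sigma>. \<forall>v\<in>V. \<forall>w\<in>V. \<not> inc (v, \<sigma> v) (w, \<sigma> w)"
  then obtain \<sigma> where \<sigma>: "\<And>v w. v \<in> V \<Longrightarrow> w \<in> V \<Longrightarrow> \<not> inc (v, \<sigma> v) (w, \<sigma> w)" by blast
  have "csp ok (cluster (\<sigma> v) v) (L (\<sigma> v))" if "v \<in> V" for v
    using \<sigma>[OF that that] by (simp add: side_inc_def)
  then have "\<exists>g. (\<forall>u\<in>cluster (\<sigma> v) v. g u \<in> L (\<sigma> v) u) \<and>
    (\<forall>u\<in>cluster (\<sigma> v) v. \<forall>w\<in>cluster (\<sigma> v) v. u \<noteq> w \<longrightarrow> ok u w (g u) (g w))" if "v \<in> V" for v
    using that by (simp add: csp_def)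
  then obtain g where g: "\<And>v u. v \<in> V \<Longrightarrow> u \<in> cluster (\<sigma> v) v \<Longrightarrow> g v u \<in> L (\<sigma> v) u"
    "\<And>v u w. v \<in> V \<Longrightarrow> u \<in> cluster (\<sigma> v) v \<Longrightarrow> w \<in> cluster (\<sigma> v) v \<Longrightarrow> u \<noteq> w \<Longrightarrow> ok u w (g v u) (g v w)"
    by metis
  define cls where "cls v = {w \<in> cluster (\<sigma> v) v. sp (\<sigma> v) \<notin> L (\<sigma> v) w}" for v
  \<comment> \<open>The choice depends only on the class and the side, so all members of a class get
    the same representative.\<close>
  define rep where "rep v = (SOME w. w \<in> cls v \<and> \<sigma> w = \<sigma> v)" for v
  define f where "f v = g (rep v) v" for v
  have self: "v \<in> cluster b v" for b v by (simp add: side_cluster_def)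
  have stay: "\<sigma> u = \<sigma> v" if v: "v \<in> V" and u: "u \<in> cluster (\<sigma> v) v" for u v
  proof -
    have "(step (\<sigma> v))\<^sup>*\<^sup>* v u" using u by (simp add: side_cluster_def)
    then show ?thesis
    proof induction
      case (step w x)
      have wx: "w \<in> V" "x \<in> V" "w \<noteq> x" using step.hyps by (auto simp: side_step_def)
      show ?case
      proof (rule ccontr)
        assume "\<sigma> x \<noteq> \<sigma> v"
        then have eq: "\<sigma> x = (\<not> \<sigma> w)" using step.IH by simp
        have "g w w \<in> L (\<sigma> w) w" "g x x \<in> L (\<sigma> x) x" using g(1) wx self by blast+
        moreover from this have "\<not> ok w x (g w w) (g x x)"
          using forced[OF step.hyps(2), of "g w w" "g x x"] eq step.IH by simp
        ultimately have "inc (w, \<sigma> w) (x, \<sigma> x)" using eq wx(3) by (auto simp: side_inc_def)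
        then show False using \<sigma> wx by blast
      qed
    qed simp
  qed
  have sym: "(step b)\<^sup>*\<^sup>* w v" if "(step b)\<^sup>*\<^sup>* v w" "sp b \<notin> L b w" for b v w
    using that
  proof induction
    case (step w x)
    then have "sp b \<notin> L b w" by (simp add: side_step_def)
    then show ?case using step.IH step_sym[OF step.hyps(2) step.prems]
      by (meson converse_rtranclp_into_rtranclp)
  qed simp
  have eq_cluster: "cluster (\<sigma> v) v = cluster (\<sigma> v) w" if "w \<in> cls v" for v w
  proof -
    have 1: "(step (\<sigma> v))\<^sup>*\<^sup>* v w" "sp (\<sigma> v) \<notin> L (\<sigma> v) w" using that by (auto simp: cls_def side_cluster_def)
    then have "(step (\<sigma> v))\<^sup>*\<^sup>* w v" using sym by blast
    then show ?thesis using 1 by (auto simp: side_cluster_def intro: rtranclp_trans)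
  qed
  have rep_eq: "rep v = rep w" if "v \<in> V" "w \<in> cls v" for v w
  proof -
    have "\<sigma> w = \<sigma> v" using stay[of v w] that by (auto simp: cls_def)
    then show ?thesis using eq_cluster[OF that(2)] by (simp add: rep_def cls_def)
  qed
  have rep: "rep v \<in> V" "\<sigma> (rep v) = \<sigma> v" "cluster (\<sigma> v) v = cluster (\<sigma> (rep v)) (rep v)"
    if "v \<in> V" "sp (\<sigma> v) \<notin> L (\<sigma> v) v" for v
  proof -
    have "v \<in> cls v \<and> \<sigma> v = \<sigma> v" using that self by (simp add: cls_def)
    then have "rep v \<in> cls v \<and> \<sigma> (rep v) = \<sigma> v" unfolding rep_def by (rule someI)
    then have r: "rep v \<in> cls v" "\<sigma> (rep v) = \<sigma> v" by auto
    have "rep v \<in> cluster (\<sigma> v) v" using r(1) by (simp add: cls_def)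
    then show "rep v \<in> V" using cluster_subset[OF that(1)] by (rule subsetD[rotated])
    show "\<sigma> (rep v) = \<sigma> v" by fact
    show "cluster (\<sigma> v) v = cluster (\<sigma> (rep v)) (rep v)" using eq_cluster[OF r(1)] r(2) by simp
  qed
  define h where "h v = (if sp (\<sigma> v) \<in> L (\<sigma> v) v then sp (\<sigma> v) else f v)" for v
  have hL: "h v \<in> L (\<sigma> v) v" if "v \<in> V" for v
  proof (cases "sp (\<sigma> v) \<in> L (\<sigma> v) v")
    case False
    then have "v \<in> cluster (\<sigma> (rep v)) (rep v)" using rep[OF that] self by auto
    then show ?thesis using g(1)[of "rep v" v] rep[OF that] False by (simp add: h_def f_def)
  qed (simp add: h_def)
  have main: "ok v w (h v) (h w)"
    if v: "v \<in> V" and w: "w \<in> V" and "v \<noteq> w" "\<sigma> v = \<sigma> w" and ns: "sp (\<sigma> v) \<notin> L (\<sigma> v) v" for v w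
  proof (cases "step (\<sigma> v) v w")
    case True
    then have wc: "w \<in> cluster (\<sigma> v) v" by (auto simp: side_cluster_def)
    note r = rep[OF v ns]
    have hv: "h v = g (rep v) v" using ns by (simp add: h_def f_def)
    have hw: "h w = g (rep v) w"
    proof (cases "sp (\<sigma> w) \<in> L (\<sigma> w) w")
      case T: True
      have "w \<in> cluster (\<sigma> (rep v)) (rep v)" using wc r(3) by simp
      from g(1)[OF r(1) this] have "g (rep v) w \<in> {sp (\<sigma> w)}"
        using special[OF w T] r(2) that(4) by simp
      then show ?thesis using T by (simp add: h_def)
    next
      case F: False
      then have "w \<in> cls v" using wc that(4) by (simp add: cls_def)
      then show ?thesis using rep_eq[OF v] F by (simp add: h_def f_def)
    qed
    show ?thesis unfolding hv hw
    proof (rule g(2)[OF r(1)])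
      show "v \<in> cluster (\<sigma> (rep v)) (rep v)" "w \<in> cluster (\<sigma> (rep v)) (rep v)"
        using wc self r(3) by auto
    qed fact
  next
    case False
    \<comment> \<open>As \<open>v\<close> is not special, the absence of a step means that no two
      values on this side conflict.\<close>
    then show ?thesis using hL[OF v] hL[OF w] that by (auto simp: side_step_def)
  qed
  show "csp ok V (\<lambda>v. L True v \<union> L False v)"
    unfolding csp_def
  proof (intro exI[of _ h] conjI ballI impI)
    fix v assume v: "v \<in> V"
    show "h v \<in> L True v \<union> L False v" using hL[OF v] by (cases "\<sigma> v") auto
    fix w assume w: "w \<in> V" and ne: "v \<noteq> w"
    consider "\<sigma> v \<noteq> \<sigma> w" | "\<sigma> v = \<sigma> w" "sp (\<sigma> v) \<notin> L (\<sigma> v) v" | "\<sigma> v = \<sigma> w" "sp (\<sigma> w) \<notin> L (\<sigma> w) w"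
      | "\<sigma> v = \<sigma> w" "sp (\<sigma> v) \<in> L (\<sigma> v) v" "sp (\<sigma> w) \<in> L (\<sigma> w) w" by blast
    then show "ok v w (h v) (h w)"
    proof cases
      case 1
      then show ?thesis using \<sigma>[OF v w] ne hL[OF v] hL[OF w] by (auto simp: side_inc_def)
    next
      case 2 then show ?thesis using main[OF v w ne] by simp
    next
      case 3 then show ?thesis using main[OF w v] ne by (simp add: ok_sym[of v w])
    next
      case 4 then show ?thesis using \<sigma>[OF v w] ne by (auto simp: side_inc_def h_def)
    qed
  qed
qed

lemma solvable_iff_two_sat:
  "csp ok V (\<lambda>v. L True v \<union> L False v) \<longleftrightarrow>
    (\<forall>v\<in>V. \<not> ((imp_step V inc)\<^sup>*\<^sup>* (v, True) (v, False) \<and> (imp_step V inc)\<^sup>*\<^sup>* (v, False) (v, True)))"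
  unfolding solvable_iff by (rule two_sat[OF fin inc_sym])

end

section \<open>Separation by cliques\<close>

text \<open>Each step before the fixed point adds an element. \<open>n\<close> is any bound on the
  cardinality because programs read the number of rounds off the input.\<close>

lemma funpow_stabilizes:
  assumes V: "finite V" "card V \<le> n" and f: "\<And>S. S \<subseteq> V \<Longrightarrow> S \<subseteq> f S \<and> f S \<subseteq> V" and X: "X \<subseteq> V"
  shows "f ((f ^^ n) X) = (f ^^ n) X"
proof (rule ccontr)
  assume neq: "f ((f ^^ n) X) \<noteq> (f ^^ n) X"
  have sub: "(f ^^ k) X \<subseteq> V" for k using f X by (induction k) auto
  have inc: "(f ^^ k) X \<subseteq> (f ^^ Suc k) X" for k using f[OF sub[of k]] by simp
  have strict: "(f ^^ k) X \<noteq> (f ^^ Suc k) X" if "k \<le> n" for k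
  proof
    assume eq: "(f ^^ k) X = (f ^^ Suc k) X"
    have *: "(f ^^ (j + k)) X = (f ^^ k) X" for j
    proof (induction j)
      case (Suc j)
      then have "(f ^^ (Suc j + k)) X = f ((f ^^ k) X)" by simp
      then show ?case using eq[symmetric] by simp
    qed simp
    have "(f ^^ n) X = (f ^^ k) X" using *[of "n - k"] that by simp
    then show False using neq eq[symmetric] by simp
  qed
  have "k \<le> card ((f ^^ k) X)" if "k \<le> Suc n" for k
    using that
  proof (induction k)
    case (Suc k)
    then have "card ((f ^^ k) X) < card ((f ^^ Suc k) X)"
      using inc[of k] strict[of k] sub[of "Suc k"] V(1) by (intro psubset_card_mono) (auto intro: finite_subset)
    then show ?case using Suc by simp
  qed simp
  from this[of "Suc n"] have "Suc n \<le> card V" using card_mono[OF V(1) sub[of "Suc n"]] by simp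
  then show False using V(2) by simp
qed

text \<open>Breadth-first ball of radius \<open>k\<close> about \<open>w\<close>, along walks whose
  other vertices lie outside \<open>C\<close>. It is used with \<open>w\<close> in \<open>C\<close>,
  so the centre is not a member.\<close>

definition clique_layer :: "'v set \<Rightarrow> ('v \<Rightarrow> 'v \<Rightarrow> bool) \<Rightarrow> 'v set \<Rightarrow> 'v \<Rightarrow> nat \<Rightarrow> 'v set" where
  "clique_layer V adj C w k = ((\<lambda>W. {p\<in>V. p \<notin> C \<and> (adj p w \<or> (\<exists>q\<in>W. adj p q))}) ^^ k) {}"

text \<open>
  If \<open>u\<close> and \<open>w\<close> are not completely adjacent, then no clique separates an interior vertex of
  a shortest path between them from both of them.
\<close>

definition clique_hull_step ::
  "nat \<Rightarrow> 'v set \<Rightarrow> ('v \<Rightarrow> 'v \<Rightarrow> bool) \<Rightarrow> ('v \<Rightarrow> 'v \<Rightarrow> bool) \<Rightarrow> 'v set \<Rightarrow> 'v set \<Rightarrow> 'v set" where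
  "clique_hull_step n V adj bi A C = {p\<in>V. p \<in> C \<or> (\<exists>u\<in>C. adj p u \<and> (u \<notin> A \<or> (\<exists>w\<in>C. w \<noteq> u \<and> \<not> bi u w \<and>
     (\<exists>k\<in>{..n}. p \<in> clique_layer V adj C w (Suc k) \<and> (\<forall>q\<in>clique_layer V adj C w k. \<not> adj q u)))))}"

definition clique_near ::
  "nat \<Rightarrow> 'v set \<Rightarrow> ('v \<Rightarrow> 'v \<Rightarrow> bool) \<Rightarrow> ('v \<Rightarrow> 'v \<Rightarrow> bool) \<Rightarrow> 'v set \<Rightarrow> 'v \<Rightarrow> 'v \<Rightarrow> bool" where
  "clique_near n V adj bi A u v \<longleftrightarrow> v \<in> (clique_hull_step n V adj bi A ^^ n) {w\<in>V. w = u \<or> adj w u}"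

text \<open>Perfect elimination in parallel: each round deletes all vertices whose surviving
  neighbours are pairwise near.\<close>

definition clique_alive ::
  "nat \<Rightarrow> 'v set \<Rightarrow> ('v \<Rightarrow> 'v \<Rightarrow> bool) \<Rightarrow> ('v \<Rightarrow> 'v \<Rightarrow> bool) \<Rightarrow> 'v set \<Rightarrow> nat \<Rightarrow> 'v set" where
  "clique_alive n V adj bi A t = ((\<lambda>W. {v\<in>V. v \<in> W \<and> \<not> (\<forall>a\<in>W. \<forall>b\<in>W.
     clique_near n V adj bi A v a \<and> clique_near n V adj bi A v b \<longrightarrow> clique_near n V adj bi A a b)}) ^^ t) V"

text \<open>Candidates for maximal sets of pairwise near vertices. Such a set is found at its first
  vertex to be deleted, in the round before the deletion, so there are only polynomially many
  candidates.\<close>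

definition clique_region ::
  "nat \<Rightarrow> 'v set \<Rightarrow> ('v \<Rightarrow> 'v \<Rightarrow> bool) \<Rightarrow> ('v \<Rightarrow> 'v \<Rightarrow> bool) \<Rightarrow> 'v set \<Rightarrow> nat \<Rightarrow> 'v \<Rightarrow> 'v set" where
  "clique_region n V adj bi A t v = {w \<in> clique_alive n V adj bi A t. clique_near n V adj bi A v w}"

locale clique_sep =
  fixes n :: nat and V :: "'v set" and adj bi :: "'v \<Rightarrow> 'v \<Rightarrow> bool" and A :: "'v set"
  assumes fin: "finite V" and card_n: "card V \<le> n" and AV: "A \<subseteq> V"
    and adj_sym: "adj u v \<Longrightarrow> adj v u"
    and bi_adj: "bi u v \<Longrightarrow> u \<noteq> v \<Longrightarrow> adj u v"
begin

definition clq :: "'v set \<Rightarrow> bool" where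
  "clq Q \<longleftrightarrow> Q \<subseteq> A \<and> (\<forall>u\<in>Q. \<forall>v\<in>Q. u \<noteq> v \<longrightarrow> bi u v)"

definition con :: "'v set \<Rightarrow> 'v \<Rightarrow> 'v \<Rightarrow> bool" where
  "con Q = (\<lambda>u v. adj u v \<and> u \<in> V - Q \<and> v \<in> V - Q)\<^sup>*\<^sup>*"

definition sim :: "'v \<Rightarrow> 'v \<Rightarrow> bool" where
  "sim u v \<longleftrightarrow> (\<forall>Q. clq Q \<and> u \<notin> Q \<and> v \<notin> Q \<longrightarrow> con Q u v)"

lemma con_refl [simp]: "con Q u u" by (simp add: con_def)

lemma con_trans: "con Q u v \<Longrightarrow> con Q v w \<Longrightarrow> con Q u w" by (auto simp: con_def)

lemma con_sym: "con Q u v \<Longrightarrow> con Q v u"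
  unfolding con_def
proof (induction rule: rtranclp_induct)
  case (step x y)
  then show ?case by (intro converse_rtranclp_into_rtranclp[OF _ step.IH]) (auto intro: adj_sym)
qed simp

lemma con_adj: "adj u v \<Longrightarrow> u \<in> V - Q \<Longrightarrow> v \<in> V - Q \<Longrightarrow> con Q u v"
  unfolding con_def by (rule r_into_rtranclp) simp

lemma con_adj': "adj v u \<Longrightarrow> u \<in> V - Q \<Longrightarrow> v \<in> V - Q \<Longrightarrow> con Q u v"
  by (rule con_adj[OF adj_sym])

lemma con_mem: "con Q u v \<Longrightarrow> u \<in> V - Q \<Longrightarrow> v \<in> V - Q"
  unfolding con_def by (induction rule: rtranclp_induct) auto

lemma con_closed:
  assumes "con Q u v" "u \<in> M" "\<And>x y. x \<in> M \<Longrightarrow> adj x y \<Longrightarrow> y \<in> V - Q \<Longrightarrow> y \<in> M"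
  shows "v \<in> M"
  using assms(1) unfolding con_def by (induction rule: rtranclp_induct) (use assms(2,3) in auto)

lemma sim_refl [simp]: "sim u u" by (simp add: sim_def)

lemma sim_sym: "sim u v \<Longrightarrow> sim v u" unfolding sim_def using con_sym by blast

lemma sim_adj: "adj u v \<Longrightarrow> u \<in> V \<Longrightarrow> v \<in> V \<Longrightarrow> sim u v"
  unfolding sim_def by (auto intro: con_adj)

lemma clq_sim: "clq Q \<Longrightarrow> u \<in> Q \<Longrightarrow> v \<in> Q \<Longrightarrow> sim u v"
  using sim_adj[of u v] bi_adj[of u v] AV unfolding clq_def by (cases "u = v") auto

abbreviation "layer \<equiv> clique_layer V adj"
abbreviation "hull_step \<equiv> clique_hull_step n V adj bi A"
abbreviation "near \<equiv> clique_near n V adj bi A"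
abbreviation "alive \<equiv> clique_alive n V adj bi A"

lemmas layer_def = clique_layer_def and hull_step_def = clique_hull_step_def

lemma layer_0: "layer C w 0 = {}" by (simp add: layer_def)

lemma layer_Suc: "layer C w (Suc k) = {p\<in>V. p \<notin> C \<and> (adj p w \<or> (\<exists>q\<in>layer C w k. adj p q))}"
  by (simp add: layer_def)

lemma layer_sub: "layer C w k \<subseteq> V - C"
  by (cases k) (auto simp: layer_0 layer_Suc)

lemma layer_mono: "layer C w k \<subseteq> layer C w (Suc k)"
  by (induction k) (auto simp: layer_0 layer_Suc)

lemma layer_mono': "j \<le> k \<Longrightarrow> layer C w j \<subseteq> layer C w k"
  using lift_Suc_mono_le[of "layer C w" j k] layer_mono by blast

lemma layer_Suc_Un: "layer C w (Suc k) = layer C w k \<union> {p\<in>V. p \<notin> C \<and> (adj p w \<or> (\<exists>q\<in>layer C w k. adj p q))}"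
  using layer_mono[of C w k] unfolding layer_Suc by blast

lemma layer_bound: "layer C w k \<subseteq> layer C w (card V)"
proof -
  let ?f = "\<lambda>W. W \<union> {p\<in>V. p \<notin> C \<and> (adj p w \<or> (\<exists>q\<in>W. adj p q))}"
  have eq: "(?f ^^ k) {} = layer C w k" for k
    by (induction k) (simp_all add: layer_0 layer_Suc_Un)
  have "?f ((?f ^^ card V) {}) = (?f ^^ card V) {}"
    by (rule funpow_stabilizes[OF fin]) auto
  then have stable: "?f (layer C w (card V)) = layer C w (card V)" using eq by simp
  have "layer C w (card V + j) = layer C w (card V)" for j
  proof (induction j)
    case (Suc j)
    have "layer C w (card V + Suc j) = ?f (layer C w (card V + j))"
      by (simp add: layer_Suc_Un)
    then show ?case using Suc stable by simp
  qed simp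
  then have "layer C w (card V + k) \<subseteq> layer C w (card V)" by simp
  moreover have "layer C w k \<subseteq> layer C w (card V + k)" by (rule layer_mono') simp
  ultimately show ?thesis by blast
qed

text \<open>If the clique \<open>Q\<close> omits \<open>u\<close>, connect through \<open>u\<close>.
  If it contains \<open>u\<close>, it omits \<open>w\<close>, since these two are not completely
  adjacent, and the path from \<open>w\<close> to \<open>p\<close> through the layers avoids
  \<open>Q\<close>: a vertex of \<open>Q\<close> on it would be adjacent to \<open>u\<close>,
  contrary to the choice of \<open>k\<close>.\<close>

lemma hull_step_sound:
  assumes C: "C \<subseteq> V" "\<And>v. v \<in> C \<Longrightarrow> sim u0 v" and u0: "u0 \<in> V" and p: "p \<in> hull_step C"
  shows "sim u0 p"
proof (cases "p \<in> C")
  case False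
  then obtain u where u: "u \<in> C" "adj p u" and cases: "u \<notin> A \<or> (\<exists>w\<in>C. w \<noteq> u \<and> \<not> bi u w \<and>
     (\<exists>k\<in>{..n}. p \<in> layer C w (Suc k) \<and> (\<forall>q\<in>layer C w k. \<not> adj q u)))" and pV: "p \<in> V"
    using p unfolding hull_step_def by blast
  have uV: "u \<in> V" using u C by auto
  show ?thesis
    unfolding sim_def
  proof (intro allI impI)
    fix Q assume Q: "clq Q \<and> u0 \<notin> Q \<and> p \<notin> Q"
    show "con Q u0 p"
    proof (cases "u \<in> Q")
      case False
      then have "con Q u0 u" using C(2)[OF u(1)] Q by (simp add: sim_def)
      moreover have "con Q u p" using u uV pV False Q by (intro con_adj') auto
      ultimately show ?thesis by (rule con_trans)
    next
      case True
      then have "u \<in> A" using Q by (auto simp: clq_def)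
      then obtain w k where w: "w \<in> C" "w \<noteq> u" "\<not> bi u w" and k: "p \<in> layer C w (Suc k)" "\<And>q. q \<in> layer C w k \<Longrightarrow> \<not> adj q u"
        using cases by blast
      have "w \<notin> Q" using True w Q by (auto simp: clq_def)
      then have w0: "con Q u0 w" using C(2)[OF w(1)] Q by (simp add: sim_def)
      have wV: "w \<in> V - Q" using w C \<open>w \<notin> Q\<close> by auto
      have lQ: "q \<notin> Q" if "q \<in> layer C w k" for q
      proof
        assume "q \<in> Q"
        moreover have "q \<noteq> u" using that layer_sub u by blast
        ultimately have "adj q u" using Q True by (intro bi_adj) (auto simp: clq_def)
        then show False using k(2)[OF that] by simp
      qed
      have con: "con Q w q" if "q \<in> layer C w j" "j \<le> k" for q j
        using that
      proof (induction j arbitrary: q)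
        case (Suc j)
        have qQ: "q \<in> V - Q" using Suc.prems lQ layer_mono'[of "Suc j" k C w] layer_sub by blast
        from Suc.prems consider "adj q w" | r where "r \<in> layer C w j" "adj q r" by (auto simp: layer_Suc)
        then show ?case
        proof cases
          case 1 then show ?thesis using qQ wV by (intro con_adj')
        next
          case 2
          then have "con Q w r" using Suc by simp
          moreover from con_mem[OF this wV] have "con Q r q" using 2 qQ by (intro con_adj')
          ultimately show ?thesis by (rule con_trans)
        qed
      qed (simp add: layer_0)
      have pQ: "p \<in> V - Q" using pV Q by simp
      from k(1) consider "adj p w" | q where "q \<in> layer C w k" "adj p q" by (auto simp: layer_Suc)
      then have "con Q w p"
      proof cases
        case 1 then show ?thesis using pQ wV by (intro con_adj')
      next
        case 2
        then have "con Q w q" using con by blast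
        moreover from con_mem[OF this wV] have "con Q q p" using 2 pQ by (intro con_adj')
        ultimately show ?thesis by (rule con_trans)
      qed
      then show ?thesis using w0 con_trans by blast
    qed
  qed
qed (use C in auto)

text \<open>The separator is \<open>N\<close>, the neighbours in \<open>C\<close> of the component
  \<open>M\<close> of \<open>v\<close> outside \<open>C\<close>. If some element of \<open>N\<close>
  were not in \<open>A\<close>, or two were not completely adjacent, the closed set \<open>C\<close>
  would have to grow. The vertex \<open>u0\<close> is not in \<open>N\<close> because its neighbours
  already belong to \<open>C\<close>.\<close>

lemma hull_step_complete:
  assumes C: "C \<subseteq> V" "hull_step C = C" and u0: "u0 \<in> C" "\<And>v. v \<in> V \<Longrightarrow> adj v u0 \<Longrightarrow> v \<in> C"
    and v: "v \<in> V - C"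
  shows "\<not> sim u0 v"
proof -
  define M where "M = {w. con C v w}"
  have MV: "M \<subseteq> V - C" using con_mem v by (auto simp: M_def)
  define N where "N = {u\<in>C. \<exists>m\<in>M. adj m u}"
  have NA: "N \<subseteq> A"
  proof
    fix u assume "u \<in> N"
    then obtain m where m: "u \<in> C" "m \<in> M" "adj m u" by (auto simp: N_def)
    show "u \<in> A"
    proof (rule ccontr)
      assume "u \<notin> A"
      then have "m \<in> hull_step C" using m MV by (auto simp: hull_step_def)
      then show False using C m MV by auto
    qed
  qed
  have "bi u w" if uw: "u \<in> N" "w \<in> N" "u \<noteq> w" for u w
  proof (rule ccontr)
    assume nbi: "\<not> bi u w"
    obtain m m' where m: "u \<in> C" "m \<in> M" "adj m u" "w \<in> C" "m' \<in> M" "adj m' w"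
      using uw(1,2) unfolding N_def by blast
    have "con C m' m" using m con_sym con_trans unfolding M_def by blast
    then have "\<exists>j. m \<in> layer C w j"
      unfolding con_def
    proof (induction rule: rtranclp_induct)
      case base
      have "m' \<in> layer C w (Suc 0)" using m MV by (auto simp: layer_Suc)
      then show ?case by blast
    next
      case (step y z)
      then obtain j where "y \<in> layer C w j" by blast
      then have "z \<in> layer C w (Suc j)" using step.hyps adj_sym by (auto simp: layer_Suc)
      then show ?case by blast
    qed
    then have ex: "\<exists>j. \<exists>p\<in>layer C w j. adj p u" using m(3) by blast
    \<comment> \<open>Minimality makes \<open>p\<close> the last vertex before \<open>u\<close> on a
      shortest path from \<open>w\<close>, which is the pattern that \<open>hull_step\<close> looks
      for.\<close>
    define j where "j = (LEAST j. \<exists>p\<in>layer C w j. adj p u)"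
    have j: "\<exists>p\<in>layer C w j. adj p u" unfolding j_def by (rule LeastI_ex[OF ex])
    have jmin: "\<not> (\<exists>p\<in>layer C w i. adj p u)" if "i < j" for i using not_less_Least that unfolding j_def by blast
    obtain p where p: "p \<in> layer C w j" "adj p u" using j by blast
    obtain k where k: "j = Suc k" using p by (cases j) (auto simp: layer_0)
    have "p \<in> layer C w (card V)" using p layer_bound by blast
    then have "j \<le> card V" using jmin p(2) not_le by blast
    then have "k \<in> {..n}" using k card_n by simp
    moreover have "\<forall>q\<in>layer C w k. \<not> adj q u" using jmin[of k] k by blast
    moreover have "p \<in> layer C w (Suc k)" using p(1) k by simp
    ultimately have "\<exists>k\<in>{..n}. p \<in> layer C w (Suc k) \<and> (\<forall>q\<in>layer C w k. \<not> adj q u)" by blast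
    moreover have "w \<noteq> u" using uw(3) by simp
    ultimately have "\<exists>w\<in>C. w \<noteq> u \<and> \<not> bi u w \<and>
        (\<exists>k\<in>{..n}. p \<in> layer C w (Suc k) \<and> (\<forall>q\<in>layer C w k. \<not> adj q u))"
      using nbi m(4) by blast
    moreover have "p \<in> V" using p(1) layer_sub by blast
    ultimately have "p \<in> hull_step C" using m(1) p(2) unfolding hull_step_def by blast
    then show False using C p layer_sub by blast
  qed
  then have "clq N" using NA by (auto simp: clq_def)
  moreover have "u0 \<notin> N"
  proof
    assume "u0 \<in> N"
    then obtain m where "m \<in> M" "adj m u0" by (auto simp: N_def)
    then show False using u0(2) MV by blast
  qed
  moreover have "v \<notin> N" using v by (auto simp: N_def)
  moreover have "\<not> con N u0 v"
  proof
    assume "con N u0 v"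
    then have "con N v u0" by (rule con_sym)
    then have "u0 \<in> M"
    proof (rule con_closed)
      show "v \<in> M" by (simp add: M_def)
      fix x y assume xy: "x \<in> M" "adj x y" "y \<in> V - N"
      then have "y \<notin> C" by (auto simp: N_def)
      then have "con C x y" using xy MV by (intro con_adj) auto
      then show "y \<in> M" using xy con_trans unfolding M_def by blast
    qed
    then show False using MV u0 by blast
  qed
  ultimately show ?thesis unfolding sim_def by blast
qed

lemma near_iff:
  assumes "u \<in> V" "v \<in> V"
  shows "near u v \<longleftrightarrow> sim u v"
proof -
  let ?X = "{w\<in>V. w = u \<or> adj w u}"
  have st: "S \<subseteq> hull_step S \<and> hull_step S \<subseteq> V" if "S \<subseteq> V" for S using that by (auto simp: hull_step_def)
  have sub: "(hull_step ^^ k) ?X \<subseteq> V" for k by (induction k) (auto simp: hull_step_def)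
  have mono: "?X \<subseteq> (hull_step ^^ k) ?X" for k
  proof (induction k)
    case (Suc k)
    then show ?case using st[OF sub[of k]] by auto
  qed simp
  have sound: "sim u w" if "w \<in> (hull_step ^^ k) ?X" for w k
    using that
  proof (induction k arbitrary: w)
    case 0
    then show ?case using assms(1) by (auto intro: sim_sym sim_adj)
  next
    case (Suc k)
    have IH: "sim u v" if "v \<in> (hull_step ^^ k) ?X" for v using Suc.IH that by blast
    have "w \<in> hull_step ((hull_step ^^ k) ?X)" using Suc.prems by simp
    from hull_step_sound[OF sub IH assms(1) this] show ?case by simp
  qed
  have stable: "hull_step ((hull_step ^^ n) ?X) = (hull_step ^^ n) ?X"
    by (rule funpow_stabilizes[OF fin card_n st]) auto
  show ?thesis
    unfolding clique_near_def
  proof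
    assume "sim u v"
    then show "v \<in> (hull_step ^^ n) ?X"
      using hull_step_complete[OF sub[of n] stable, of u v] mono[of n] assms by blast
  qed (rule sound)
qed

definition simplicial :: "'v set \<Rightarrow> 'v \<Rightarrow> bool" where
  "simplicial W v \<longleftrightarrow> (\<forall>a\<in>W. \<forall>b\<in>W. sim v a \<and> sim v b \<longrightarrow> sim a b)"

text \<open>The graph \<open>sim\<close> is chordal.\<close>

lemma simplicial_exists:
  assumes W: "W \<subseteq> V" "W \<noteq> {}"
  shows "\<exists>v\<in>W. simplicial W v"
proof (cases "\<forall>a\<in>W. \<forall>b\<in>W. sim a b")
  case True
  then show ?thesis using W unfolding simplicial_def by blast
next
  case False
  have finW: "finite W" using W fin finite_subset by blast
  \<comment> \<open>Choose a separation \<open>(Q, v)\<close> in \<open>W\<close> for which the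
    component of \<open>v\<close> has the fewest vertices of \<open>W\<close>; this \<open>v\<close>
    will be simplicial.\<close>
  define bad where "bad p \<longleftrightarrow> clq (fst p) \<and> snd p \<in> W - fst p \<and> (\<exists>w\<in>W - fst p. \<not> con (fst p) (snd p) w)" for p
  define m where "m p = card (W \<inter> {x. con (fst p) (snd p) x})" for p
  have "\<exists>p. bad p"
  proof -
    obtain a b Q where "a \<in> W" "b \<in> W" "clq Q" "a \<notin> Q" "b \<notin> Q" "\<not> con Q a b"
      using False unfolding sim_def by blast
    then show ?thesis by (intro exI[of _ "(Q, a)"]) (auto simp: bad_def)
  qed
  then obtain p0 where "bad p0" by (elim exE)
  then have "\<exists>p. bad p \<and> (\<forall>q. bad q \<longrightarrow> m p \<le> m q)" by (rule ex_has_least_nat)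
  then obtain p where p: "bad p" and min': "\<forall>q. bad q \<longrightarrow> m p \<le> m q" by (elim exE conjE)
  have min: "m p \<le> m q" if "bad q" for q using min' that by (elim allE impE)
  obtain Q v where pQ: "p = (Q, v)" by (cases p)
  have Q: "clq Q" "v \<in> W - Q" using p pQ by (auto simp: bad_def)
  \<comment> \<open>If the component of \<open>b\<close> left by \<open>Q'\<close> misses
    \<open>Q\<close>, it is contained in the component of \<open>v\<close> left by \<open>Q\<close>,
    but lacks \<open>v\<close>; this contradicts minimality.\<close>
  have smaller: False
    if h: "clq Q'" "a \<in> W" "b \<in> W" "a \<notin> Q'" "b \<notin> Q'" "\<not> con Q' b a" "v \<in> Q'" "sim v b"
      "{x. con Q' b x} \<inter> Q = {}" for Q' a b
  proof -
    have "b \<notin> Q" using h(9) con_refl by blast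
    then have vb: "con Q v b" using h(8) Q by (simp add: sim_def)
    have "con Q v x" if x: "con Q' b x" for x
      using x unfolding con_def[of Q']
    proof (induction rule: rtranclp_induct)
      case base show ?case by (rule vb)
    next
      case (step y z)
      have "con Q' b y" using step.hyps(1) by (simp add: con_def)
      moreover have "con Q' b z"
        using step.hyps unfolding con_def by (rule rtranclp.rtrancl_into_rtrancl)
      ultimately have "y \<notin> Q" "z \<notin> Q" using h(9) by auto
      then have "con Q y z" using step.hyps by (intro con_adj) auto
      then show ?case using step.IH con_trans by blast
    qed
    moreover have "\<not> con Q' b v" using con_mem[of Q' b v] h W by auto
    ultimately have "W \<inter> {x. con Q' b x} \<subset> W \<inter> {x. con Q v x}" using Q con_refl[of Q v] by blast
    then have "m (Q', b) < m p" unfolding pQ m_def using finW by (auto intro: psubset_card_mono)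
    moreover have "bad (Q', b)" using h by (auto simp: bad_def)
    ultimately show False using min[of "(Q', b)"] by simp
  qed
  have "simplicial W v"
    unfolding simplicial_def
  proof (intro ballI impI, rule ccontr)
    fix a b assume ab: "a \<in> W" "b \<in> W" "sim v a \<and> sim v b" "\<not> sim a b"
    then obtain Q' where Q': "clq Q'" "a \<notin> Q'" "b \<notin> Q'" "\<not> con Q' a b" unfolding sim_def by blast
    have vQ': "v \<in> Q'"
    proof (rule ccontr)
      assume "v \<notin> Q'"
      then have "con Q' v a" "con Q' v b" using ab Q' by (auto simp: sim_def)
      then show False using Q' con_sym con_trans by blast
    qed
    \<comment> \<open>\<open>Q\<close> is complete, so at most one of the two components separated
      by \<open>Q'\<close> meets it; \<open>smaller\<close> applies to the other one.\<close>
    show False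
    proof (cases "{x. con Q' b x} \<inter> Q = {}")
      case True
      then show False using smaller[of Q' a b] Q' ab vQ' con_sym by blast
    next
      case False
      then obtain x where x: "con Q' b x" "x \<in> Q" by blast
      have "{x. con Q' a x} \<inter> Q = {}"
      proof (rule ccontr)
        assume "{x. con Q' a x} \<inter> Q \<noteq> {}"
        then obtain y where y: "con Q' a y" "y \<in> Q" by blast
        have "x \<in> V - Q'" "y \<in> V - Q'" using con_mem x y Q' ab W by blast+
        then have "con Q' x y"
          using x y Q(1) bi_adj[of x y] by (cases "x = y") (auto simp: clq_def intro: con_adj)
        then show False using x y Q' con_sym con_trans by blast
      qed
      then show False using smaller[of Q' b a] Q' ab vQ' by blast
    qed
  qed
  then show ?thesis using Q by blast
qed

lemma alive_0: "alive 0 = V" by (simp add: clique_alive_def)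

lemma alive_sub: "alive t \<subseteq> V"
  by (cases t) (auto simp: clique_alive_def)

lemma alive_Suc: "alive (Suc t) = {v\<in>V. v \<in> alive t \<and> \<not> simplicial (alive t) v}"
proof -
  have 1: "alive (Suc t) = {v\<in>V. v \<in> alive t \<and> \<not> (\<forall>a\<in>alive t. \<forall>b\<in>alive t. near v a \<and> near v b \<longrightarrow> near a b)}"
    unfolding clique_alive_def funpow.simps o_apply ..
  have 2: "(\<forall>a\<in>alive t. \<forall>b\<in>alive t. near v a \<and> near v b \<longrightarrow> near a b) \<longleftrightarrow> simplicial (alive t) v"
    if "v \<in> V" for v
    unfolding simplicial_def
  proof (intro ball_cong refl)
    fix a b assume "a \<in> alive t" "b \<in> alive t"
    then have "a \<in> V" "b \<in> V" using alive_sub by auto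
    then show "(near v a \<and> near v b \<longrightarrow> near a b) \<longleftrightarrow> (sim v a \<and> sim v b \<longrightarrow> sim a b)"
      using near_iff that by simp
  qed
  show ?thesis
    unfolding 1 by (rule Collect_cong, rule conj_cong[OF refl], rule conj_cong[OF refl], simp only: 2)
qed

lemma alive_empty: "alive (card V) = {}"
proof -
  have "card (alive t) \<le> card V - t" for t
  proof (induction t)
    case (Suc t)
    show ?case
    proof (cases "alive t = {}")
      case True then show ?thesis by (simp add: alive_Suc)
    next
      case False
      then obtain v where "v \<in> alive t" "simplicial (alive t) v" using simplicial_exists alive_sub by blast
      then have "alive (Suc t) \<subset> alive t" by (auto simp: alive_Suc)
      then have "card (alive (Suc t)) < card (alive t)"
        using finite_subset[OF alive_sub fin] by (rule psubset_card_mono[rotated])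
      then show ?thesis using Suc by simp
    qed
  qed (simp add: alive_0)
  from this[of "card V"] have "card (alive (card V)) = 0" by simp
  then show ?thesis using finite_subset[OF alive_sub fin, of "card V"] by simp
qed

text \<open>Let \<open>R\<close> be a maximal set of pairwise inseparable vertices containing
  \<open>Q\<close>. When a vertex \<open>v\<close> of \<open>R\<close> is deleted for the first
  time, its surviving neighbours are pairwise inseparable and include \<open>R\<close>, hence equal
  \<open>R\<close>. An element of \<open>R\<close> outside \<open>A\<close> lies in no admissible
  clique, so a neighbour of it outside \<open>R\<close> could be added to \<open>R\<close>.\<close>

lemma clique_region_exists:
  assumes Q: "clq Q" "Q \<noteq> {}"
  shows "\<exists>t\<in>{..n}. \<exists>v\<in>V. let R = clique_region n V adj bi A t v in
    R \<subseteq> V \<and> Q \<subseteq> R \<and> (\<forall>u\<in>R - Q. \<forall>w\<in>R - Q. con Q u w) \<and> (\<forall>m\<in>V - R. \<forall>r\<in>R. adj m r \<longrightarrow> r \<in> A)"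
proof -
  define P where "P R \<longleftrightarrow> R \<subseteq> V \<and> Q \<subseteq> R \<and> (\<forall>u\<in>R. \<forall>v\<in>R. sim u v)" for R
  have "P Q" using Q AV clq_sim[of Q] by (auto simp: clq_def P_def)
  then have "{R. P R} \<noteq> {}" by blast
  moreover have "finite {R. P R}" by (rule finite_subset[of _ "Pow V"]) (use fin in \<open>auto simp: P_def\<close>)
  ultimately obtain R where "R \<in> {R. P R}" "\<forall>S\<in>{R. P R}. R \<subseteq> S \<longrightarrow> R = S"
    using finite_has_maximal[of "{R. P R}"] by blast
  then have PR: "P R" and max: "\<And>S. P S \<Longrightarrow> R \<subseteq> S \<Longrightarrow> S = R" by auto
  have R: "R \<subseteq> V" "Q \<subseteq> R" "\<And>u v. u \<in> R \<Longrightarrow> v \<in> R \<Longrightarrow> sim u v" using PR by (auto simp: P_def)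
  have sep: "con Q u w" if "u \<in> R - Q" "w \<in> R - Q" for u w
    using R that Q by (auto simp: sim_def)
  have inA: "r \<in> A" if m: "m \<in> V - R" "r \<in> R" "adj m r" for m r
  proof (rule ccontr)
    assume rA: "r \<notin> A"
    have "sim m r'" if r': "r' \<in> R" for r'
      unfolding sim_def
    proof (intro allI impI)
      fix Q' assume Q': "clq Q' \<and> m \<notin> Q' \<and> r' \<notin> Q'"
      then have "r \<notin> Q'" using rA by (auto simp: clq_def)
      then have "con Q' r r'" using R r' m Q' by (auto simp: sim_def)
      moreover have "con Q' m r" using m R Q' \<open>r \<notin> Q'\<close> by (intro con_adj) auto
      ultimately show "con Q' m r'" using con_trans by blast
    qed
    then have "P (insert m R)" using R m sim_sym unfolding P_def by auto
    then show False using max[of "insert m R"] m by auto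
  qed
  have "R \<noteq> {}" using R Q by auto
  then have "\<exists>t. \<not> R \<subseteq> alive t" using alive_empty by (intro exI[of _ "card V"]) auto
  define t where "t = (LEAST t. \<not> R \<subseteq> alive t)"
  have t: "\<not> R \<subseteq> alive t" unfolding t_def by (rule LeastI_ex) fact
  have tle: "t \<le> card V" unfolding t_def by (rule Least_le) (use alive_empty \<open>R \<noteq> {}\<close> in auto)
  obtain k where k: "t = Suc k" using t R by (cases t) (auto simp: alive_0)
  have Rk: "R \<subseteq> alive k" using not_less_Least[of k "\<lambda>t. \<not> R \<subseteq> alive t"] k unfolding t_def by auto
  obtain v where v: "v \<in> R" "simplicial (alive k) v" using t k Rk R by (auto simp: alive_Suc)
  have "P {w\<in>alive k. sim v w}" unfolding P_def
  proof (intro conjI ballI)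
    show "{w \<in> alive k. sim v w} \<subseteq> V" using alive_sub by auto
    show "Q \<subseteq> {w \<in> alive k. sim v w}" using v R Rk by auto
    fix a b assume "a \<in> {w \<in> alive k. sim v w}" "b \<in> {w \<in> alive k. sim v w}"
    then show "sim a b" using v(2) unfolding simplicial_def by blast
  qed
  moreover have "R \<subseteq> {w\<in>alive k. sim v w}" using R Rk v by blast
  ultimately have "{w\<in>alive k. sim v w} = R" by (rule max)
  moreover have "clique_region n V adj bi A k v = {w\<in>alive k. sim v w}"
    unfolding clique_region_def
  proof (rule Collect_cong, rule conj_cong[OF refl])
    fix w assume "w \<in> alive k"
    then show "near v w \<longleftrightarrow> sim v w" using alive_sub[of k] v(1) R(1) by (intro near_iff) auto
  qed
  ultimately have reg: "clique_region n V adj bi A k v = R" by simp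
  then show ?thesis
    using sep inA R v(1) k tle card_n reg by (intro bexI[of _ k] bexI[of _ v]) (simp_all add: Let_def, blast+)
qed

end


section \<open>Trees\<close>

definition acyclic_trigraph :: "'a trigraph \<Rightarrow> bool" where
  "acyclic_trigraph H \<longleftrightarrow> (\<nexists>xs. underlying_cycle H xs)"

text \<open>Meant for an edge \<open>x z\<close> of a forest: the component of \<open>z\<close>
  after removal of this edge.\<close>

definition side :: "'a trigraph \<Rightarrow> 'a \<Rightarrow> 'a \<Rightarrow> 'a set" where
  "side H x z = {c. (\<lambda>a b. underlying_adj H a b \<and> {a, b} \<noteq> {x, z})\<^sup>*\<^sup>* z c}"

lemma underlying_adj_sym: "underlying_adj H x y \<longleftrightarrow> underlying_adj H y x"
  by (auto simp: underlying_adj_def)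

lemma rtranclp_path:
  "r\<^sup>*\<^sup>* a b \<Longrightarrow> \<exists>xs. xs \<noteq> [] \<and> hd xs = a \<and> last xs = b \<and> successively r xs \<and> distinct xs"
proof (induction rule: converse_rtranclp_induct)
  case base
  show ?case by (rule exI[of _ "[b]"]) simp
next
  case (step a c)
  then obtain xs where xs: "xs \<noteq> []" "hd xs = c" "last xs = b" "successively r xs" "distinct xs" by blast
  show ?case
  proof (cases "a \<in> set xs")
    case True
    then obtain ys zs where "xs = ys @ a # zs" by (meson split_list)
    then show ?thesis using xs by (intro exI[of _ "a # zs"]) (auto simp: successively_append_iff)
  next
    case False
    then show ?thesis using xs step.hyps(1) by (intro exI[of _ "a # xs"]) (auto simp: successively_Cons)
  qed
qed

lemma not_in_side:
  assumes "acyclic_trigraph H" "underlying_adj H x z"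
  shows "x \<notin> side H x z"
proof
  let ?r = "\<lambda>a b. underlying_adj H a b \<and> {a, b} \<noteq> {x, z}"
  assume "x \<in> side H x z"
  then have "?r\<^sup>*\<^sup>* z x" by (simp add: side_def)
  from rtranclp_path[OF this]
  obtain xs where xs: "xs \<noteq> []" "hd xs = z" "last xs = x" "successively ?r xs" "distinct xs"
    by (elim exE conjE)
  have "x \<noteq> z" using assms(2) by (simp add: underlying_adj_def)
  obtain a ys where "xs = a # ys" using xs(1) by (cases xs) auto
  moreover from this have "ys \<noteq> []" using xs \<open>x \<noteq> z\<close> by auto
  then obtain b zs where "ys = b # zs" by (cases ys) auto
  moreover from calculation have "zs \<noteq> []" using xs by auto
  ultimately have "3 \<le> length xs" by (simp add: Suc_le_eq)
  moreover have "successively (underlying_adj H) xs" using xs(4) by (rule successively_mono) simp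
  ultimately have "underlying_cycle H xs" using xs assms(2) by (simp add: underlying_cycle_def)
  then show False using assms(1) by (auto simp: acyclic_trigraph_def)
qed

lemma self_in_side: "z \<in> side H x z"
  by (simp add: side_def)

lemma side_crossing:
  assumes "acyclic_trigraph H" "underlying_adj H x z" "underlying_adj H c d" "c \<in> side H x z" "d \<notin> side H x z"
  shows "c = z \<and> d = x"
proof -
  have "{c, d} = {x, z}"
  proof (rule ccontr)
    assume "{c, d} \<noteq> {x, z}"
    then have "d \<in> side H x z"
      using assms(3,4) by (auto simp: side_def intro: rtranclp.rtrancl_into_rtrancl)
    then show False using assms(5) by simp
  qed
  then show ?thesis using not_in_side[OF assms(1,2)] assms(4,5) by (auto simp: doubleton_eq_iff)
qed

text \<open>A walk in a tree that never turns back would close a cycle.\<close>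

lemma exists_turning_point:
  assumes H: "acyclic_trigraph H" and \<Lambda>: "finite \<Lambda>" "\<Lambda> \<noteq> {}"
    and s: "\<And>x. x \<in> \<Lambda> \<Longrightarrow> s x \<in> \<Lambda> \<and> underlying_adj H x (s x)"
  shows "\<exists>x\<in>\<Lambda>. s (s x) = x"
proof (rule ccontr)
  assume no: "\<not> (\<exists>x\<in>\<Lambda>. s (s x) = x)"
  obtain x0 where "x0 \<in> \<Lambda>" using \<Lambda> by blast
  define a where "a k = (s ^^ k) x0" for k
  have a: "a k \<in> \<Lambda>" for k by (induction k) (use \<open>x0 \<in> \<Lambda>\<close> s in \<open>auto simp: a_def\<close>)
  have step: "a (Suc k) = s (a k)" for k by (simp add: a_def)
  have "\<not> inj a" 
  proof
    assume "inj a"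
    then have "infinite (range a)" by (rule range_inj_infinite)
    moreover have "range a \<subseteq> \<Lambda>" using a by auto
    ultimately show False using finite_subset[OF _ \<Lambda>(1)] by simp
  qed
  then have "\<exists>j. \<exists>i<j. a i = a j" 
  proof -
    assume "\<not> inj a"
    then obtain i j where "i \<noteq> j" "a i = a j" by (auto simp: inj_on_def)
    then show ?thesis by (cases i j rule: linorder_cases) (auto dest: sym)
  qed
  \<comment> \<open>The first repetition closes a segment of distinct vertices. Its length is at
    least 3 because \<open>s\<close> moves every vertex and, by assumption, never turns
    back.\<close>
  define j where "j = (LEAST j. \<exists>i<j. a i = a j)"
  have "\<exists>i<j. a i = a j" unfolding j_def by (rule LeastI_ex) fact
  then obtain i where i: "i < j" "a i = a j" by blast
  have dist: "a k \<noteq> a l" if "k < l" "l < j" for k l 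
  proof
    assume "a k = a l"
    then have "\<exists>i<l. a i = a l" using that(1) by blast
    then show False using not_less_Least[of l "\<lambda>j. \<exists>i<j. a i = a j"] that(2) unfolding j_def by simp
  qed
  have "j \<noteq> Suc i" using i(2) s[OF a[of i]] step[of i] by (auto simp: underlying_adj_def)
  moreover have "j \<noteq> Suc (Suc i)" 
  proof
    assume "j = Suc (Suc i)"
    then have "s (s (a i)) = a i" using i(2) step[of i] step[of "Suc i"] by simp
    then show False using no a[of i] by blast
  qed
  ultimately have len: "3 \<le> j - i" using i(1) by linarith
  let ?xs = "map a [i..<j]"
  have "distinct ?xs" unfolding distinct_map
  proof (intro conjI inj_onI)
    fix k l assume "k \<in> set [i..<j]" "l \<in> set [i..<j]" "a k = a l"
    then show "k = l" using dist[of k l] dist[of l k] by (cases k l rule: linorder_cases) auto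
  qed simp
  moreover have "successively (underlying_adj H) ?xs"
    unfolding successively_conv_nth using s[OF a] step by (auto simp: nth_append)
  moreover have "last ?xs = a (j - 1)" "hd ?xs = a i" using i by (auto simp: last_map hd_map)
  moreover have "underlying_adj H (a (j - 1)) (a i)"
    using s[OF a[of "j - 1"]] step[of "j - 1"] i by simp
  ultimately have "underlying_cycle H ?xs" using len by (simp add: underlying_cycle_def)
  then show False using H by (auto simp: acyclic_trigraph_def)
qed

section \<open>List homomorphisms as constraint satisfaction\<close>

text \<open>The two ordered pairs are bundled into one constraint, which is symmetric under
  exchanging vertices together with their colours, as \<open>two_sides\<close> requires.\<close>

definition hok :: "'a trigraph \<Rightarrow> ('v \<Rightarrow> 'v \<Rightarrow> bool) \<Rightarrow> 'v \<Rightarrow> 'v \<Rightarrow> 'a \<Rightarrow> 'a \<Rightarrow> bool" where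
  "hok H e u v c d \<longleftrightarrow>
     (if e u v then (c, d) \<in> edges H else (c, d) \<notin> strong H) \<and>
     (if e v u then (d, c) \<in> edges H else (d, c) \<notin> strong H)"

definition sol :: "'a trigraph \<Rightarrow> ('v \<Rightarrow> 'v \<Rightarrow> bool) \<Rightarrow> 'v set \<Rightarrow> ('v \<Rightarrow> 'a set) \<Rightarrow> bool" where
  "sol H e U L \<longleftrightarrow> csp (hok H e) U (\<lambda>u. L u \<inter> verts H)"

lemma hok_sym: "hok H e u v c d \<longleftrightarrow> hok H e v u d c"
  by (auto simp: hok_def)

lemma solI:
  assumes "\<And>u. u \<in> U \<Longrightarrow> f u \<in> L u \<inter> verts H"
    and "\<And>u v. u \<in> U \<Longrightarrow> v \<in> U \<Longrightarrow> u \<noteq> v \<Longrightarrow> hok H e u v (f u) (f v)"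
  shows "sol H e U L"
  unfolding sol_def csp_def using assms by blast

lemma solE:
  assumes "sol H e U L"
  obtains f where "\<And>u. u \<in> U \<Longrightarrow> f u \<in> L u" "\<And>u. u \<in> U \<Longrightarrow> f u \<in> verts H"
    "\<And>u v. u \<in> U \<Longrightarrow> v \<in> U \<Longrightarrow> u \<noteq> v \<Longrightarrow> hok H e u v (f u) (f v)"
proof -
  obtain f where "\<forall>v\<in>U. f v \<in> L v \<inter> verts H" "\<forall>u\<in>U. \<forall>v\<in>U. u \<noteq> v \<longrightarrow> hok H e u v (f u) (f v)"
    using assms unfolding sol_def csp_def by blast
  then show thesis by (intro that[of f]) auto
qed

lemma csp_cong:
  assumes "\<And>v. v \<in> V \<Longrightarrow> L v = L' v"
    and "\<And>u v c d. u \<in> V \<Longrightarrow> v \<in> V \<Longrightarrow> c \<in> L u \<Longrightarrow> d \<in> L v \<Longrightarrow> ok u v c d = ok' u v c d"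
  shows "csp ok V L = csp ok' V L'"
  unfolding csp_def
proof (rule ex_cong1, rule conj_cong)
  fix f
  show "(\<forall>v\<in>V. f v \<in> L v) = (\<forall>v\<in>V. f v \<in> L' v)" using assms(1) by simp
  assume "\<forall>v\<in>V. f v \<in> L' v"
  then show "(\<forall>u\<in>V. \<forall>v\<in>V. u \<noteq> v \<longrightarrow> ok u v (f u) (f v)) = (\<forall>u\<in>V. \<forall>v\<in>V. u \<noteq> v \<longrightarrow> ok' u v (f u) (f v))"
    using assms by (intro ball_cong refl imp_cong) auto
qed

lemma sol_mono:
  assumes "sol H e U L" "\<And>u. u \<in> U \<Longrightarrow> L u \<subseteq> L' u"
  shows "sol H e U L'"
proof -
  obtain f where f: "\<And>u. u \<in> U \<Longrightarrow> f u \<in> L u" "\<And>u. u \<in> U \<Longrightarrow> f u \<in> verts H"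
    "\<And>u v. u \<in> U \<Longrightarrow> v \<in> U \<Longrightarrow> u \<noteq> v \<Longrightarrow> hok H e u v (f u) (f v)"
    by (rule solE[OF assms(1)], blast)
  then show ?thesis using assms(2) by (intro solI[where f = f]) blast+
qed

definition adjE :: "('v \<Rightarrow> 'v \<Rightarrow> bool) \<Rightarrow> 'v \<Rightarrow> 'v \<Rightarrow> bool" where
  "adjE e u v \<longleftrightarrow> u \<noteq> v \<and> (e u v \<or> e v u)"

definition biE :: "('v \<Rightarrow> 'v \<Rightarrow> bool) \<Rightarrow> 'v \<Rightarrow> 'v \<Rightarrow> bool" where
  "biE e u v \<longleftrightarrow> e u v \<and> e v u"

lemma adjE_sym: "adjE e u v \<Longrightarrow> adjE e v u"
  by (auto simp: adjE_def)

lemma hok_adj: "hok H e u v c d \<Longrightarrow> adjE e u v \<Longrightarrow> c = d \<or> underlying_adj H c d"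
  by (auto simp: hok_def adjE_def underlying_adj_def split: if_splits)

lemma hok_nonadj: "\<not> e u v \<Longrightarrow> \<not> e v u \<Longrightarrow> (c, d) \<notin> strong H \<Longrightarrow> (d, c) \<notin> strong H \<Longrightarrow> hok H e u v c d"
  by (auto simp: hok_def)

lemma hok_weak: "(c, d) \<in> weak H \<Longrightarrow> (d, c) \<in> weak H \<Longrightarrow> weak H \<inter> strong H = {} \<Longrightarrow> hok H e u v c d"
  by (auto simp: hok_def edges_def)

definition del_edge :: "'a trigraph \<Rightarrow> 'a \<Rightarrow> 'a \<Rightarrow> 'a trigraph" where
  "del_edge H x y = \<lparr> verts = verts H, weak = weak H - {(x, y), (y, x)}, strong = strong H - {(x, y), (y, x)} \<rparr>"

definition del_vertex :: "'a trigraph \<Rightarrow> 'a \<Rightarrow> 'a trigraph" where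
  "del_vertex H x = \<lparr> verts = verts H - {x}, weak = {p \<in> weak H. fst p \<noteq> x \<and> snd p \<noteq> x},
     strong = {p \<in> strong H. fst p \<noteq> x \<and> snd p \<noteq> x} \<rparr>"

lemma hok_del_edge: "{c, d} \<noteq> {x, y} \<Longrightarrow> hok (del_edge H x y) e u v c d \<longleftrightarrow> hok H e u v c d"
  by (auto simp: hok_def del_edge_def edges_def doubleton_eq_iff)

lemma hok_del_vertex: "c \<noteq> x \<Longrightarrow> d \<noteq> x \<Longrightarrow> hok (del_vertex H x) e u v c d \<longleftrightarrow> hok H e u v c d"
  by (auto simp: hok_def del_vertex_def edges_def)

lemma acyclic_mono:
  assumes "acyclic_trigraph H" "edges H' \<subseteq> edges H"
  shows "acyclic_trigraph H'"
proof -
  have "underlying_adj H' a b \<Longrightarrow> underlying_adj H a b" for a b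
    using assms(2) by (auto simp: underlying_adj_def)
  then have "underlying_cycle H xs" if "underlying_cycle H' xs" for xs
    using that by (auto simp: underlying_cycle_def elim: successively_mono)
  then show ?thesis using assms(1) by (auto simp: acyclic_trigraph_def)
qed


section \<open>Anchored instances\<close>

text \<open>
  \<open>\<rho>\<close> guesses for every colour a vertex that gets this colour, with \<open>\<rho> c \<notin> U\<close> for unused colours.
\<close>

definition anchor :: "'a trigraph \<Rightarrow> ('v \<Rightarrow> 'v \<Rightarrow> bool) \<Rightarrow> 'v set \<Rightarrow> ('a \<Rightarrow> 'v) \<Rightarrow> ('v \<Rightarrow> 'a set) \<Rightarrow> 'v \<Rightarrow> 'a set" where
  "anchor H e U \<rho> L u = {c \<in> L u. c \<in> verts H \<and> \<rho> c \<in> U \<and>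
     (\<forall>d\<in>verts H. \<rho> d \<in> U \<longrightarrow> (if u = \<rho> d then c = d else hok H e u (\<rho> d) c d))}"

lemma anchorD:
  assumes "c \<in> anchor H e U \<rho> L u"
  shows "c \<in> L u" "c \<in> verts H" "\<rho> c \<in> U" "d \<in> verts H \<Longrightarrow> \<rho> d \<in> U \<Longrightarrow> u = \<rho> d \<Longrightarrow> c = d"
    "d \<in> verts H \<Longrightarrow> \<rho> d \<in> U \<Longrightarrow> u \<noteq> \<rho> d \<Longrightarrow> hok H e u (\<rho> d) c d"
  using assms unfolding anchor_def by auto

lemma anchor_exists:
  assumes f: "\<And>u. u \<in> U \<Longrightarrow> f u \<in> L u" "\<And>u. u \<in> U \<Longrightarrow> f u \<in> verts H"
    "\<And>u v. u \<in> U \<Longrightarrow> v \<in> U \<Longrightarrow> u \<noteq> v \<Longrightarrow> hok H e u v (f u) (f v)" and k: "k \<notin> U"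
  obtains \<rho> where "\<And>c. \<rho> c \<in> insert k U" "\<And>c. \<rho> c \<in> U \<longleftrightarrow> c \<in> f ` U" "\<And>u. u \<in> U \<Longrightarrow> f u \<in> anchor H e U \<rho> L u"
proof -
  define \<rho> where "\<rho> c = (if c \<in> f ` U then (SOME u. u \<in> U \<and> f u = c) else k)" for c
  have \<rho>: "\<rho> c \<in> U \<and> f (\<rho> c) = c" if c: "c \<in> f ` U" for c
  proof -
    have "\<exists>u. u \<in> U \<and> f u = c" using c by blast
    from someI_ex[OF this] show ?thesis using c by (simp add: \<rho>_def)
  qed
  have iff: "\<rho> c \<in> U \<longleftrightarrow> c \<in> f ` U" for c using \<rho>[of c] k by (cases "c \<in> f ` U") (auto simp: \<rho>_def)
  show ?thesis
  proof (rule that[of \<rho>])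
    show "\<rho> c \<in> insert k U" for c using \<rho>[of c] by (cases "c \<in> f ` U") (auto simp: \<rho>_def)
    show "\<rho> c \<in> U \<longleftrightarrow> c \<in> f ` U" for c by (rule iff)
    fix u assume u: "u \<in> U"
    have "if u = \<rho> d then f u = d else hok H e u (\<rho> d) (f u) d" if "\<rho> d \<in> U" for d
      using \<rho>[of d] iff[of d] that f(3)[OF u, of "\<rho> d"] by (cases "u = \<rho> d") auto
    then show "f u \<in> anchor H e U \<rho> L u"
      using f(1,2)[OF u] iff u by (auto simp: anchor_def)
  qed
qed


section \<open>Cutting a tree edge\<close>

text \<open>\<open>True\<close> stands for the side of \<open>x\<close> and \<open>False\<close> for
  the side of \<open>y\<close>, in accordance with the special values.\<close>

definition side_list :: "'a trigraph \<Rightarrow> 'a \<Rightarrow> 'a \<Rightarrow> ('v \<Rightarrow> 'a set) \<Rightarrow> bool \<Rightarrow> 'v \<Rightarrow> 'a set" where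
  "side_list H x y L b u = {c \<in> L u. c \<in> side H x y \<longleftrightarrow> \<not> b}"

text \<open>\<open>side_inc\<close> with the cluster test moved to \<open>H'\<close>; this is where
  a problem for \<open>H\<close> becomes a set of questions for a smaller trigraph.\<close>

definition cut_inc ::
  "'a trigraph \<Rightarrow> 'a trigraph \<Rightarrow> 'a \<Rightarrow> 'a \<Rightarrow> ('v \<Rightarrow> 'v \<Rightarrow> bool) \<Rightarrow> 'v set \<Rightarrow> ('v \<Rightarrow> 'a set) \<Rightarrow> 'v \<times> bool \<Rightarrow> 'v \<times> bool \<Rightarrow> bool" where
  "cut_inc H H' x y e U L l m \<longleftrightarrow>
     (let SL = side_list H x y L; sp = (\<lambda>b. if b then x else y) in
     (if fst l = fst m then snd l = snd m \<and>
        \<not> sol H' e (side_cluster (hok H e) U SL sp (snd l) (fst l)) (SL (snd l))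
      else if snd l = snd m then sp (snd l) \<in> SL (snd l) (fst l) \<and> sp (snd l) \<in> SL (snd l) (fst m) \<and>
        \<not> hok H e (fst l) (fst m) (sp (snd l)) (sp (snd l))
      else \<exists>c\<in>SL (snd l) (fst l). \<exists>d\<in>SL (snd m) (fst m). \<not> hok H e (fst l) (fst m) c d))"

definition cut_solvable ::
  "'a trigraph \<Rightarrow> 'a trigraph \<Rightarrow> 'a \<Rightarrow> 'a \<Rightarrow> ('v \<Rightarrow> 'v \<Rightarrow> bool) \<Rightarrow> 'v set \<Rightarrow> ('v \<Rightarrow> 'a set) \<Rightarrow> bool" where
  "cut_solvable H H' x y e U L \<longleftrightarrow>
     (\<forall>v\<in>U. \<not> ((imp_step U (cut_inc H H' x y e U L))\<^sup>*\<^sup>* (v, True) (v, False) \<and>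
       (imp_step U (cut_inc H H' x y e U L))\<^sup>*\<^sup>* (v, False) (v, True)))"

text \<open>In a forest \<open>x\<close> and \<open>y\<close> are the only colours joined across the
  edge. For any other two colours on different sides the constraint just says that the vertices are
  non-adjacent, which gives \<open>cross\<close>. The hypotheses \<open>x\<close> and
  \<open>y\<close> supply \<open>special\<close>.\<close>

lemma cut_solvable_iff:
  assumes H: "acyclic_trigraph H" "underlying_adj H x y" and fin: "finite U"
    and anch: "\<And>u. u \<in> U \<Longrightarrow> L u \<subseteq> anchor H e U \<rho> L0 u"
    and x: "\<And>u. u \<in> U \<Longrightarrow> x \<in> L u \<Longrightarrow> L u - side H x y = {x}"
    and y: "\<And>u. u \<in> U \<Longrightarrow> y \<in> L u \<Longrightarrow> L u \<inter> side H x y = {y}"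
  shows "cut_solvable H (del_edge H x y) x y e U L \<longleftrightarrow> sol H e U L"
proof -
  let ?sp = "\<lambda>b::bool. if b then x else y"
  let ?SL = "side_list H x y L"
  have V: "c \<in> verts H" if "u \<in> U" "c \<in> L u" for u c using anchorD(2)[OF subsetD[OF anch[OF that(1)] that(2)]] .
  have xs: "x \<notin> side H x y" "y \<in> side H x y" using not_in_side[OF H] self_in_side by auto
  have cross: "c = ?sp b" if "c \<in> ?SL b u" "d \<in> ?SL (\<not> b) v" "underlying_adj H c d" for b c d u v
  proof (cases b)
    case True
    then show ?thesis using that side_crossing[OF H, of d c] by (auto simp: side_list_def underlying_adj_sym)
  next
    case False
    then show ?thesis using that side_crossing[OF H, of c d] by (auto simp: side_list_def)
  qed
  have opp: "c \<noteq> d" if "c \<in> ?SL b u" "d \<in> ?SL (\<not> b) v" for b c d u v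
    using that by (auto simp: side_list_def)
  have nonadj: "hok H e u v c d \<longleftrightarrow> \<not> e u v \<and> \<not> e v u"
    if "c \<in> ?SL b u" "d \<in> ?SL (\<not> b) v" "c \<noteq> ?sp b \<or> d \<noteq> ?sp (\<not> b)" for b c d u v
  proof -
    have "\<not> underlying_adj H c d"
    proof
      assume adj: "underlying_adj H c d"
      then have "underlying_adj H d c" by (simp add: underlying_adj_sym)
      then show False using cross[OF that(1,2) adj] cross[OF that(2), of c u] that by auto
    qed
    then have "(c, d) \<notin> edges H" "(d, c) \<notin> edges H"
      using opp[OF that(1,2)] by (auto simp: underlying_adj_def)
    then show ?thesis by (auto simp: hok_def edges_def)
  qed
  have special: "?SL b u = {?sp b}" if "u \<in> U" "?sp b \<in> ?SL b u" for b u
    using x[OF that(1)] y[OF that(1)] that(2) by (cases b) (auto simp: side_list_def)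
  interpret two_sides "hok H e" U ?SL ?sp
  proof
    show "finite U" by fact
    show "hok H e u v c d = hok H e v u d c" for u v c d by (rule hok_sym)
    show "?SL True v \<inter> ?SL False v = {}" for v by (auto simp: side_list_def)
    show "?SL b v = {?sp b}" if "v \<in> U" "?sp b \<in> ?SL b v" for v b using special that by blast
  next
    fix u v c b c' d d'
    assume uv: "u \<in> U" "v \<in> U" "u \<noteq> v" and c: "c \<in> ?SL b u" "c' \<in> ?SL b u" and d: "d \<in> ?SL (\<not> b) v" "d' \<in> ?SL (\<not> b) v"
      and ok: "hok H e u v c d"
    show "hok H e u v c' d'"
    proof (cases "?sp b \<in> ?SL b u \<and> ?sp (\<not> b) \<in> ?SL (\<not> b) v")
      case True
      have s: "?SL b u = {?sp b}" "?SL (\<not> b) v = {?sp (\<not> b)}"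
        by (rule special[OF uv(1) conjunct1[OF True]], rule special[OF uv(2) conjunct2[OF True]])
      have "c = c'" "d = d'" using c d unfolding s by (simp_all only: singleton_iff)
      then show ?thesis using ok by simp
    next
      case False
      have 1: "c \<noteq> ?sp b \<or> d \<noteq> ?sp (\<not> b)" if "c \<in> ?SL b u" "d \<in> ?SL (\<not> b) v" for c d
      proof (rule ccontr)
        assume "\<not> ?thesis"
        then have "c = ?sp b" "d = ?sp (\<not> b)" by (simp_all only: de_Morgan_disj not_not)
        then show False using False that by (simp only: simp_thms)
      qed
      show ?thesis using ok nonadj[OF c(1) d(1) 1[OF c(1) d(1)]] nonadj[OF c(2) d(2) 1[OF c(2) d(2)]] by simp
    qed
  next
    fix b u v c d
    assume st: "side_step (hok H e) U ?SL ?sp b u v" and c: "c \<in> ?SL b u" and d: "d \<in> ?SL (\<not> b) v"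
    have uv: "u \<in> U" "v \<in> U" "u \<noteq> v" "?sp b \<notin> ?SL b u" using st unfolding side_step_def by blast+
    obtain c' d' where c': "c' \<in> ?SL b u" and d': "d' \<in> ?SL b v" and nok: "\<not> hok H e u v c' d'"
      using st unfolding side_step_def by blast
    have csp: "c \<noteq> ?sp b" "c' \<noteq> ?sp b" using uv(4) c c' by blast+
    show "\<not> hok H e u v c d"
    proof
      assume "hok H e u v c d"
      then have na: "\<not> e u v" "\<not> e v u" using nonadj[OF c d] csp by auto
      \<comment> \<open>Since \<open>u\<close> and \<open>v\<close> are non-adjacent, the conflict
        on one side comes from a strong edge between \<open>c'\<close> and \<open>d'\<close>. As
        \<open>v\<close> admits \<open>d'\<close>, it is adjacent to the representative of
        \<open>c'\<close>, so its colour \<open>d\<close> on the other side is joined to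
        \<open>c'\<close>. But only a special value is joined across.\<close>
      then have str: "(c', d') \<in> strong H \<or> (d', c') \<in> strong H" using nok na hok_nonadj[of e u v c' d' H] by blast
      have ac: "c' \<in> anchor H e U \<rho> L0 u" using c' anch[OF uv(1)] by (auto simp: side_list_def)
      have ad: "d \<in> anchor H e U \<rho> L0 v" "d' \<in> anchor H e U \<rho> L0 v"
        using d d' anch[OF uv(2)] by (auto simp: side_list_def)
      have r: "\<rho> c' \<in> U" "c' \<in> verts H" using anchorD(2,3)[OF ac] by auto
      have "v \<noteq> \<rho> c'" using anchorD(4)[OF ad(1) r(2,1)] opp[OF c' d] by auto
      then have h: "hok H e v (\<rho> c') d c'" "hok H e v (\<rho> c') d' c'"
        using anchorD(5)[OF ad(1) r(2,1)] anchorD(5)[OF ad(2) r(2,1)] by auto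
      then have "(d, c') \<in> edges H \<or> (c', d) \<in> edges H" using str by (auto simp: hok_def split: if_splits)
      then have "underlying_adj H c' d" using opp[OF c' d] by (auto simp: underlying_adj_def)
      then show False using cross[OF c' d] csp by simp
    qed
  qed
  \<comment> \<open>Colours on one side never form the pair of \<open>x\<close> and
    \<open>y\<close>, so a problem on one side does not notice the deletion.\<close>
  have csp_eq: "csp (hok H e) W (?SL b) \<longleftrightarrow> sol (del_edge H x y) e W (?SL b)" if W: "W \<subseteq> U" for W b
    unfolding sol_def
  proof (rule csp_cong)
    fix u assume "u \<in> W"
    then show "?SL b u = ?SL b u \<inter> verts (del_edge H x y)"
      using V W by (auto simp: side_list_def del_edge_def)
  next
    fix u v c d assume "c \<in> ?SL b u" "d \<in> ?SL b v"
    then show "hok H e u v c d = hok (del_edge H x y) e u v c d"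
      using xs by (intro hok_del_edge[symmetric]) (cases b; auto simp: side_list_def doubleton_eq_iff)
  qed
  have agree: "cut_inc H (del_edge H x y) x y e U L l m = side_inc (hok H e) U ?SL ?sp l m" if "fst l \<in> U" for l m
    unfolding cut_inc_def side_inc_def Let_def using csp_eq[OF cluster_subset[OF that], of "snd l" "snd l"]
    by (cases "fst l = fst m") simp_all
  have "imp_step U (cut_inc H (del_edge H x y) x y e U L) = imp_step U (side_inc (hok H e) U ?SL ?sp)"
    by (intro ext) (auto simp: imp_step_def agree)
  then have "cut_solvable H (del_edge H x y) x y e U L \<longleftrightarrow> csp (hok H e) U (\<lambda>v. ?SL True v \<union> ?SL False v)"
    unfolding cut_solvable_def solvable_iff_two_sat by simp
  also have "\<dots> \<longleftrightarrow> sol H e U L"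
  proof -
    have "?SL True v \<union> ?SL False v = L v \<inter> verts H" if "v \<in> U" for v
      using V[OF that] by (auto simp: side_list_def)
    then show ?thesis unfolding sol_def csp_def by simp
  qed
  finally show ?thesis .
qed


lemma sol_del_edge:
  assumes "\<And>u. u \<in> U \<Longrightarrow> z \<notin> L u" "z \<in> {x, y}"
  shows "sol (del_edge H x y) e U L \<longleftrightarrow> sol H e U L"
  unfolding sol_def
proof (rule csp_cong)
  fix u v c d
  assume "u \<in> U" "v \<in> U" "c \<in> L u \<inter> verts (del_edge H x y)" "d \<in> L v \<inter> verts (del_edge H x y)"
  then have "{c, d} \<noteq> {x, y}" using assms by (auto simp: doubleton_eq_iff)
  then show "hok (del_edge H x y) e u v c d = hok H e u v c d" by (rule hok_del_edge)
qed (simp add: del_edge_def)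

text \<open>A solution that omits \<open>x\<close> or \<open>y\<close> survives the deletion of the
  edge. Otherwise both have representatives. A vertex that may get \<open>x\<close> is adjacent to
  the representative of \<open>y\<close> in the direction of the strong edge, so all its colours
  have an edge to \<open>y\<close>, and on the side of \<open>x\<close> only \<open>x\<close> has
  one. This and its mirror image are the hypotheses of \<open>cut_solvable_iff\<close>.\<close>

lemma strong_edge_sol_iff:
  assumes tri: "is_trigraph H" and ac: "acyclic_trigraph H" and xy: "(x, y) \<in> strong H" "x \<noteq> y"
    and U: "finite U" "k \<notin> U"
  shows "sol H e U L \<longleftrightarrow> sol (del_edge H x y) e U (\<lambda>u. L u - {x}) \<or> sol (del_edge H x y) e U (\<lambda>u. L u - {y}) \<or>
    (\<exists>\<rho>. (\<forall>c. \<rho> c \<in> insert k U) \<and> \<rho> x \<in> U \<and> \<rho> y \<in> U \<and>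
      cut_solvable H (del_edge H x y) x y e U (anchor H e U \<rho> L))"
proof -
  have adj: "underlying_adj H x y" using xy by (auto simp: underlying_adj_def edges_def)
  have V: "x \<in> verts H" "y \<in> verts H" using xy tri by (auto simp: is_trigraph_def edges_def)
  have xs: "x \<notin> side H x y" "y \<in> side H x y" using not_in_side[OF ac adj] self_in_side by auto
  have cut: "cut_solvable H (del_edge H x y) x y e U (anchor H e U \<rho> L) \<longleftrightarrow> sol H e U (anchor H e U \<rho> L)"
    if \<rho>: "\<rho> x \<in> U" "\<rho> y \<in> U" for \<rho>
  proof (rule cut_solvable_iff[OF ac adj U(1) subset_refl])
    fix u assume u: "u \<in> U" and x: "x \<in> anchor H e U \<rho> L u"
    have "u \<noteq> \<rho> y" using anchorD(4)[OF x V(2) \<rho>(2)] xy by auto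
    then have e: "e u (\<rho> y)" using anchorD(5)[OF x V(2) \<rho>(2)] xy by (auto simp: hok_def split: if_splits)
    have "c = x" if c: "c \<in> anchor H e U \<rho> L u" "c \<notin> side H x y" for c
    proof -
      have "(c, y) \<in> edges H" using anchorD(5)[OF c(1) V(2) \<rho>(2)] \<open>u \<noteq> \<rho> y\<close> e by (auto simp: hok_def)
      then have "underlying_adj H y c" using c(2) xs by (auto simp: underlying_adj_def)
      then show ?thesis using side_crossing[OF ac adj _ xs(2) c(2)] by blast
    qed
    then show "anchor H e U \<rho> L u - side H x y = {x}" using x xs by blast
  next
    fix u assume u: "u \<in> U" and y: "y \<in> anchor H e U \<rho> L u"
    have "u \<noteq> \<rho> x" using anchorD(4)[OF y V(1) \<rho>(1)] xy by auto
    then have e: "e (\<rho> x) u" using anchorD(5)[OF y V(1) \<rho>(1)] xy by (auto simp: hok_def split: if_splits)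
    have "c = y" if c: "c \<in> anchor H e U \<rho> L u" "c \<in> side H x y" for c
    proof -
      have "(x, c) \<in> edges H" using anchorD(5)[OF c(1) V(1) \<rho>(1)] \<open>u \<noteq> \<rho> x\<close> e by (auto simp: hok_def)
      then have "underlying_adj H c x" using c(2) xs by (auto simp: underlying_adj_def)
      then show ?thesis using side_crossing[OF ac adj _ c(2) xs(1)] by blast
    qed
    then show "anchor H e U \<rho> L u \<inter> side H x y = {y}" using y xs by blast
  qed
  show ?thesis
  proof
    assume "sol H e U L"
    then obtain f where f: "\<And>u. u \<in> U \<Longrightarrow> f u \<in> L u" "\<And>u. u \<in> U \<Longrightarrow> f u \<in> verts H"
      "\<And>u v. u \<in> U \<Longrightarrow> v \<in> U \<Longrightarrow> u \<noteq> v \<Longrightarrow> hok H e u v (f u) (f v)" by (rule solE, blast)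
    have avoid: "sol (del_edge H x y) e U (\<lambda>u. L u - {z})" if z: "z \<notin> f ` U" "z \<in> {x, y}" for z
    proof -
      have "sol H e U (\<lambda>u. L u - {z})" by (rule solI[where f = f]) (use f z in auto)
      then show ?thesis using sol_del_edge[of U z "\<lambda>u. L u - {z}" x y H e] z(2) by simp
    qed
    show "sol (del_edge H x y) e U (\<lambda>u. L u - {x}) \<or> sol (del_edge H x y) e U (\<lambda>u. L u - {y}) \<or>
      (\<exists>\<rho>. (\<forall>c. \<rho> c \<in> insert k U) \<and> \<rho> x \<in> U \<and> \<rho> y \<in> U \<and>
        cut_solvable H (del_edge H x y) x y e U (anchor H e U \<rho> L))"
    proof (cases "x \<in> f ` U \<and> y \<in> f ` U")
      case True
      obtain \<rho> where \<rho>: "\<And>c. \<rho> c \<in> insert k U" "\<And>c. \<rho> c \<in> U \<longleftrightarrow> c \<in> f ` U"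
        "\<And>u. u \<in> U \<Longrightarrow> f u \<in> anchor H e U \<rho> L u"
        by (rule anchor_exists[of U f L H e k]) (use f U in auto)
      have "sol H e U (anchor H e U \<rho> L)" by (rule solI[where f = f]) (use \<rho>(3) f in auto)
      then have "cut_solvable H (del_edge H x y) x y e U (anchor H e U \<rho> L)" using cut \<rho>(2) True by blast
      then show ?thesis using \<rho> True by blast
    next
      case False
      then show ?thesis using avoid[of x] avoid[of y] by auto
    qed
  next
    assume "sol (del_edge H x y) e U (\<lambda>u. L u - {x}) \<or> sol (del_edge H x y) e U (\<lambda>u. L u - {y}) \<or>
      (\<exists>\<rho>. (\<forall>c. \<rho> c \<in> insert k U) \<and> \<rho> x \<in> U \<and> \<rho> y \<in> U \<and>
        cut_solvable H (del_edge H x y) x y e U (anchor H e U \<rho> L))"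
    moreover have "sol H e U L" if "sol (del_edge H x y) e U (\<lambda>u. L u - {z})" "z \<in> {x, y}" for z
      using that sol_del_edge[of U z "\<lambda>u. L u - {z}" x y H e] by (auto intro: sol_mono)
    moreover have "sol H e U L" if "sol H e U (anchor H e U \<rho> L)" for \<rho>
      using that by (rule sol_mono) (auto dest: anchorD(1))
    ultimately show "sol H e U L" using cut by blast
  qed
qed


section \<open>Strong loops\<close>

definition clique_check :: "'a trigraph \<Rightarrow> ('v \<Rightarrow> 'v \<Rightarrow> bool) \<Rightarrow> 'v set \<Rightarrow> ('v \<Rightarrow> 'a set) \<Rightarrow> 'a \<Rightarrow> 'v set \<Rightarrow> bool" where
  "clique_check H e U L x Q \<longleftrightarrow> (\<forall>q\<in>Q. x \<in> L q) \<and> (\<forall>q\<in>Q. \<forall>r\<in>Q. q \<noteq> r \<longrightarrow> biE e q r) \<and>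
     sol (del_vertex H x) e (U - Q) (\<lambda>u. {c \<in> L u. \<forall>q\<in>Q. hok H e u q c x})"

lemma clique_check_sound:
  assumes xx: "(x, x) \<in> edges H" "x \<in> verts H" and chk: "clique_check H e U L x Q"
  shows "sol H e U L"
proof -
  obtain g where g: "\<And>u. u \<in> U - Q \<Longrightarrow> g u \<in> {c \<in> L u. \<forall>q\<in>Q. hok H e u q c x}"
    "\<And>u. u \<in> U - Q \<Longrightarrow> g u \<in> verts (del_vertex H x)"
    "\<And>u v. u \<in> U - Q \<Longrightarrow> v \<in> U - Q \<Longrightarrow> u \<noteq> v \<Longrightarrow> hok (del_vertex H x) e u v (g u) (g v)"
    using chk unfolding clique_check_def by (elim conjE) (rule solE, assumption, blast)
  have gx: "g u \<noteq> x" "g u \<in> verts H" if "u \<in> U - Q" for u using g(2)[OF that] by (auto simp: del_vertex_def)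
  define f where "f u = (if u \<in> Q then x else g u)" for u
  show ?thesis
  proof (rule solI[where f = f])
    fix u assume u: "u \<in> U"
    show "f u \<in> L u \<inter> verts H" using g(1)[of u] gx[of u] chk u xx by (auto simp: f_def clique_check_def)
    fix v assume v: "v \<in> U" "u \<noteq> v"
    consider "u \<in> Q" "v \<in> Q" | "u \<in> Q" "v \<notin> Q" | "u \<notin> Q" "v \<in> Q" | "u \<notin> Q" "v \<notin> Q" by blast
    then show "hok H e u v (f u) (f v)"
    proof cases
      case 1
      then have "biE e u v" using chk v by (auto simp: clique_check_def)
      then show ?thesis using 1 xx by (simp add: f_def hok_def biE_def)
    next
      case 2
      then have "hok H e v u (g v) x" using g(1)[of v] v by auto
      then show ?thesis using 2 by (simp add: f_def hok_sym)
    next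
      case 3
      then show ?thesis using g(1)[of u] u by (simp add: f_def)
    next
      case 4
      then show ?thesis using g(3)[of u v] gx[of u] gx[of v] u v by (simp add: f_def hok_del_vertex)
    qed
  qed
qed

text \<open>On \<open>A\<close> the graph is split into the clique \<open>Q\<close> and an
  independent rest. A vertex of the rest adjacent to all of \<open>Q\<close> has neighbourhood
  \<open>Q\<close>; a vertex of \<open>Q\<close> without neighbours in the rest has closed
  neighbourhood \<open>Q\<close>. Failing both, \<open>Q\<close> consists of the vertices with two
  non-adjacent neighbours. So only linearly many \<open>Q\<close> are possible.\<close>

lemma split_partition:
  assumes sym: "\<And>u v. adj u v \<Longrightarrow> adj v u" and irr: "\<And>u. \<not> adj u u"
    and Q: "Q \<subseteq> A" "\<And>u v. u \<in> Q \<Longrightarrow> v \<in> Q \<Longrightarrow> u \<noteq> v \<Longrightarrow> adj u v"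
    and I: "\<And>u v. u \<in> A - Q \<Longrightarrow> v \<in> A - Q \<Longrightarrow> \<not> adj u v"
  shows "(\<exists>w\<in>A. Q = {v\<in>A. adj v w}) \<or> (\<exists>w\<in>A. Q = {v\<in>A. v = w \<or> adj v w}) \<or>
    Q = {v\<in>A. \<exists>a\<in>A. \<exists>b\<in>A. a \<noteq> b \<and> adj v a \<and> adj v b \<and> \<not> adj a b}"
proof (cases "\<exists>w\<in>A - Q. \<forall>q\<in>Q. adj q w")
  case True
  then obtain w where w: "w \<in> A - Q" "\<forall>q\<in>Q. adj q w" by blast
  have "Q = {v\<in>A. adj v w}" using w I Q(1) by blast
  then show ?thesis using w by blast
next
  case no_universal: False
  show ?thesis
  proof (cases "\<exists>w\<in>Q. \<forall>v\<in>A - Q. \<not> adj v w")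
    case True
    then obtain w where w: "w \<in> Q" "\<forall>v\<in>A - Q. \<not> adj v w" by blast
    have "Q = {v\<in>A. v = w \<or> adj v w}" using w Q by blast
    then show ?thesis using w Q(1) by blast
  next
    case False
    have "Q = {v\<in>A. \<exists>a\<in>A. \<exists>b\<in>A. a \<noteq> b \<and> adj v a \<and> adj v b \<and> \<not> adj a b}" (is "_ = ?N")
    proof
      show "Q \<subseteq> ?N"
      proof
        fix v assume v: "v \<in> Q"
        then obtain i where i: "i \<in> A - Q" "adj i v" using False by blast
        then obtain q where q: "q \<in> Q" "\<not> adj q i" using no_universal by blast
        have "adj v i" using i sym by blast
        then have "q \<noteq> v" using q by blast
        then have "adj v q" using Q(2) v q by blast
        moreover have "q \<noteq> i" using q i by blast
        ultimately show "v \<in> ?N" using v Q(1) q i \<open>adj v i\<close> by blast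
      qed
      show "?N \<subseteq> Q"
      proof
        fix v assume "v \<in> ?N"
        then obtain a b where ab: "v \<in> A" "a \<in> A" "b \<in> A" "a \<noteq> b" "adj v a" "adj v b" "\<not> adj a b" by blast
        show "v \<in> Q"
        proof (rule ccontr)
          assume "v \<notin> Q"
          then have "a \<in> Q" "b \<in> Q" using I[of v a] I[of v b] ab by blast+
          then show False using Q(2) ab by blast
        qed
      qed
    qed
    then show ?thesis by blast
  qed
qed

definition loop_cluster :: "('v \<Rightarrow> 'v \<Rightarrow> bool) \<Rightarrow> 'v set \<Rightarrow> 'v set \<Rightarrow> 'v \<Rightarrow> 'v set" where
  "loop_cluster e U R v = {w\<in>U. (\<lambda>a b. adjE e a b \<and> a \<in> U - R \<and> b \<in> U - R)\<^sup>*\<^sup>* v w}"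

definition loop_lists ::
  "'a trigraph \<Rightarrow> ('v \<Rightarrow> 'v \<Rightarrow> bool) \<Rightarrow> ('v \<Rightarrow> 'a set) \<Rightarrow> 'a \<Rightarrow> 'a \<Rightarrow> 'v set \<Rightarrow> 'v set \<Rightarrow> 'v \<Rightarrow> 'a set" where
  "loop_lists H e L x z R Q w =
     {c \<in> L w. c \<in> side H x z \<and> (\<forall>a\<in>R. x \<in> L a \<longrightarrow> hok H e w a c (if a \<in> Q then x else z))}"

text \<open>
  \<open>Q\<close> is the set of vertices of \<open>R\<close> already known to get the colour \<open>x\<close>; the other vertices of \<open>R\<close> whose
  list contains \<open>x\<close> tentatively get the colour \<open>z\<close>. If a component outside \<open>R\<close> cannot be coloured from
  the side of \<open>z\<close> then, it goes elsewhere, and its neighbours in \<open>R\<close> have to get the colour \<open>x\<close>.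
\<close>

definition loop_step ::
  "'a trigraph \<Rightarrow> ('v \<Rightarrow> 'v \<Rightarrow> bool) \<Rightarrow> 'v set \<Rightarrow> ('v \<Rightarrow> 'a set) \<Rightarrow> 'a \<Rightarrow> 'a \<Rightarrow> 'v set \<Rightarrow> 'v set \<Rightarrow> 'v set" where
  "loop_step H e U L x z R Q = {a\<in>R. x \<in> L a \<and> (a \<in> Q \<or> (\<exists>v\<in>U - R. adjE e v a \<and>
     \<not> sol (del_vertex H x) e (loop_cluster e U R v) (loop_lists H e L x z R Q)))}"

text \<open>The iteration starts from the vertices for which the tentative colour \<open>z\<close>
  is impossible.\<close>

definition loop_fix ::
  "nat \<Rightarrow> 'a trigraph \<Rightarrow> ('v \<Rightarrow> 'v \<Rightarrow> bool) \<Rightarrow> 'v set \<Rightarrow> ('v \<Rightarrow> 'a set) \<Rightarrow> 'a \<Rightarrow> 'a \<Rightarrow> 'v set \<Rightarrow> 'v set" where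
  "loop_fix n H e U L x z R = (loop_step H e U L x z R ^^ n) {a\<in>R. x \<in> L a \<and> z \<notin> L a}"

text \<open>\<open>clique_check\<close> verifies every candidate for the colour class of
  \<open>x\<close>, so accepting is sound for any \<open>R\<close>. Candidates are all vertices of
  \<open>R\<close> admitting \<open>x\<close>, the three shapes of \<open>split_partition\<close>,
  and one fixed point per colour \<open>z\<close>.\<close>

definition region_accepts ::
  "nat \<Rightarrow> 'a trigraph \<Rightarrow> ('v \<Rightarrow> 'v \<Rightarrow> bool) \<Rightarrow> 'v set \<Rightarrow> ('v \<Rightarrow> 'a set) \<Rightarrow> 'a \<Rightarrow> 'v set \<Rightarrow> bool" where
  "region_accepts n H e U L x R \<longleftrightarrow>
     clique_check H e U L x {v\<in>R. x \<in> L v} \<or>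
     (\<exists>w\<in>R. clique_check H e U L x {v\<in>R. x \<in> L v \<and> adjE e v w}) \<or>
     (\<exists>w\<in>R. clique_check H e U L x {v\<in>R. x \<in> L v \<and> (v = w \<or> adjE e v w)}) \<or>
     clique_check H e U L x {v\<in>R. x \<in> L v \<and> (\<exists>a\<in>R. x \<in> L a \<and> (\<exists>b\<in>R. x \<in> L b \<and>
       a \<noteq> b \<and> adjE e v a \<and> adjE e v b \<and> \<not> adjE e a b))} \<or>
     (\<exists>z\<in>verts H. clique_check H e U L x (loop_fix n H e U L x z R))"

lemma region_accepts_sound:
  assumes "(x, x) \<in> edges H" "x \<in> verts H" "region_accepts n H e U L x R"
  shows "sol H e U L"
  using assms(3) clique_check_sound[OF assms(1,2)] unfolding region_accepts_def by blast

text \<open>\<open>f\<close> is a solution unknown to the algorithm and \<open>R\<close> a region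
  around its colour class of \<open>x\<close>; the aim is that the tests find some, possibly
  different, solution. \<open>sep\<close> says that the class does not separate \<open>R\<close>,
  and \<open>bdry\<close> that \<open>R\<close> meets the outside only in vertices admitting
  \<open>x\<close>.\<close>

locale loop_instance =
  fixes n :: nat and H :: "'a trigraph" and e :: "'v \<Rightarrow> 'v \<Rightarrow> bool" and U :: "'v set" and L L0 :: "'v \<Rightarrow> 'a set"
    and \<rho> :: "'a \<Rightarrow> 'v" and x :: 'a and f :: "'v \<Rightarrow> 'a" and R :: "'v set"
  assumes tri: "is_trigraph H" and acyc: "acyclic_trigraph H"
    and loops_only: "(a, b) \<in> strong H \<Longrightarrow> a = b" and xx: "(x, x) \<in> strong H"
    and fin: "finite U" and card_n: "card U \<le> n"
    and anch: "u \<in> U \<Longrightarrow> L u \<subseteq> anchor H e U \<rho> L0 u"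
    and \<rho>x: "\<rho> x \<in> U"
    and fL: "u \<in> U \<Longrightarrow> f u \<in> L u"
    and fok: "u \<in> U \<Longrightarrow> v \<in> U \<Longrightarrow> u \<noteq> v \<Longrightarrow> hok H e u v (f u) (f v)"
    and RU: "R \<subseteq> U" and QR: "{u\<in>U. f u = x} \<subseteq> R"
    and sep: "u \<in> R \<Longrightarrow> v \<in> R \<Longrightarrow> f u \<noteq> x \<Longrightarrow> f v \<noteq> x \<Longrightarrow>
      (\<lambda>a b. adjE e a b \<and> a \<in> U \<and> f a \<noteq> x \<and> b \<in> U \<and> f b \<noteq> x)\<^sup>*\<^sup>* u v"
    and bdry: "m \<in> U - R \<Longrightarrow> r \<in> R \<Longrightarrow> adjE e m r \<Longrightarrow> x \<in> L r"
begin

abbreviation "Q \<equiv> {u\<in>U. f u = x}"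
abbreviation "A \<equiv> {v\<in>R. x \<in> L v}"

lemma xV: "x \<in> verts H" using tri xx by (auto simp: is_trigraph_def edges_def)

lemma LV: "u \<in> U \<Longrightarrow> c \<in> L u \<Longrightarrow> c \<in> verts H"
  by (rule anchorD(2)[OF subsetD[OF anch]])

lemma fV: "u \<in> U \<Longrightarrow> f u \<in> verts H" using fL LV by blast

lemma Q_sub_A: "Q \<subseteq> A" using QR fL by force

lemma f_adj: "u \<in> U \<Longrightarrow> v \<in> U \<Longrightarrow> adjE e u v \<Longrightarrow> f u = f v \<or> underlying_adj H (f u) (f v)"
  using fok[of u v] hok_adj[of H e u v] by (auto simp: adjE_def)

lemma Q_bi: "u \<in> Q \<Longrightarrow> v \<in> Q \<Longrightarrow> u \<noteq> v \<Longrightarrow> biE e u v"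
  using fok[of u v] xx by (auto simp: hok_def biE_def split: if_splits)

text \<open>Vertices whose list contains \<open>x\<close> are completely adjacent to the representative of \<open>x\<close>.\<close>

lemma A_colour:
  assumes "v \<in> U" "x \<in> L v" "c \<in> L v"
  shows "c = x \<or> (c, x) \<in> edges H \<and> (x, c) \<in> edges H"
proof (cases "v = \<rho> x")
  case True
  then show ?thesis using anchorD(4)[OF subsetD[OF anch[OF assms(1)] assms(3)] xV \<rho>x] by simp
next
  case False
  have "hok H e v (\<rho> x) x x"
    using anchorD(5)[OF subsetD[OF anch[OF assms(1)] assms(2)] xV \<rho>x False] .
  then have "e v (\<rho> x)" "e (\<rho> x) v" using xx by (auto simp: hok_def split: if_splits)
  moreover have "hok H e v (\<rho> x) c x"
    using anchorD(5)[OF subsetD[OF anch[OF assms(1)] assms(3)] xV \<rho>x False] .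
  ultimately show ?thesis by (auto simp: hok_def)
qed

lemma side_connected:
  assumes z: "underlying_adj H x z" and path: "(\<lambda>a b. adjE e a b \<and> a \<in> U \<and> f a \<noteq> x \<and> b \<in> U \<and> f b \<noteq> x)\<^sup>*\<^sup>* u v"
    and u: "f u \<in> side H x z"
  shows "f v \<in> side H x z"
  using path
proof induction
  case (step a b)
  then have "f a = f b \<or> underlying_adj H (f a) (f b)" using f_adj by blast
  then show ?case using step side_crossing[OF acyc z, of "f a" "f b"] by metis
qed (rule u)

lemma clique_check_Q: "clique_check H e U L x Q"
  unfolding clique_check_def
proof (intro conjI ballI impI)
  show "x \<in> L q" if "q \<in> Q" for q using that Q_sub_A by blast
  show "biE e q r" if "q \<in> Q" "r \<in> Q" "q \<noteq> r" for q r using that by (rule Q_bi)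
  show "sol (del_vertex H x) e (U - Q) (\<lambda>u. {c \<in> L u. \<forall>q\<in>Q. hok H e u q c x})"
  proof (rule solI[where f = f])
    fix u assume u: "u \<in> U - Q"
    have "hok H e u q (f u) x" if "q \<in> Q" for q using fok[of u q] u that by auto
    then show "f u \<in> {c \<in> L u. \<forall>q\<in>Q. hok H e u q c x} \<inter> verts (del_vertex H x)"
      using u fL fV by (auto simp: del_vertex_def)
    fix v assume "v \<in> U - Q" "u \<noteq> v"
    then show "hok (del_vertex H x) e u v (f u) (f v)" using u fok by (auto simp: hok_del_vertex)
  qed
qed

text \<open>\<open>z\<close> names the branch of the tree at \<open>x\<close> from which the rest of
  \<open>R\<close> is coloured.\<close>

definition dominates :: "'a \<Rightarrow> bool" where
  "dominates z \<longleftrightarrow> underlying_adj H x z \<and> (\<forall>r\<in>R. f r \<noteq> x \<longrightarrow> f r \<in> side H x z)"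

text \<open>A list containing \<open>x\<close> consists of \<open>x\<close> and neighbours of
  \<open>x\<close>, and in a tree \<open>z\<close> is the only neighbour of \<open>x\<close> in its
  branch.\<close>

lemma A_two_colours:
  assumes z: "dominates z" and v: "v \<in> A"
  shows "f v = x \<or> f v = z"
proof (rule disjCI)
  assume nz: "f v \<noteq> z"
  show "f v = x"
  proof (rule ccontr)
    assume nx: "f v \<noteq> x"
    then have "underlying_adj H (f v) x"
      using A_colour[of v "f v"] v RU fL by (auto simp: underlying_adj_def)
    moreover have "f v \<in> side H x z" using z v nx by (auto simp: dominates_def)
    ultimately show False
      using side_crossing[OF acyc, of x z "f v" x] not_in_side[OF acyc, of x z] z nz by (auto simp: dominates_def)
  qed
qed

text \<open>The colour of a vertex of \<open>A\<close> outside \<open>Q\<close> is a neighbour of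
  \<open>x\<close>, and \<open>sep\<close> spreads its branch over the rest of
  \<open>R\<close>.\<close>

lemma dominates_or_all_x: "(\<exists>z. dominates z) \<or> A = Q"
proof (rule disjCI)
  assume "A \<noteq> Q"
  then obtain v where v: "v \<in> A" "f v \<noteq> x" using Q_sub_A RU by blast
  then have adj: "underlying_adj H x (f v)"
    using A_colour[of v "f v"] RU fL by (auto simp: underlying_adj_def)
  have "f r \<in> side H x (f v)" if "r \<in> R" "f r \<noteq> x" for r
    using side_connected[OF adj sep[of v r]] that v self_in_side[of "f v"] by auto
  then show "\<exists>z. dominates z" using adj unfolding dominates_def by blast
qed

lemma accepts_if_all_x: "A = Q \<Longrightarrow> region_accepts n H e U L x R"
  using clique_check_Q unfolding region_accepts_def by simp

text \<open>All vertices of \<open>A\<close> outside \<open>Q\<close> have the colour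
  \<open>z\<close>; without a loop at \<open>z\<close> they are independent, and
  \<open>split_partition\<close> applies.\<close>

lemma accepts_if_unlooped:
  assumes z: "dominates z" "(z, z) \<notin> edges H"
  shows "region_accepts n H e U L x R"
proof -
  have adjQ: "adjE e u v" if "u \<in> Q" "v \<in> Q" "u \<noteq> v" for u v using Q_bi[OF that] that by (auto simp: biE_def adjE_def)
  have nonadj: "\<not> adjE e u v" if "u \<in> A - Q" "v \<in> A - Q" for u v
  proof
    assume adj: "adjE e u v"
    have "f u = z" "f v = z" using A_two_colours[OF z(1), of u] A_two_colours[OF z(1), of v] that RU by auto
    moreover have "hok H e u v (f u) (f v)" using fok that RU adj by (auto simp: adjE_def)
    ultimately show False using adj z(2) by (auto simp: hok_def adjE_def split: if_splits)
  qed
  have irr: "\<not> adjE e u u" for u by (simp add: adjE_def)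
  have A: "w \<in> R" if "w \<in> A" for w using that by simp
  from split_partition[where adj = "adjE e", OF adjE_sym irr Q_sub_A adjQ nonadj]
  consider w where "w \<in> A" "Q = {v\<in>A. adjE e v w}" | w where "w \<in> A" "Q = {v\<in>A. v = w \<or> adjE e v w}"
    | "Q = {v\<in>A. \<exists>a\<in>A. \<exists>b\<in>A. a \<noteq> b \<and> adjE e v a \<and> adjE e v b \<and> \<not> adjE e a b}" by blast
  then show ?thesis
  proof cases
    case 1
    then have eq: "Q = {v\<in>R. x \<in> L v \<and> adjE e v w}" by auto
    have "clique_check H e U L x {v\<in>R. x \<in> L v \<and> adjE e v w}" using clique_check_Q unfolding eq .
    then show ?thesis using A[OF 1(1)] unfolding region_accepts_def by blast
  next
    case 2
    then have eq: "Q = {v\<in>R. x \<in> L v \<and> (v = w \<or> adjE e v w)}" by auto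
    have "clique_check H e U L x {v\<in>R. x \<in> L v \<and> (v = w \<or> adjE e v w)}" using clique_check_Q unfolding eq .
    then show ?thesis using A[OF 2(1)] unfolding region_accepts_def by blast
  next
    case 3
    then have eq: "Q = {v\<in>R. x \<in> L v \<and> (\<exists>a\<in>R. x \<in> L a \<and> (\<exists>b\<in>R. x \<in> L b \<and>
       a \<noteq> b \<and> adjE e v a \<and> adjE e v b \<and> \<not> adjE e a b))}" by auto
    have "clique_check H e U L x {v\<in>R. x \<in> L v \<and> (\<exists>a\<in>R. x \<in> L a \<and> (\<exists>b\<in>R. x \<in> L b \<and>
       a \<noteq> b \<and> adjE e v a \<and> adjE e v b \<and> \<not> adjE e a b))}" using clique_check_Q unfolding eq .
    then show ?thesis unfolding region_accepts_def by blast
  qed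
qed

lemma cluster_mem: "v \<in> U - R \<Longrightarrow> w \<in> loop_cluster e U R v \<Longrightarrow> w \<in> U - R"
  unfolding loop_cluster_def by (auto elim: rtranclp.cases)

lemma cluster_step: "v \<in> U - R \<Longrightarrow> w \<in> loop_cluster e U R v \<Longrightarrow> adjE e w u \<Longrightarrow> u \<in> U - R \<Longrightarrow> u \<in> loop_cluster e U R v"
  using cluster_mem[of v w] unfolding loop_cluster_def
  by (auto intro: rtranclp.rtrancl_into_rtrancl)

lemma cluster_self: "v \<in> U \<Longrightarrow> v \<in> loop_cluster e U R v"
  by (simp add: loop_cluster_def)

lemma cluster_eq:
  assumes "w \<in> loop_cluster e U R v"
  shows "loop_cluster e U R w = loop_cluster e U R v"
proof -
  let ?r = "\<lambda>a b. adjE e a b \<and> a \<in> U - R \<and> b \<in> U - R"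
  have "?r\<^sup>*\<^sup>* b a" if "?r\<^sup>*\<^sup>* a b" for a b
    using that
  proof induction
    case (step y z)
    from step.hyps(2) have "?r z y" using adjE_sym[of e y z] by simp
    then show ?case using step.IH by (rule converse_rtranclp_into_rtranclp)
  qed simp
  then show ?thesis using assms unfolding loop_cluster_def by (auto intro: rtranclp_trans)
qed

text \<open>Each of \<open>u\<close> and \<open>v\<close> is, or is adjacent to, the representative
  of \<open>w\<close>. If that vertex is in the cluster of \<open>v\<close>, then \<open>u\<close>
  is in the cluster as well or is a boundary vertex of \<open>R\<close>, which admits
  \<open>x\<close>. If not, it is a boundary vertex itself, although its list contains nothing but
  \<open>w\<close>. So recolouring a cluster on its own cannot violate a strong loop
  elsewhere.\<close>

lemma no_common_loop:
  assumes v: "v \<in> U - R" and u: "u \<in> U" "u \<notin> loop_cluster e U R v" "u \<in> R \<Longrightarrow> x \<notin> L u"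
    and w: "(w, w) \<in> strong H" "w \<in> L u" "w \<in> L v" "w \<noteq> x"
  shows False
proof -
  have vU: "v \<in> U" using v by simp
  have au: "w \<in> anchor H e U \<rho> L0 u" and av: "w \<in> anchor H e U \<rho> L0 v"
    using anch[OF u(1)] anch[OF vU] w by auto
  have r: "w \<in> verts H" "\<rho> w \<in> U" using anchorD(2,3)[OF au] by auto
  have adj: "adjE e a (\<rho> w)" if "a \<noteq> \<rho> w" "w \<in> anchor H e U \<rho> L0 a" for a
    using anchorD(5)[OF that(2) r that(1)] w(1) that(1) by (auto simp: hok_def adjE_def split: if_splits)
  show False
  proof (cases "\<rho> w \<in> loop_cluster e U R v")
    case *: True
    then have ne: "u \<noteq> \<rho> w" using u by auto
    have adj': "adjE e (\<rho> w) u" using adj[OF ne au] by (rule adjE_sym)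
    show False
    proof (cases "u \<in> R")
      case True
      then have "x \<in> L u" using bdry[OF cluster_mem[OF v *] _ adj'] by blast
      then show False using u True by blast
    next
      case False
      then show False using cluster_step[OF v * adj'] u by blast
    qed
  next
    case False
    then have ne: "v \<noteq> \<rho> w" using cluster_self[OF vU] by auto
    have adj': "adjE e v (\<rho> w)" using adj[OF ne av] .
    have "\<rho> w \<in> R" using cluster_step[OF v cluster_self[OF vU] adj'] r False by blast
    then have "x \<in> L (\<rho> w)" using bdry[OF v _ adj'] by blast
    then have "x = w" using anchorD(4)[OF subsetD[OF anch[OF r(2)]] r] by blast
    then show False using w by simp
  qed
qed

context
  fixes z :: 'a
  assumes z: "dominates z" and zz: "(z, z) \<in> weak H" and xz: "(x, z) \<in> weak H" "(z, x) \<in> weak H"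
begin

abbreviation "stp \<equiv> loop_step H e U L x z R"
abbreviation "Qz \<equiv> loop_fix n H e U L x z R"

lemma zx: "z \<noteq> x" and z_side: "z \<in> side H x z" and x_side: "x \<notin> side H x z"
  using z not_in_side[OF acyc] self_in_side by (auto simp: dominates_def underlying_adj_def)

lemma disjoint_edges: "weak H \<inter> strong H = {}" using tri by (simp add: is_trigraph_def)

lemma zV: "z \<in> verts H" using zz tri by (auto simp: is_trigraph_def edges_def)

text \<open>Strong edges are loops here, and the loop at \<open>z\<close> is weak; hence
  \<open>z\<close> imposes nothing on non-neighbours.\<close>

lemma strong_z: "(z, c) \<notin> strong H" "(c, z) \<notin> strong H"
  using loops_only[of z c] loops_only[of c z] zz disjoint_edges by auto

lemma hok_nonadj_z: "\<not> adjE e u v \<Longrightarrow> u \<noteq> v \<Longrightarrow> hok H e u v c z"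
  using strong_z by (intro hok_nonadj) (auto simp: adjE_def)

lemma hok_zz: "hok H e u v z z" by (rule hok_weak[OF zz zz disjoint_edges])

lemma hok_zx: "hok H e u v z x" by (rule hok_weak[OF xz(2) xz(1) disjoint_edges])

text \<open>A neighbour of a vertex coloured \<open>x\<close> on the side of \<open>z\<close> has the colour \<open>z\<close>.\<close>

lemma hok_shift:
  assumes "u \<in> U" "v \<in> U" "u \<noteq> v" "f v = x \<or> f v = z" "f u \<in> side H x z"
  shows "hok H e u v (f u) z"
proof (cases "f v = z")
  case True
  then show ?thesis using fok assms by metis
next
  case False
  then have fv: "f v = x" using assms(4) by simp
  show ?thesis
  proof (cases "adjE e u v")
    case True
    then have "underlying_adj H (f u) x" using f_adj[OF assms(1,2) True] assms(5) fv x_side by auto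
    then have "f u = z" using side_crossing[OF acyc _ _ assms(5) x_side] z by (auto simp: dominates_def)
    then show ?thesis by (simp add: hok_zz)
  next
    case False
    then show ?thesis using hok_nonadj_z assms(3) by blast
  qed
qed

lemma step_mono: "S \<subseteq> A \<Longrightarrow> S \<subseteq> stp S \<and> stp S \<subseteq> A"
  by (auto simp: loop_step_def)

text \<open>\<open>f\<close> itself refutes a wrong addition: if \<open>a\<close> had the colour
  \<open>z\<close>, the outside component next to it would be coloured by \<open>f\<close> from the
  branch of \<open>z\<close>, and by \<open>hok_shift\<close> this colouring also fits the tentative
  colours.\<close>

lemma iterate_sub_Q: "(stp ^^ k) {a\<in>R. x \<in> L a \<and> z \<notin> L a} \<subseteq> Q"
proof (induction k)
  case 0
  have "f a = x" if "a \<in> A" "z \<notin> L a" for a using A_two_colours[OF z that(1)] fL[of a] that RU by auto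
  then show ?case using RU by auto
next
  case (Suc k)
  let ?S = "(stp ^^ k) {a\<in>R. x \<in> L a \<and> z \<notin> L a}"
  have "a \<in> Q" if a: "a \<in> stp ?S" for a
  proof (rule ccontr)
    assume aQ: "a \<notin> Q"
    have aA: "a \<in> A" using a by (auto simp: loop_step_def)
    then have aU: "a \<in> U" using RU by auto
    then have fa: "f a = z" using A_two_colours[OF z aA] aQ by auto
    have "a \<notin> ?S" using aQ Suc by auto
    then obtain v where v: "v \<in> U - R" "adjE e v a"
      and ns: "\<not> sol (del_vertex H x) e (loop_cluster e U R v) (loop_lists H e L x z R ?S)"
      using a by (auto simp: loop_step_def)
    have fx: "f w \<noteq> x" if "w \<in> U - R" for w using QR that by auto
    \<comment> \<open>The only colour joined to \<open>z\<close> from outside its branch is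
      \<open>x\<close>, and \<open>f\<close> uses \<open>x\<close> only inside
      \<open>R\<close>.\<close>
    have fv: "f v \<in> side H x z"
    proof (rule ccontr)
      assume n: "f v \<notin> side H x z"
      then have "underlying_adj H z (f v)" using f_adj[of v a] v aU fa z_side by (auto simp: underlying_adj_sym)
      then show False using side_crossing[OF acyc _ _ z_side n] z fx[OF v(1)] by (auto simp: dominates_def)
    qed
    have "sol (del_vertex H x) e (loop_cluster e U R v) (loop_lists H e L x z R ?S)"
    proof (rule solI[where f = f])
      fix w assume w: "w \<in> loop_cluster e U R v"
      have wU: "w \<in> U - R" by (rule cluster_mem[OF v(1) w])
      have "(\<lambda>a b. adjE e a b \<and> a \<in> U - R \<and> b \<in> U - R)\<^sup>*\<^sup>* v w" using w by (simp add: loop_cluster_def)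
      then have "(\<lambda>a b. adjE e a b \<and> a \<in> U \<and> f a \<noteq> x \<and> b \<in> U \<and> f b \<noteq> x)\<^sup>*\<^sup>* v w"
        by (rule rtranclp_mono[THEN predicate2D, rotated]) (use fx in auto)
      then have fw: "f w \<in> side H x z" using side_connected z fv by (auto simp: dominates_def)
      have "hok H e w b (f w) (if b \<in> ?S then x else z)" if b: "b \<in> A" for b
      proof -
        have ne: "w \<noteq> b" "b \<in> U" using b wU RU by auto
        show ?thesis
        proof (cases "b \<in> ?S")
          case True
          then have "f b = x" using Suc by auto
          then show ?thesis using True fok[of w b] ne wU by auto
        next
          case False
          then show ?thesis using hok_shift[of w b] A_two_colours[OF z b] ne wU fw by auto
        qed
      qed
      then show "f w \<in> loop_lists H e L x z R ?S w \<inter> verts (del_vertex H x)"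
        using fw fL fV fx[OF wU] wU by (auto simp: loop_lists_def del_vertex_def)
      fix w' assume w': "w' \<in> loop_cluster e U R v" "w \<noteq> w'"
      then have "w' \<in> U - R" using cluster_mem[OF v(1)] by blast
      then show "hok (del_vertex H x) e w w' (f w) (f w')"
        using fok[of w w'] fx[of w'] fx[OF wU] wU w' by (auto simp: hok_del_vertex)
    qed
    then show False using ns by simp
  qed
  then show ?case by auto
qed

lemma Qz_sub_Q: "Qz \<subseteq> Q" unfolding loop_fix_def by (rule iterate_sub_Q)

lemma Qz_stable: "stp Qz = Qz"
  unfolding loop_fix_def
proof (rule funpow_stabilizes[where V = A])
  have AU: "A \<subseteq> U" using RU by auto
  show "finite A" by (rule finite_subset[OF AU fin])
  show "card A \<le> n" using card_mono[OF fin AU] card_n by simp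
qed (use step_mono in auto)

lemma Qz_base: "a \<in> A \<Longrightarrow> a \<notin> Qz \<Longrightarrow> z \<in> L a"
proof (rule ccontr)
  assume a: "a \<in> A" "a \<notin> Qz" "z \<notin> L a"
  have "{a\<in>R. x \<in> L a \<and> z \<notin> L a} \<subseteq> (stp ^^ k) {a\<in>R. x \<in> L a \<and> z \<notin> L a}" for k
  proof (induction k)
    case (Suc k)
    have "(stp ^^ k) {a\<in>R. x \<in> L a \<and> z \<notin> L a} \<subseteq> A" using iterate_sub_Q Q_sub_A by blast
    then have "(stp ^^ k) {a\<in>R. x \<in> L a \<and> z \<notin> L a} \<subseteq> stp ((stp ^^ k) {a\<in>R. x \<in> L a \<and> z \<notin> L a})"
      by (rule conjunct1[OF step_mono])
    from order_trans[OF Suc this] show ?case unfolding funpow.simps o_apply .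
  qed simp
  then show False using a unfolding loop_fix_def by blast
qed

text \<open>The solution is rebuilt: vertices of \<open>A\<close> outside \<open>Qz\<close> get
  \<open>z\<close>, solvable outside components use colourings of their own, and everything else
  keeps \<open>f\<close>. By \<open>Qz_stable\<close> an unsolvable component has no neighbour in
  \<open>A\<close> outside \<open>Qz\<close>, since such a neighbour would have been added.\<close>

lemma clique_check_Qz: "clique_check H e U L x Qz"
proof -
  let ?good = "\<lambda>v. sol (del_vertex H x) e (loop_cluster e U R v) (loop_lists H e L x z R Qz)"
  define ext where "ext S h \<longleftrightarrow> (\<forall>w\<in>S. h w \<in> loop_lists H e L x z R Qz w \<inter> verts (del_vertex H x)) \<and>
      (\<forall>w\<in>S. \<forall>w'\<in>S. w \<noteq> w' \<longrightarrow> hok (del_vertex H x) e w w' (h w) (h w'))" for S h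
  \<comment> \<open>The choice is made per set, so that all vertices of a component use the same
    colouring.\<close>
  define g where "g S = (SOME h. ext S h)" for S
  have g: "ext (loop_cluster e U R v) (g (loop_cluster e U R v))" if "?good v" for v
  proof -
    have "\<exists>h. ext (loop_cluster e U R v) h" using that unfolding sol_def csp_def ext_def .
    then show ?thesis unfolding g_def by (rule someI_ex)
  qed
  define f' where "f' u = (if u \<in> A then z else if u \<notin> R \<and> ?good u then g (loop_cluster e U R u) u else f u)" for u
  have fx: "f w \<noteq> x" if "w \<in> U - R" for w using QR that by auto
  have f'A: "f' u = z" if "u \<in> A" for u using that by (simp add: f'_def)
  have f'R: "f' u = f u" if "u \<in> R" "u \<notin> A" for u using that by (simp add: f'_def)
  have f'B: "f' u = f u" if "u \<notin> R" "\<not> ?good u" for u using that by (simp add: f'_def)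
  have f'G: "f' u = g (loop_cluster e U R u) u" if "u \<notin> R" "?good u" for u using that by (simp add: f'_def)
  have G: "f' u \<in> L u" "f' u \<in> side H x z" "f' u \<in> verts H" "f' u \<noteq> x"
    "\<And>a. a \<in> A \<Longrightarrow> hok H e u a (f' u) (if a \<in> Qz then x else z)" if u: "u \<in> U - R" "?good u" for u
  proof -
    have "u \<in> loop_cluster e U R u" using cluster_self u by auto
    then have "f' u \<in> loop_lists H e L x z R Qz u \<inter> verts (del_vertex H x)"
      using g[OF u(2)] f'G[of u] u unfolding ext_def by auto
    then show "f' u \<in> L u" "f' u \<in> side H x z" "f' u \<in> verts H" "f' u \<noteq> x"
      "\<And>a. a \<in> A \<Longrightarrow> hok H e u a (f' u) (if a \<in> Qz then x else z)"
      by (auto simp: loop_lists_def del_vertex_def)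
  qed
  \<comment> \<open>Apart from its own component and \<open>A\<close>, the vertex \<open>v\<close>
    has no neighbours, by \<open>bdry\<close>; for non-neighbours \<open>no_common_loop\<close>
    excludes a common strong loop.\<close>
  have far: "hok H e u v (f' u) (f' v)"
    if u: "u \<in> U" "u \<in> R \<Longrightarrow> u \<notin> A" "u \<notin> loop_cluster e U R v" and v: "v \<in> U - R" "?good v" and "u \<noteq> v" and fu: "f' u \<in> L u" for u v
  proof (rule hok_nonadj)
    have na: "\<not> adjE e v u"
    proof
      assume adj: "adjE e v u"
      show False
      proof (cases "u \<in> R")
        case True
        then show False using bdry[OF v(1) True adj] u(2) by auto
      next
        case False
        then show False using cluster_step[OF v(1) cluster_self adj] u v by auto
      qed
    qed
    then show "\<not> e u v" "\<not> e v u" using \<open>u \<noteq> v\<close> by (auto simp: adjE_def)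
    have no: False if "f' u = f' v" "(f' v, f' v) \<in> strong H"
      using no_common_loop[OF v(1) u(1) u(3) _ that(2)] u(2) fu G[OF v] that(1) by auto
    show "(f' u, f' v) \<notin> strong H" "(f' v, f' u) \<notin> strong H" using no loops_only by metis+
  qed
  have sol: "sol (del_vertex H x) e (U - Qz) (\<lambda>u. {c \<in> L u. \<forall>q\<in>Qz. hok H e u q c x})"
  proof (rule solI[where f = f'])
    have mem: "f' u \<in> L u \<and> f' u \<in> verts H \<and> f' u \<noteq> x \<and> (\<forall>q\<in>Qz. hok H e u q (f' u) x)" if u: "u \<in> U - Qz" for u
    proof -
      have orig: ?thesis if "f' u = f u" "f u \<noteq> x"
      proof -
        have "hok H e u q (f u) x" if "q \<in> Qz" for q using that Qz_sub_Q fok[of u q] u by auto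
        then show ?thesis using that fL fV u by auto
      qed
      consider "u \<in> A" | "u \<in> R" "u \<notin> A" | "u \<notin> R" "?good u" | "u \<notin> R" "\<not> ?good u" by blast
      then show ?thesis
      proof cases
        case 1
        then show ?thesis using Qz_base[of u] u f'A[OF 1] hok_zx zV zx by auto
      next
        case 2
        then have "f u \<noteq> x" using fL[of u] u by auto
        then show ?thesis using orig f'R[OF 2] by blast
      next
        case 3
        have "hok H e u q (f' u) x" if "q \<in> Qz" for q
          using G(5)[of u q] 3 u that Qz_sub_Q Q_sub_A by auto
        then show ?thesis using G[of u] 3 u by blast
      next
        case 4
        then show ?thesis using orig f'B[OF 4] fx u by blast
      qed
    qed
    show "f' u \<in> {c \<in> L u. \<forall>q\<in>Qz. hok H e u q c x} \<inter> verts (del_vertex H x)" if "u \<in> U - Qz" for u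
      using mem[OF that] by (auto simp: del_vertex_def)
    \<comment> \<open>\<open>ord\<close> selects one order of \<open>u\<close> and \<open>v\<close>
      for the asymmetric kinds of pairs; the other order follows from the symmetry of
      \<open>hok\<close>.\<close>
    have main: "hok H e u v (f' u) (f' v)"
      if uv: "u \<in> U - Qz" "v \<in> U - Qz" "u \<noteq> v" and ord: "u \<in> A \<or> v \<notin> A" "v \<notin> R \<and> ?good v \<or> u \<in> A \<or> \<not> (u \<notin> R \<and> ?good u)" for u v
    proof -
      consider "u \<in> A" "v \<in> A" | "u \<in> A" "v \<in> R" "v \<notin> A" | "u \<in> A" "v \<notin> R" "?good v" | "u \<in> A" "v \<notin> R" "\<not> ?good v"
        | "u \<notin> A" "v \<notin> A" "v \<notin> R" "?good v" | "u \<notin> A" "v \<notin> A" "\<not> (v \<notin> R \<and> ?good v)" "\<not> (u \<notin> R \<and> ?good u)"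
        using ord by blast
      then show ?thesis
      proof cases
        case 1
        then show ?thesis by (simp add: f'A hok_zz)
      next
        case 2
        have fv: "f v \<in> side H x z" using z 2 fL[of v] uv by (auto simp: dominates_def)
        have "hok H e v u (f v) z"
          using hok_shift[of v u] uv 2 A_two_colours[OF z 2(1)] fv by auto
        then show ?thesis using f'A[OF 2(1)] f'R[OF 2(2,3)] hok_sym by metis
      next
        case 3
        have "hok H e v u (f' v) z" using G(5)[of v u] 3 uv by auto
        then show ?thesis using f'A[OF 3(1)] hok_sym by metis
      next
        case 4
        have "\<not> adjE e v u"
        proof
          assume "adjE e v u"
          then have "u \<in> stp Qz" using 4 uv by (auto simp: loop_step_def)
          then show False using Qz_stable uv by simp
        qed
        then have "hok H e v u (f' v) z" using hok_nonadj_z uv by auto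
        then show ?thesis using f'A[OF 4(1)] hok_sym by metis
      next
        case 5
        show ?thesis
        proof (cases "u \<in> loop_cluster e U R v")
          case True
          have "u \<notin> R" using cluster_mem[of v u] True 5 uv by auto
          have eq: "loop_cluster e U R u = loop_cluster e U R v" by (rule cluster_eq[OF True])
          then have gu: "?good u" using 5 by simp
          have "hok (del_vertex H x) e u v (f' u) (f' v)"
            using g[OF 5(4), unfolded ext_def] f'G[OF \<open>u \<notin> R\<close> gu] f'G[OF 5(3,4)] eq True cluster_self[of v] uv by auto
          then show ?thesis using mem uv by (simp add: hok_del_vertex)
        next
          case False
          then show ?thesis using far[of u v] 5 uv mem by auto
        qed
      next
        case 6
        then have "f' u = f u" "f' v = f v" by (auto simp: f'_def)
        then show ?thesis using fok uv by auto
      qed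
    qed
    fix u v assume uv: "u \<in> U - Qz" "v \<in> U - Qz" "u \<noteq> v"
    have "hok H e u v (f' u) (f' v)"
    proof (cases "(u \<in> A \<or> v \<notin> A) \<and> (v \<notin> R \<and> ?good v \<or> u \<in> A \<or> \<not> (u \<notin> R \<and> ?good u))")
      case True
      then show ?thesis using main uv by blast
    next
      case False
      then have "hok H e v u (f' v) (f' u)" using uv by (intro main) auto
      then show ?thesis by (simp add: hok_sym)
    qed
    then show "hok (del_vertex H x) e u v (f' u) (f' v)" using mem uv by (simp add: hok_del_vertex)
  qed
  show ?thesis
    unfolding clique_check_def using sol Qz_sub_Q Q_sub_A Q_bi by blast
qed

end

text \<open>A vertex of \<open>A\<close> coloured \<open>z\<close> shows that \<open>x\<close> and
  \<open>z\<close> are joined in both directions. These edges are weak because strong edges are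
  loops here, so \<open>clique_check_Qz\<close> covers a weak loop at \<open>z\<close>.\<close>

lemma accepts_or_strong_neighbour:
  "region_accepts n H e U L x R \<or> (\<exists>z. dominates z \<and> (z, z) \<in> strong H)"
proof (cases "A = Q")
  case True
  then show ?thesis using accepts_if_all_x by blast
next
  case False
  then obtain z where z: "dominates z" using dominates_or_all_x by blast
  obtain v where v: "v \<in> A" "f v \<noteq> x" using False Q_sub_A RU by blast
  then have "f v = z" using A_two_colours[OF z] by blast
  then have xz: "(x, z) \<in> edges H" "(z, x) \<in> edges H" using A_colour[of v "f v"] v RU fL by auto
  have "z \<noteq> x" using \<open>f v = z\<close> v by blast
  then have xz': "(x, z) \<in> weak H" "(z, x) \<in> weak H" using xz loops_only unfolding edges_def by blast+
  have zV: "z \<in> verts H" using tri xz by (auto simp: is_trigraph_def)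
  show ?thesis
  proof (cases "(z, z) \<in> weak H")
    case True
    then show ?thesis using clique_check_Qz[OF z True xz'] zV unfolding region_accepts_def by blast
  next
    case False
    then show ?thesis using accepts_if_unlooped[OF z] z by (auto simp: edges_def)
  qed
qed

end


text \<open>Two guessed regions decide which vertices admitting exactly one of \<open>x\<close> and
  \<open>y\<close> really get it. In a trimmed anchored list, \<open>x\<close> can then only occur
  as the sole colour on its side, as \<open>cut_solvable_iff\<close> demands; likewise
  \<open>y\<close>.\<close>

definition trim :: "'a \<Rightarrow> 'a \<Rightarrow> 'v set \<Rightarrow> 'v set \<Rightarrow> ('v \<Rightarrow> 'a set) \<Rightarrow> 'v \<Rightarrow> 'a set" where
  "trim x y Rx Ry L u = {c \<in> L u.
     (x \<in> L u \<and> y \<notin> L u \<longrightarrow> (c = x \<longleftrightarrow> u \<in> Rx)) \<and> (y \<in> L u \<and> x \<notin> L u \<longrightarrow> (c = y \<longleftrightarrow> u \<in> Ry))}"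

definition strong_loops :: "'a trigraph \<Rightarrow> 'a set" where
  "strong_loops H = {x \<in> verts H. (x, x) \<in> strong H}"

definition region :: "nat \<Rightarrow> ('v \<Rightarrow> 'v \<Rightarrow> bool) \<Rightarrow> 'v set \<Rightarrow> ('v \<Rightarrow> 'a set) \<Rightarrow> 'a \<Rightarrow> nat \<Rightarrow> 'v \<Rightarrow> 'v set" where
  "region n e U L x t v = clique_region n U (adjE e) (biE e) {u\<in>U. x \<in> L u} t v"

definition loops_accept ::
  "nat \<Rightarrow> 'a trigraph \<Rightarrow> ('v \<Rightarrow> 'v \<Rightarrow> bool) \<Rightarrow> 'v set \<Rightarrow> ('v \<Rightarrow> 'a set) \<Rightarrow> ('a \<Rightarrow> 'v) \<Rightarrow> bool" where
  "loops_accept n H e U L \<rho> \<longleftrightarrow>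
     (\<exists>x\<in>strong_loops H. \<exists>t\<in>{..n}. \<exists>v\<in>U. region_accepts n H e U L x (region n e U L x t v)) \<or>
     (\<exists>x\<in>strong_loops H. \<exists>y\<in>strong_loops H. underlying_adj H x y \<and> \<rho> x \<in> U \<and> \<rho> y \<in> U \<and>
       (\<exists>t\<in>{..n}. \<exists>v\<in>U. \<exists>t'\<in>{..n}. \<exists>v'\<in>U. cut_solvable H (del_edge H x y) x y e U
          (trim x y (region n e U L x t v) (region n e U L y t' v') L)))"

text \<open>If all strong loops occur as colours and no region accepts, every \<open>x\<close> has a
  strongly looped neighbour \<open>s x\<close> that dominates its region. At a turning pair the two
  regions, each dominated by the other colour, reveal enough of the solution for
  \<open>trim\<close>.\<close>

lemma loops_sol_iff:
  assumes tri: "is_trigraph H" and ac: "acyclic_trigraph H"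
    and loops: "\<And>a b. (a, b) \<in> strong H \<Longrightarrow> a = b" and ne: "strong H \<noteq> {}"
    and U: "finite U" "card U \<le> n" "k \<notin> U"
  shows "sol H e U L \<longleftrightarrow> (\<exists>x\<in>strong_loops H. sol (del_vertex H x) e U L) \<or>
    (\<exists>\<rho>. (\<forall>c. \<rho> c \<in> insert k U) \<and> loops_accept n H e U (anchor H e U \<rho> L) \<rho>)"
proof -
  have "strong_loops H \<noteq> {}"
  proof -
    obtain a b where ab: "(a, b) \<in> strong H" using ne by auto
    then have "(a, a) \<in> strong H" "a \<in> verts H" using loops[OF ab] tri by (auto simp: is_trigraph_def edges_def)
    then show ?thesis by (auto simp: strong_loops_def)
  qed
  have finL: "finite (strong_loops H)" using tri by (auto simp: strong_loops_def is_trigraph_def)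
  have cut: "cut_solvable H (del_edge H x y) x y e U (trim x y Rx Ry (anchor H e U \<rho> L)) \<longleftrightarrow>
      sol H e U (trim x y Rx Ry (anchor H e U \<rho> L))"
    if xy: "x \<in> strong_loops H" "y \<in> strong_loops H" "underlying_adj H x y" "\<rho> x \<in> U" "\<rho> y \<in> U" for x y \<rho> Rx Ry
  proof -
    let ?L = "anchor H e U \<rho> L"
    have V: "x \<in> verts H" "y \<in> verts H" "(x, x) \<in> strong H" "(y, y) \<in> strong H"
      using xy by (auto simp: strong_loops_def)
    have xs: "x \<notin> side H x y" "y \<in> side H x y" "x \<noteq> y"
      using not_in_side[OF ac xy(3)] self_in_side xy(3) by (auto simp: underlying_adj_def)
    have near: "c = z \<or> underlying_adj H c z"
      if "z \<in> {x, y}" "z \<in> ?L u" "c \<in> ?L u" for z c u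
    proof (cases "u = \<rho> z")
      case True
      then show ?thesis using anchorD(4)[OF that(3), of z] V that(1) xy by auto
    next
      case False
      have z: "z \<in> verts H" "\<rho> z \<in> U" "(z, z) \<in> strong H" using that(1) V xy by auto
      have "hok H e u (\<rho> z) z z" "hok H e u (\<rho> z) c z"
        using anchorD(5)[OF that(2) z(1,2) False] anchorD(5)[OF that(3) z(1,2) False] by auto
      then show ?thesis using z(3) by (auto simp: hok_def underlying_adj_def split: if_splits)
    qed
    \<comment> \<open>A third colour joined to both \<open>x\<close> and \<open>y\<close> would
      close a triangle.\<close>
    have two: "c = x \<or> c = y" if "x \<in> ?L u" "y \<in> ?L u" "c \<in> ?L u" for c u
    proof (rule ccontr)
      assume "\<not> ?thesis"
      then have c: "c \<noteq> x" "c \<noteq> y" "underlying_adj H c x" "underlying_adj H c y"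
        using near[of x u c] near[of y u c] that by auto
      show False
      proof (cases "c \<in> side H x y")
        case True
        then show False using side_crossing[OF ac xy(3) c(3) True xs(1)] c by simp
      next
        case False
        have "underlying_adj H y c" using c(4) by (simp add: underlying_adj_sym)
        then show False using side_crossing[OF ac xy(3) _ xs(2) False] c by blast
      qed
    qed
    show ?thesis
    proof (rule cut_solvable_iff[OF ac xy(3) U(1)])
      fix u
      show "trim x y Rx Ry ?L u \<subseteq> ?L u" by (auto simp: trim_def)
      show "trim x y Rx Ry ?L u - side H x y = {x}" if h: "x \<in> trim x y Rx Ry ?L u"
      proof (cases "y \<in> ?L u")
        case True
        then show ?thesis using two[of u] h xs by (auto simp: trim_def)
      next
        case False
        then show ?thesis using h xs by (auto simp: trim_def)
      qed
      show "trim x y Rx Ry ?L u \<inter> side H x y = {y}" if h: "y \<in> trim x y Rx Ry ?L u"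
      proof (cases "x \<in> ?L u")
        case True
        then show ?thesis using two[of u] h xs by (auto simp: trim_def)
      next
        case False
        then show ?thesis using h xs by (auto simp: trim_def)
      qed
    qed
  qed
  show ?thesis
  proof
    assume "sol H e U L"
    then obtain f where f: "\<And>u. u \<in> U \<Longrightarrow> f u \<in> L u" "\<And>u. u \<in> U \<Longrightarrow> f u \<in> verts H"
      "\<And>u v. u \<in> U \<Longrightarrow> v \<in> U \<Longrightarrow> u \<noteq> v \<Longrightarrow> hok H e u v (f u) (f v)" by (rule solE, blast)
    show "(\<exists>x\<in>strong_loops H. sol (del_vertex H x) e U L) \<or>
      (\<exists>\<rho>. (\<forall>c. \<rho> c \<in> insert k U) \<and> loops_accept n H e U (anchor H e U \<rho> L) \<rho>)"
    proof (cases "strong_loops H \<subseteq> f ` U")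
      case False
      then obtain x where x: "x \<in> strong_loops H" "x \<notin> f ` U" by blast
      have "sol (del_vertex H x) e U L"
      proof (rule solI[where f = f])
        fix u assume u: "u \<in> U"
        then show "f u \<in> L u \<inter> verts (del_vertex H x)" using f x by (auto simp: del_vertex_def)
        fix v assume v: "v \<in> U" "u \<noteq> v"
        have "f u \<noteq> x" "f v \<noteq> x" using u v x by auto
        then show "hok (del_vertex H x) e u v (f u) (f v)" using f(3)[OF u v] by (simp add: hok_del_vertex)
      qed
      then show ?thesis using x by blast
    next
      case used: True
      obtain \<rho> where \<rho>: "\<And>c. \<rho> c \<in> insert k U" "\<And>c. \<rho> c \<in> U \<longleftrightarrow> c \<in> f ` U"
        "\<And>u. u \<in> U \<Longrightarrow> f u \<in> anchor H e U \<rho> L u"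
        by (rule anchor_exists[of U f L H e k]) (use f U in auto)
      let ?L = "anchor H e U \<rho> L"
      let ?reg = "region n e U ?L"
      have key: "(\<exists>t\<in>{..n}. \<exists>v\<in>U. region_accepts n H e U ?L x (?reg x t v)) \<or>
        (\<exists>z t v. z \<in> strong_loops H \<and> underlying_adj H x z \<and> t \<in> {..n} \<and> v \<in> U \<and>
          {u\<in>U. f u = x} \<subseteq> ?reg x t v \<and> (\<forall>r\<in>?reg x t v. f r \<noteq> x \<longrightarrow> f r \<in> side H x z))"
        if x: "x \<in> strong_loops H" for x
      proof -
        have xx: "(x, x) \<in> strong H" using x by (simp add: strong_loops_def)
        interpret S: clique_sep n U "adjE e" "biE e" "{u\<in>U. x \<in> ?L u}"
          by unfold_locales (use U in \<open>auto simp: adjE_def biE_def\<close>)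
        let ?Q = "{u\<in>U. f u = x}"
        have "biE e u v" if "u \<in> ?Q" "v \<in> ?Q" "u \<noteq> v" for u v
          using f(3)[of u v] that xx by (auto simp: hok_def biE_def split: if_splits)
        then have "S.clq ?Q" using \<rho>(3) by (auto simp: S.clq_def)
        moreover have "?Q \<noteq> {}" using used x by auto
        ultimately obtain t v where t: "t \<in> {..n}" and v: "v \<in> U" and R: "?reg x t v \<subseteq> U" "?Q \<subseteq> ?reg x t v"
          "\<And>u w. u \<in> ?reg x t v - ?Q \<Longrightarrow> w \<in> ?reg x t v - ?Q \<Longrightarrow> S.con ?Q u w"
          "\<And>m r. m \<in> U - ?reg x t v \<Longrightarrow> r \<in> ?reg x t v \<Longrightarrow> adjE e m r \<Longrightarrow> r \<in> {u\<in>U. x \<in> ?L u}"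
          using S.clique_region_exists[of ?Q] unfolding region_def Let_def by blast
        interpret loop_instance n H e U ?L L \<rho> x f "?reg x t v"
        proof unfold_locales
          fix u w assume u: "u \<in> ?reg x t v" "f u \<noteq> x" and w: "w \<in> ?reg x t v" "f w \<noteq> x"
          then have "S.con ?Q u w" using R(3) by blast
          then show "(\<lambda>a b. adjE e a b \<and> a \<in> U \<and> f a \<noteq> x \<and> b \<in> U \<and> f b \<noteq> x)\<^sup>*\<^sup>* u w"
            unfolding S.con_def by (rule rtranclp_mono[THEN predicate2D, rotated]) auto
        next
          show "\<rho> x \<in> U" using used x \<rho>(2) by blast
        qed (use tri ac loops xx U \<rho>(3) f(3) R(1,2,4) in blast)+
        from accepts_or_strong_neighbour show ?thesis
        proof
          assume "\<exists>z. dominates z \<and> (z, z) \<in> strong H"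
          then obtain z where z: "dominates z" "(z, z) \<in> strong H" by blast
          then have "z \<in> strong_loops H" using tri by (auto simp: strong_loops_def is_trigraph_def edges_def)
          then show ?thesis using z t v R(2) unfolding dominates_def by blast
        qed (use t v in blast)
      qed
      show ?thesis
      proof (cases "\<exists>x\<in>strong_loops H. \<exists>t\<in>{..n}. \<exists>v\<in>U. region_accepts n H e U ?L x (?reg x t v)")
        case True
        then show ?thesis using \<rho>(1) unfolding loops_accept_def by blast
      next
        case False
        define P where "P x z t v \<longleftrightarrow> z \<in> strong_loops H \<and> underlying_adj H x z \<and> t \<in> {..n} \<and> v \<in> U \<and>
          {u\<in>U. f u = x} \<subseteq> ?reg x t v \<and> (\<forall>r\<in>?reg x t v. f r \<noteq> x \<longrightarrow> f r \<in> side H x z)" for x z t v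
        have "\<exists>z t v. P x z t v" if "x \<in> strong_loops H" for x
          using key[OF that] False that unfolding P_def by blast
        then obtain s where s: "\<And>x. x \<in> strong_loops H \<Longrightarrow> \<exists>t v. P x (s x) t v" by metis
        have "\<exists>x\<in>strong_loops H. s (s x) = x"
        proof (rule exists_turning_point[OF ac finL \<open>strong_loops H \<noteq> {}\<close>])
          fix x assume "x \<in> strong_loops H"
          then show "s x \<in> strong_loops H \<and> underlying_adj H x (s x)" using s[of x] by (auto simp: P_def)
        qed
        then obtain x where x: "x \<in> strong_loops H" "s (s x) = x" by blast
        define y where "y = s x"
        obtain t v where tv: "P x y t v" using s[OF x(1)] y_def by blast
        then have y: "y \<in> strong_loops H" "underlying_adj H x y" by (auto simp: P_def)
        obtain t' v' where tv': "P y x t' v'" using s[OF y(1)] x(2) y_def by metis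
        have \<rho>xy: "\<rho> x \<in> U" "\<rho> y \<in> U" using used x y \<rho>(2) by blast+
        have xs: "x \<notin> side H x y" "y \<notin> side H y x" "x \<noteq> y" "underlying_adj H y x"
          using not_in_side[OF ac] y(2) by (auto simp: underlying_adj_sym) (auto simp: underlying_adj_def)
        have nbr: "f u = z \<or> underlying_adj H (f u) z" if "u \<in> U" "z \<in> ?L u" "z \<in> strong_loops H" "\<rho> z \<in> U" for u z
        proof (cases "u = \<rho> z")
          case True
          then show ?thesis using anchorD(4)[OF \<rho>(3)[OF that(1)], of z] that by (auto simp: strong_loops_def)
        next
          case ne: False
          have z: "z \<in> verts H" "(z, z) \<in> strong H" using that by (auto simp: strong_loops_def)
          have "hok H e u (\<rho> z) z z" "hok H e u (\<rho> z) (f u) z"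
            using anchorD(5)[OF that(2) z(1) that(4) ne] anchorD(5)[OF \<rho>(3)[OF that(1)] z(1) that(4) ne] by auto
          then show ?thesis using z(2) by (auto simp: hok_def underlying_adj_def split: if_splits)
        qed
        have half: "f u = a \<longleftrightarrow> u \<in> ?reg a t v"
          if P: "P a b t v" and ab: "a \<in> strong_loops H" "\<rho> a \<in> U" "a \<notin> side H a b" and u: "u \<in> U" "a \<in> ?L u" "b \<notin> ?L u" for a b t v u
        proof
          assume "f u = a"
          then show "u \<in> ?reg a t v" using P u by (auto simp: P_def)
        next
          assume r: "u \<in> ?reg a t v"
          show "f u = a"
          proof (rule ccontr)
            assume na: "f u \<noteq> a"
            then have "f u \<in> side H a b" "underlying_adj H (f u) a" using P r nbr[OF u(1,2) ab(1,2)] by (auto simp: P_def)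
            then have "f u = b" using side_crossing[OF ac _ _ _ ab(3)] P by (auto simp: P_def)
            then show False using \<rho>(3)[OF u(1)] u(3) by simp
          qed
        qed
        have "sol H e U (trim x y (?reg x t v) (?reg y t' v') ?L)"
        proof (rule solI[where f = f])
          fix u assume u: "u \<in> U"
          show "f u \<in> trim x y (?reg x t v) (?reg y t' v') ?L u \<inter> verts H"
            using \<rho>(3)[OF u] f(2)[OF u] half[OF tv x(1) \<rho>xy(1) xs(1) u] half[OF tv' y(1) \<rho>xy(2) xs(2) u]
            by (auto simp: trim_def)
        qed (use f in auto)
        then have "cut_solvable H (del_edge H x y) x y e U (trim x y (?reg x t v) (?reg y t' v') ?L)"
          using cut[OF x(1) y \<rho>xy] by blast
        moreover have "t \<in> {..n}" "v \<in> U" "t' \<in> {..n}" "v' \<in> U" using tv tv' by (auto simp: P_def)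
        ultimately have "loops_accept n H e U ?L \<rho>"
          using x(1) y \<rho>xy unfolding loops_accept_def by blast
        then show ?thesis using \<rho>(1) by blast
      qed
    qed
  next
    have mono: "sol H e U L" if "sol H e U (anchor H e U \<rho> L)" for \<rho>
      using that by (rule sol_mono) (auto dest: anchorD(1))
    assume "(\<exists>x\<in>strong_loops H. sol (del_vertex H x) e U L) \<or>
      (\<exists>\<rho>. (\<forall>c. \<rho> c \<in> insert k U) \<and> loops_accept n H e U (anchor H e U \<rho> L) \<rho>)"
    then show "sol H e U L"
    proof (elim disjE exE conjE bexE)
      fix x assume "sol (del_vertex H x) e U L"
      then obtain f where f: "\<And>u. u \<in> U \<Longrightarrow> f u \<in> L u" "\<And>u. u \<in> U \<Longrightarrow> f u \<in> verts (del_vertex H x)"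
        "\<And>u v. u \<in> U \<Longrightarrow> v \<in> U \<Longrightarrow> u \<noteq> v \<Longrightarrow> hok (del_vertex H x) e u v (f u) (f v)" by (rule solE, blast)
      have "f u \<noteq> x" "f u \<in> verts H" if "u \<in> U" for u using f(2)[OF that] by (auto simp: del_vertex_def)
      then show ?thesis using f(1,3) by (intro solI[where f = f]) (auto simp: hok_del_vertex)
    next
      fix \<rho> assume "loops_accept n H e U (anchor H e U \<rho> L) \<rho>"
      then consider x R where "x \<in> strong_loops H" "region_accepts n H e U (anchor H e U \<rho> L) x R"
        | x y Rx Ry where "x \<in> strong_loops H" "y \<in> strong_loops H" "underlying_adj H x y" "\<rho> x \<in> U" "\<rho> y \<in> U"
          "cut_solvable H (del_edge H x y) x y e U (trim x y Rx Ry (anchor H e U \<rho> L))"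
        unfolding loops_accept_def by blast
      then have "sol H e U (anchor H e U \<rho> L)"
      proof cases
        case 1
        then show ?thesis by (intro region_accepts_sound[of x]) (auto simp: strong_loops_def edges_def)
      next
        case 2
        then have "sol H e U (trim x y Rx Ry (anchor H e U \<rho> L))" using cut by blast
        then show ?thesis by (rule sol_mono) (auto simp: trim_def)
      qed
      then show ?thesis by (rule mono)
    qed
  qed
qed

section \<open>Polynomial-time computable sets and lists\<close>

text \<open>Any enumerating list represents the set, in whatever order and with repetitions.
  Definitions in terms of sets thus become programs without list versions of their own.\<close>

definition pset :: "problem \<Rightarrow> ('e::enc \<Rightarrow> 'x::enc set) \<Rightarrow> bool" where
  "pset B S \<longleftrightarrow> (\<exists>l. ptime B l \<and> (\<forall>e. S e = set (l e)))"

lemma psetE: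
  assumes "pset B S"
  obtains l where "ptime B l" "S = (\<lambda>e. set (l e))"
  using assms unfolding pset_def by blast

lemma pset_set [ptime_intros]: "ptime B l \<Longrightarrow> pset B (\<lambda>e. set (l e))"
  unfolding pset_def by blast

lemma pset_comp: "pset B S \<Longrightarrow> ptime B f \<Longrightarrow> pset B (\<lambda>e. S (f e))"
  by (erule psetE) (auto intro: pset_set ptime_comp)

lemma pset_Collect [ptime_intros]:
  assumes "pset B S" "ptime B (\<lambda>p. P (fst p) (snd p))"
  shows "pset B (\<lambda>e. {x \<in> S e. P e x})"
proof -
  obtain l where l: "ptime B l" "S = (\<lambda>e. set (l e))" using psetE[OF assms(1)] .
  have "pset B (\<lambda>e. set (filter (P e) (l e)))" by (intro ptime_intros l assms(2))
  then show ?thesis by (simp add: l)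
qed

lemma pset_bex [ptime_intros]:
  assumes "pset B S" "ptime B (\<lambda>p. P (fst p) (snd p))"
  shows "ptime B (\<lambda>e. \<exists>x\<in>S e. P e x)"
proof -
  obtain l where l: "ptime B l" "S = (\<lambda>e. set (l e))" using psetE[OF assms(1)] .
  show ?thesis unfolding l(2) by (rule ptime_bex[OF l(1) assms(2)])
qed

lemma pset_ball [ptime_intros]:
  assumes "pset B S" "ptime B (\<lambda>p. P (fst p) (snd p))"
  shows "ptime B (\<lambda>e. \<forall>x\<in>S e. P e x)"
proof -
  obtain l where l: "ptime B l" "S = (\<lambda>e. set (l e))" using psetE[OF assms(1)] .
  show ?thesis unfolding l(2) by (rule ptime_ball[OF l(1) assms(2)])
qed

lemma pset_mem [ptime_intros]:
  fixes x :: "'e::enc \<Rightarrow> nat"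
  assumes "ptime B x" "pset B S"
  shows "ptime B (\<lambda>e. x e \<in> S e)"
proof -
  obtain l where l: "ptime B l" "S = (\<lambda>e. set (l e))" using psetE[OF assms(2)] .
  show ?thesis unfolding l(2) by (rule ptime_mem[OF assms(1) l(1)])
qed

lemma pset_minus [ptime_intros]:
  fixes S T :: "'e::enc \<Rightarrow> nat set"
  assumes "pset B S" "pset B T"
  shows "pset B (\<lambda>e. S e - T e)"
proof -
  have "pset B (\<lambda>e. {x\<in>S e. x \<notin> T e})" by (intro ptime_intros assms pset_comp[OF assms(2)])
  then show ?thesis by (simp add: set_diff_eq)
qed

lemma pset_atMost [ptime_intros]:
  fixes n :: "'e::enc \<Rightarrow> nat"
  shows "ptime B n \<Longrightarrow> pset B (\<lambda>e. {..n e})"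
proof -
  assume "ptime B n"
  then have "pset B (\<lambda>e. set [0..<Suc (n e)])" by (intro ptime_intros)
  then show ?thesis by (simp only: set_upt atLeast0LessThan lessThan_Suc_atMost)
qed

lemma pset_lessThan [ptime_intros]:
  fixes n :: "'e::enc \<Rightarrow> nat"
  shows "ptime B n \<Longrightarrow> pset B (\<lambda>e. {..<n e})"
proof -
  assume "ptime B n"
  then have "pset B (\<lambda>e. set [0..<n e])" by (intro ptime_intros)
  then show ?thesis by (simp add: atLeast0LessThan)
qed

lemma pset_const_empty [ptime_intros]: "pset B (\<lambda>e. {})"
  using pset_set[OF ptime_const[of B "[]"]] by simp

lemma pset_funpow:
  fixes U :: "'e::enc \<Rightarrow> 'x::enc set" and step :: "'e \<Rightarrow> 'x set \<Rightarrow> 'x set"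
  assumes step: "\<And>e S. step e S = {y \<in> U e. P e S y}"
    and "ptime B (\<lambda>p. P (fst p) (set (fst (snd p))) (snd (snd p)))" "pset B U" "pset B I" "ptime B k"
  shows "pset B (\<lambda>e. (step e ^^ k e) (I e))"
proof -
  obtain u where u: "ptime B u" "U = (\<lambda>e. set (u e))" using psetE[OF assms(3)] .
  obtain i where i: "ptime B i" "I = (\<lambda>e. set (i e))" using psetE[OF assms(4)] .
  have eq: "(step e ^^ j) (I e) = set (((\<lambda>S. filter (\<lambda>y. P e (set S) y) (u e)) ^^ j) (i e))" for e j
    by (induction j) (simp_all add: step u i)
  have "pset B (\<lambda>e. set (((\<lambda>S. filter (\<lambda>y. P e (set S) y) (u e)) ^^ k e) (i e)))"
    by (intro pset_set ptime_funpow_filter assms(2,5) u i)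
  then show ?thesis by (simp add: eq)
qed

text \<open>Membership is written \<open>\<exists>z\<in>S. z = y\<close> so that the program needs
  only an equality test on the element type. Reflexivity is split off because \<open>a\<close> need
  not belong to \<open>D\<close>.\<close>

lemma rtranclp_iff_iterate:
  assumes D: "finite D" "card D \<le> n" and r: "\<And>x y. r x y \<Longrightarrow> x \<in> D \<and> y \<in> D"
  shows "r\<^sup>*\<^sup>* a b \<longleftrightarrow> a = b \<or> b \<in> ((\<lambda>S. {y\<in>D. (\<exists>z\<in>S. z = y) \<or> (\<exists>x\<in>S. r x y)}) ^^ n) {y\<in>D. r a y}"
    (is "_ \<longleftrightarrow> _ \<or> b \<in> (?F ^^ n) ?I")
proof
  have sub: "(?F ^^ k) ?I \<subseteq> D" for k by (induction k) auto
  have mono: "?I \<subseteq> (?F ^^ k) ?I" for k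
  proof (induction k)
    case (Suc k)
    have "(?F ^^ k) ?I \<subseteq> ?F ((?F ^^ k) ?I)" using sub[of k] by blast
    from order_trans[OF Suc this] show ?case unfolding funpow.simps o_apply .
  qed simp
  have stable: "?F ((?F ^^ n) ?I) = (?F ^^ n) ?I"
    by (rule funpow_stabilizes[OF D]) auto
  assume "r\<^sup>*\<^sup>* a b"
  then show "a = b \<or> b \<in> (?F ^^ n) ?I"
  proof induction
    case (step y z)
    have "z \<in> (?F ^^ n) ?I"
    proof (cases "y = a")
      case True
      then have "z \<in> ?I" using step.hyps r by auto
      then show ?thesis using mono[of n] by blast
    next
      case False
      then have "z \<in> ?F ((?F ^^ n) ?I)" using step r by blast
      then show ?thesis by (simp only: stable)
    qed
    then show ?case ..
  qed simp
next
  have "r\<^sup>*\<^sup>* a b" if "b \<in> (?F ^^ k) ?I" for k b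
    using that by (induction k arbitrary: b) (auto intro: rtranclp.rtrancl_into_rtrancl)
  then show "a = b \<or> b \<in> (?F ^^ n) ?I \<Longrightarrow> r\<^sup>*\<^sup>* a b" by blast
qed

lemma ptime_rtranclp:
  fixes f g :: "'e::enc \<Rightarrow> 'x::enc"
  assumes eq: "ptime B (\<lambda>p :: 'x \<times> 'x. fst p = snd p)"
    and D: "pset B D" and r: "ptime B (\<lambda>p. r (fst p) (fst (snd p)) (snd (snd p)))"
    and rD: "\<And>e x y. r e x y \<Longrightarrow> x \<in> D e \<and> y \<in> D e"
    and fg: "ptime B f" "ptime B g"
  shows "ptime B (\<lambda>e. (r e)\<^sup>*\<^sup>* (f e) (g e))"
proof -
  obtain l where l: "ptime B l" "D = (\<lambda>e. set (l e))" using psetE[OF D] .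
  note [ptime_intros] = ptime_subst2[OF eq] ptime_subst3[OF r] ptime_comp[OF _ l(1)] pset_comp[OF D] ptime_comp[OF _ fg(1)] ptime_comp[OF _ fg(2)]
  have "pset B (\<lambda>e. ((\<lambda>S. {y\<in>D e. (\<exists>z\<in>S. z = y) \<or> (\<exists>x\<in>S. r e x y)}) ^^ length (l e)) {y\<in>D e. r e (f e) y})"
    by (rule pset_funpow[OF refl]) (intro ptime_intros)+
  note it = this
  have "ptime B (\<lambda>e. f e = g e \<or> (\<exists>z\<in>((\<lambda>S. {y\<in>D e. (\<exists>z\<in>S. z = y) \<or> (\<exists>x\<in>S. r e x y)}) ^^ length (l e)) {y\<in>D e. r e (f e) y}. z = g e))"
    by (intro ptime_intros it fg)
  moreover have "(r e)\<^sup>*\<^sup>* (f e) (g e) \<longleftrightarrow> f e = g e \<or>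
      (\<exists>z\<in>((\<lambda>S. {y\<in>D e. (\<exists>z\<in>S. z = y) \<or> (\<exists>x\<in>S. r e x y)}) ^^ length (l e)) {y\<in>D e. r e (f e) y}. z = g e)" for e
    using rtranclp_iff_iterate[of "D e" "length (l e)" "r e" "f e" "g e"] rD[of e] l(2) card_length by auto
  ultimately show ?thesis by simp
qed

lemma ptime_rtranclp_nat:
  fixes f g :: "'e::enc \<Rightarrow> nat"
  assumes "pset B D" "ptime B (\<lambda>p. r (fst p) (fst (snd p)) (snd (snd p)))"
    "\<And>e x y. r e x y \<Longrightarrow> x \<in> D e \<and> y \<in> D e" "ptime B f" "ptime B g"
  shows "ptime B (\<lambda>e. (r e)\<^sup>*\<^sup>* (f e) (g e))"
  by (rule ptime_rtranclp[OF _ assms]) (intro ptime_intros)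

lemma ptime_rtranclp_lit:
  fixes f g :: "'e::enc \<Rightarrow> nat \<times> bool"
  assumes "pset B D" "ptime B (\<lambda>p. r (fst p) (fst (snd p)) (snd (snd p)))"
    "\<And>e x y. r e x y \<Longrightarrow> fst x \<in> D e \<and> fst y \<in> D e" "ptime B f" "ptime B g"
  shows "ptime B (\<lambda>e. (r e)\<^sup>*\<^sup>* (f e) (g e))"
proof (rule ptime_rtranclp[OF _ _ assms(2)])
  have "ptime B (\<lambda>p :: (nat \<times> bool) \<times> (nat \<times> bool). fst (fst p) = fst (snd p) \<and> snd (fst p) = snd (snd p))"
    by (intro ptime_intros)
  then show "ptime B (\<lambda>p :: (nat \<times> bool) \<times> (nat \<times> bool). fst p = snd p)" by (simp add: prod_eq_iff)
  obtain l where l: "ptime B l" "D = (\<lambda>e. set (l e))" using psetE[OF assms(1)] .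
  have "pset B (\<lambda>e. set (concat (map (\<lambda>v. [(v, True), (v, False)]) (l e))))" by (intro ptime_intros l)
  moreover have "set (concat (map (\<lambda>v. [(v, True), (v, False)]) vs)) = set vs \<times> UNIV" for vs :: "nat list"
    by (induction vs) (auto simp: UNIV_bool)
  ultimately show "pset B (\<lambda>e. D e \<times> (UNIV :: bool set))" by (simp add: l(2))
  show "x \<in> D e \<times> UNIV \<and> y \<in> D e \<times> UNIV" if "r e x y" for e x y
    using assms(3)[OF that] by (cases x; cases y) auto
qed (rule assms)+


section \<open>Tables of lists\<close>

definition edge :: "bool list list \<Rightarrow> nat \<Rightarrow> nat \<Rightarrow> bool" where
  "edge E u v = nthd False (nthd [] E u) v"

text \<open>Colours are numbered within an ambient set \<open>C\<close>, possibly larger than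
  \<open>verts H\<close>, so that all trigraphs met while deleting edges and vertices share one
  table format.\<close>

definition lst :: "'a set \<Rightarrow> bool list list \<Rightarrow> nat \<Rightarrow> 'a set" where
  "lst C T u = {c \<in> C. nthd False (nthd [] T u) (to_nat_on C c)}"

definition table :: "'a set \<Rightarrow> nat \<Rightarrow> (nat \<Rightarrow> 'a set) \<Rightarrow> bool list list" where
  "table C n L = map (\<lambda>u. map (\<lambda>i. from_nat_into C i \<in> L u) [0..<card C]) [0..<n]"

definition active :: "'a set \<Rightarrow> bool list list \<times> bool list list \<Rightarrow> nat set" where
  "active C p = {u\<in>{..<length (fst p)}. \<exists>c\<in>C. c \<in> lst C (snd p) u}"

text \<open>
  Vertices with an empty list are ignored, so that subinstances need no renumbering.
\<close>

definition decidable :: "problem \<Rightarrow> 'a set \<Rightarrow> 'a trigraph \<Rightarrow> bool" where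
  "decidable B C H \<longleftrightarrow> ptime B (\<lambda>p. sol H (edge (fst p)) (active C p) (lst C (snd p)))"

lemma ptime_edge [ptime_intros]:
  "ptime B E \<Longrightarrow> ptime B u \<Longrightarrow> ptime B v \<Longrightarrow> ptime B (\<lambda>e. edge (E e) (u e) (v e))"
  unfolding edge_def by (intro ptime_intros)

lemma ptime_adjE [ptime_intros]:
  "ptime B E \<Longrightarrow> ptime B u \<Longrightarrow> ptime B v \<Longrightarrow> ptime B (\<lambda>e. adjE (edge (E e)) (u e) (v e))"
  unfolding adjE_def by (intro ptime_intros)

lemma ptime_biE [ptime_intros]:
  "ptime B E \<Longrightarrow> ptime B u \<Longrightarrow> ptime B v \<Longrightarrow> ptime B (\<lambda>e. biE (edge (E e)) (u e) (v e))"
  unfolding biE_def by (intro ptime_intros)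

lemma ptime_hok [ptime_intros]:
  "ptime B E \<Longrightarrow> ptime B u \<Longrightarrow> ptime B v \<Longrightarrow> ptime B (\<lambda>e. hok H (edge (E e)) (u e) (v e) c d)"
  unfolding hok_def by (intro ptime_intros)

lemma ptime_lst [ptime_intros]:
  "ptime B T \<Longrightarrow> ptime B u \<Longrightarrow> ptime B (\<lambda>e. c \<in> lst C (T e) (u e))"
  unfolding lst_def mem_Collect_eq by (intro ptime_intros)

lemma lst_table: "finite C \<Longrightarrow> u < n \<Longrightarrow> lst C (table C n L) u = C \<inter> L u"
  using to_nat_on_finite[of C]
  by (auto simp: lst_def table_def nthd_def bij_betw_def countable_finite)

text \<open>Colours are not data of the machine: a family of lists is given by one program per
  colour, and quantifiers over colours become finite combinations of programs.\<close>

definition plist :: "problem \<Rightarrow> 'a set \<Rightarrow> ('e::enc \<Rightarrow> nat \<Rightarrow> 'a set) \<Rightarrow> bool" where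
  "plist B C L \<longleftrightarrow> (\<forall>e u. L e u \<subseteq> C) \<and> (\<forall>c\<in>C. ptime B (\<lambda>p. c \<in> L (fst p) (snd p)))"

lemma plistI:
  "(\<And>e u. L e u \<subseteq> C) \<Longrightarrow> (\<And>c. c \<in> C \<Longrightarrow> ptime B (\<lambda>p. c \<in> L (fst p) (snd p))) \<Longrightarrow> plist B C L"
  unfolding plist_def by blast

lemma plist_subset: "plist B C L \<Longrightarrow> L e u \<subseteq> C"
  unfolding plist_def by blast

lemma plist_mem:
  assumes "plist B C L" "ptime B f" "ptime B u"
  shows "ptime B (\<lambda>e. c \<in> L (f e) (u e))"
proof (cases "c \<in> C")
  case True
  then show ?thesis using ptime_subst2[of B "\<lambda>e u. c \<in> L e u" f u] assms by (simp add: plist_def)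
next
  case False
  then have "(\<lambda>e. c \<in> L (f e) (u e)) = (\<lambda>e. False)" using plist_subset[OF assms(1)] by blast
  then show ?thesis by (simp add: ptime_const)
qed

lemma plist_comp: "plist B C L \<Longrightarrow> ptime B f \<Longrightarrow> plist B C (\<lambda>e. L (f e))"
  by (rule plistI, rule plist_subset, assumption, erule plist_mem)
    (rule ptime_comp[OF ptime_fst[OF ptime_id]], assumption, rule ptime_snd[OF ptime_id])

lemma plist_Collect:
  assumes "plist B C L" "\<And>c. c \<in> C \<Longrightarrow> ptime B (\<lambda>p. P (fst p) (snd p) c)"
  shows "plist B C (\<lambda>e u. {c \<in> L e u. P e u c})"
proof (rule plistI)
  show "{c \<in> L e u. P e u c} \<subseteq> C" for e u using plist_subset[OF assms(1)] by blast
  fix c assume "c \<in> C"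
  then show "ptime B (\<lambda>p. c \<in> {c \<in> L (fst p) (snd p). P (fst p) (snd p) c})"
    unfolding mem_Collect_eq by (intro ptime_intros plist_mem[OF assms(1)] assms(2))
qed

lemma ptime_table:
  assumes C: "finite C" and L: "plist B C L" and n: "ptime B n"
  shows "ptime B (\<lambda>e. table C (n e) (L e))"
  unfolding table_def
  by (intro ptime_intros n ptime_map_const[where f = "\<lambda>i e. from_nat_into C i \<in> L (fst e) (snd e)"] plist_mem[OF L])

text \<open>An instance is restricted to \<open>U\<close> by emptying the lists elsewhere. Since
  \<open>active\<close> skips all vertices with an empty list, one inside \<open>U\<close> is tested
  for separately: it makes the instance unsolvable.\<close>

lemma ptime_sol:
  assumes dec: "decidable B C H" and C: "finite C" "verts H \<subseteq> C"
    and E: "ptime B E" and U: "pset B U" "\<And>e. U e \<subseteq> {..<length (E e)}" and L: "plist B C L"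
  shows "ptime B (\<lambda>e. sol H (edge (E e)) (U e) (L e))"
proof -
  let ?L = "\<lambda>e u. {c \<in> L e u. u \<in> U e}"
  have L': "plist B C ?L" by (intro plist_Collect L ptime_intros pset_comp[OF U(1)])
  have q: "ptime B (\<lambda>e. (E e, table C (length (E e)) (?L e)))" by (intro ptime_intros ptime_table C L' E)
  have "ptime B (\<lambda>e. (\<forall>u\<in>U e. \<exists>c\<in>C. c \<in> L e u) \<and>
      sol H (edge (fst (E e, table C (length (E e)) (?L e)))) (active C (E e, table C (length (E e)) (?L e)))
        (lst C (snd (E e, table C (length (E e)) (?L e)))))"
    by (intro ptime_intros U(1) ptime_bex_finite C(1) plist_mem[OF L] ptime_comp[OF q dec[unfolded decidable_def]])
  moreover have "((\<forall>u\<in>U e. \<exists>c\<in>C. c \<in> L e u) \<and>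
      sol H (edge (fst (E e, table C (length (E e)) (?L e)))) (active C (E e, table C (length (E e)) (?L e)))
        (lst C (snd (E e, table C (length (E e)) (?L e))))) \<longleftrightarrow> sol H (edge (E e)) (U e) (L e)" for e
  proof (cases "\<forall>u\<in>U e. \<exists>c\<in>C. c \<in> L e u")
    case True
    have lst: "lst C (table C (length (E e)) (?L e)) u = (if u \<in> U e then L e u else {})" if "u < length (E e)" for u
      using that plist_subset[OF L] by (auto simp: lst_table[OF C(1)])
    have "active C (E e, table C (length (E e)) (?L e)) = U e"
      using True U(2)[of e] by (auto simp: active_def lst split: if_splits)
    moreover have "lst C (table C (length (E e)) (?L e)) u = L e u" if "u \<in> U e" for u
      using that U(2)[of e] lst[of u] by auto
    ultimately show ?thesis using True unfolding sol_def by (simp add: csp_def)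
  next
    case False
    then obtain u where u: "u \<in> U e" "L e u = {}" using plist_subset[OF L] by blast
    then have "\<not> sol H (edge (E e)) (U e) (L e)" unfolding sol_def csp_def by blast
    then show ?thesis using False by blast
  qed
  ultimately show ?thesis by simp
qed



section \<open>The algorithms run in polynomial time\<close>

lemma pset_layer:
  assumes E: "ptime B E" and V: "pset B V" and C: "pset B C" and w: "ptime B w" and k: "ptime B k"
  shows "pset B (\<lambda>e. clique_layer (V e) (adjE (edge (E e))) (C e) (w e) (k e))"
  unfolding clique_layer_def
proof (rule pset_funpow[OF refl])
  note [ptime_intros] = ptime_comp[OF _ E] pset_comp[OF C] ptime_comp[OF _ w]
  show "ptime B (\<lambda>p. snd (snd p) \<notin> C (fst p) \<and> (adjE (edge (E (fst p))) (snd (snd p)) (w (fst p)) \<or>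
      (\<exists>q\<in>set (fst (snd p)). adjE (edge (E (fst p))) (snd (snd p)) q)))"
    by (intro ptime_intros)
qed (intro ptime_intros assms)+

lemma pset_hull:
  assumes E: "ptime B E" and V: "pset B V" and A: "pset B A" and X: "pset B X" and n: "ptime B n" and k: "ptime B k"
  shows "pset B (\<lambda>e. (clique_hull_step (n e) (V e) (adjE (edge (E e))) (biE (edge (E e))) (A e) ^^ k e) (X e))"
proof (rule pset_funpow[OF clique_hull_step_def])
  note [ptime_intros] = ptime_comp[OF _ E] pset_comp[OF V] pset_comp[OF A] ptime_comp[OF _ n] pset_layer
  show "ptime B (\<lambda>p. snd (snd p) \<in> set (fst (snd p)) \<or> (\<exists>u\<in>set (fst (snd p)). adjE (edge (E (fst p))) (snd (snd p)) u \<and>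
      (u \<notin> A (fst p) \<or> (\<exists>w\<in>set (fst (snd p)). w \<noteq> u \<and> \<not> biE (edge (E (fst p))) u w \<and>
        (\<exists>k\<in>{..n (fst p)}. snd (snd p) \<in> clique_layer (V (fst p)) (adjE (edge (E (fst p)))) (set (fst (snd p))) w (Suc k) \<and>
          (\<forall>q\<in>clique_layer (V (fst p)) (adjE (edge (E (fst p)))) (set (fst (snd p))) w k. \<not> adjE (edge (E (fst p))) q u))))))"
    by (intro ptime_intros)
qed (intro assms)+

lemma ptime_near:
  assumes E: "ptime B E" and V: "pset B V" and A: "pset B A" and n: "ptime B n" and uv: "ptime B u" "ptime B v"
  shows "ptime B (\<lambda>e. clique_near (n e) (V e) (adjE (edge (E e))) (biE (edge (E e))) (A e) (u e) (v e))"
proof -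
  note [ptime_intros] = ptime_comp[OF _ E] pset_comp[OF V] ptime_comp[OF _ uv(1)]
  show ?thesis unfolding clique_near_def by (intro ptime_intros pset_hull assms)
qed

lemma pset_alive:
  assumes E: "ptime B E" and V: "pset B V" and A: "pset B A" and n: "ptime B n" and t: "ptime B t"
  shows "pset B (\<lambda>e. clique_alive (n e) (V e) (adjE (edge (E e))) (biE (edge (E e))) (A e) (t e))"
  unfolding clique_alive_def
proof (rule pset_funpow[OF refl])
  note [ptime_intros] = ptime_comp[OF _ E] pset_comp[OF V] pset_comp[OF A] ptime_comp[OF _ n] ptime_near
  let ?near = "\<lambda>p. clique_near (n (fst p)) (V (fst p)) (adjE (edge (E (fst p)))) (biE (edge (E (fst p)))) (A (fst p))"
  show "ptime B (\<lambda>p. snd (snd p) \<in> set (fst (snd p)) \<and> \<not> (\<forall>a\<in>set (fst (snd p)). \<forall>b\<in>set (fst (snd p)).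
      ?near p (snd (snd p)) a \<and> ?near p (snd (snd p)) b \<longrightarrow> ?near p a b))"
    by (intro ptime_intros)
qed (intro assms)+

lemma pset_region:
  assumes E: "ptime B E" and U: "pset B U" and L: "plist B C L" and n: "ptime B n" and t: "ptime B t" and v: "ptime B v"
  shows "pset B (\<lambda>e. region (n e) (edge (E e)) (U e) (L e) x (t e) (v e))"
proof -
  note [ptime_intros] = ptime_comp[OF _ E] pset_comp[OF U] ptime_comp[OF _ n] ptime_comp[OF _ v] ptime_near pset_alive plist_mem[OF L]
  show ?thesis unfolding region_def clique_region_def by (intro ptime_intros assms)
qed

lemma ptime_clique_check:
  assumes dec: "decidable B C (del_vertex H x)" and C: "finite C" "verts H \<subseteq> C"
    and E: "ptime B E" and U: "pset B U" "\<And>e. U e \<subseteq> {..<length (E e)}" and L: "plist B C L" and Q: "pset B Q"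
  shows "ptime B (\<lambda>e. clique_check H (edge (E e)) (U e) (L e) x (Q e))"
proof -
  note [ptime_intros] = ptime_comp[OF _ E] pset_comp[OF U(1)] pset_comp[OF Q] plist_mem[OF L]
  have V: "verts (del_vertex H x) \<subseteq> C" using C by (auto simp: del_vertex_def)
  have UQ: "U e - Q e \<subseteq> {..<length (E e)}" for e using U(2)[of e] by blast
  show ?thesis
    unfolding clique_check_def
    by (intro ptime_intros E U(1) Q ptime_sol[OF dec C(1) V _ _ UQ] plist_Collect[OF L])
qed

lemma ptime_loop_cluster:
  assumes E: "ptime B E" and U: "pset B U" and R: "pset B R" and v: "ptime B v"
  shows "pset B (\<lambda>e. loop_cluster (edge (E e)) (U e) (R e) (v e))"
proof -
  note [ptime_intros] = ptime_comp[OF _ E] pset_comp[OF U] pset_comp[OF R] ptime_comp[OF _ v]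
  have "ptime B (\<lambda>p. (\<lambda>a b. adjE (edge (E (fst p))) a b \<and> a \<in> U (fst p) - R (fst p) \<and> b \<in> U (fst p) - R (fst p))\<^sup>*\<^sup>* (v (fst p)) (snd p))"
    by (rule ptime_rtranclp_nat[where D = "\<lambda>p. U (fst p)"]) ((intro ptime_intros)+, blast, (intro ptime_intros)+)
  then show ?thesis unfolding loop_cluster_def by (rule pset_Collect[OF U])
qed

lemma plist_loop_lists:
  fixes H :: "'a trigraph"
  assumes E: "ptime B E" and L: "plist B C L" and R: "pset B R" and Q: "pset B Q"
  shows "plist B C (\<lambda>e. loop_lists H (edge (E e)) (L e) x z (R e) (Q e))"
proof -
  note [ptime_intros] = ptime_comp[OF _ E] pset_comp[OF R] pset_comp[OF Q] plist_mem[OF L]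
  have eq: "hok H e w a c (if b then x else z) = (if b then hok H e w a c x else hok H e w a c z)"
    for e w a b and c :: 'a by simp
  show ?thesis unfolding loop_lists_def eq by (intro plist_Collect[OF L] ptime_intros)
qed

lemma pset_loop_fix:
  assumes dec: "decidable B C (del_vertex H x)" and C: "finite C" "verts H \<subseteq> C"
    and E: "ptime B E" and U: "pset B U" "\<And>e. U e \<subseteq> {..<length (E e)}" and L: "plist B C L" and R: "pset B R" and n: "ptime B n"
  shows "pset B (\<lambda>e. loop_fix (n e) H (edge (E e)) (U e) (L e) x z (R e))"
  unfolding loop_fix_def
proof (rule pset_funpow[OF loop_step_def])
  note [ptime_intros] = ptime_comp[OF _ E] pset_comp[OF U(1)] pset_comp[OF R] plist_mem[OF L] ptime_loop_cluster plist_comp[OF L] plist_loop_lists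
  have V: "verts (del_vertex H x) \<subseteq> C" using C by (auto simp: del_vertex_def)
  show "ptime B (\<lambda>p. x \<in> L (fst p) (snd (snd p)) \<and> (snd (snd p) \<in> set (fst (snd p)) \<or>
      (\<exists>v\<in>U (fst p) - R (fst p). adjE (edge (E (fst p))) v (snd (snd p)) \<and>
        \<not> sol (del_vertex H x) (edge (E (fst p))) (loop_cluster (edge (E (fst p))) (U (fst p)) (R (fst p)) v)
          (loop_lists H (edge (E (fst p))) (L (fst p)) x z (R (fst p)) (set (fst (snd p)))))))"
    by (intro ptime_intros ptime_sol[OF dec C(1) V]) (use U(2) in \<open>auto simp: loop_cluster_def\<close>)
  show "pset B (\<lambda>e. {a \<in> R e. x \<in> L e a \<and> z \<notin> L e a})" by (intro ptime_intros R)
qed (intro R n)+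

lemma ptime_region_accepts:
  assumes dec: "decidable B C (del_vertex H x)" and C: "finite C" "verts H \<subseteq> C"
    and E: "ptime B E" and U: "pset B U" "\<And>e. U e \<subseteq> {..<length (E e)}" and L: "plist B C L" and R: "pset B R" and n: "ptime B n"
  shows "ptime B (\<lambda>e. region_accepts (n e) H (edge (E e)) (U e) (L e) x (R e))"
proof -
  note [ptime_intros] = ptime_comp[OF _ E] pset_comp[OF U(1)] pset_comp[OF R] plist_mem[OF L] plist_comp[OF L]
  note check = ptime_clique_check[OF dec C]
  have finV: "finite (verts H)" using C finite_subset by blast
  show ?thesis
    unfolding region_accepts_def
    by (intro ptime_intros ptime_bex_finite[OF finV] check pset_loop_fix[OF dec C] E U L R n)
qed

lemma plist_side_list:
  assumes L: "plist B C L"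
  shows "plist B C (\<lambda>e. side_list H x y (L e) b)"
  unfolding side_list_def by (intro plist_Collect[OF L] ptime_const)

lemma ptime_cut_solvable:
  fixes E :: "'c::enc \<Rightarrow> bool list list"
  assumes dec: "decidable B C (del_edge H x y)" and C: "finite C" "verts H \<subseteq> C"
    and E: "ptime B E" and U: "pset B U" "\<And>e. U e \<subseteq> {..<length (E e)}" and L: "plist B C L"
  shows "ptime B (\<lambda>e. cut_solvable H (del_edge H x y) x y (edge (E e)) (U e) (L e))"
proof -
  let ?sp = "\<lambda>b::bool. if b then x else y"
  let ?SL = "\<lambda>e. side_list H x y (L e)"
  have V: "verts (del_edge H x y) \<subseteq> C" using C by (auto simp: del_edge_def)
  note SL = plist_side_list[OF L, of H x y]
  note [ptime_intros] = ptime_comp[OF _ E] pset_comp[OF U(1)]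
  define st where "st b = (\<lambda>p. side_step (hok H (edge (E p))) (U p) (?SL p) ?sp b)" for b
  define cl where "cl b p v = {w\<in>U p. (st b p)\<^sup>*\<^sup>* v w}" for b p v
  have st: "ptime B (\<lambda>e. st b (f e) (u e) (v e))" if "ptime B f" "ptime B u" "ptime B v" for b and f :: "'e::enc \<Rightarrow> 'c" and u v :: "'e \<Rightarrow> nat"
  proof -
    have eq: "st b p a a' \<longleftrightarrow> a \<in> U p \<and> a' \<in> U p \<and> a \<noteq> a' \<and> ?sp b \<notin> ?SL p b a \<and>
        (\<exists>c\<in>C. c \<in> ?SL p b a \<and> (\<exists>d\<in>C. d \<in> ?SL p b a' \<and> \<not> hok H (edge (E p)) a a' c d))" for p a a'
      using plist_subset[OF SL, of p b] unfolding st_def side_step_def by blast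
    show ?thesis
      unfolding eq by (intro ptime_intros ptime_bex_finite[OF C(1)] that plist_mem[OF SL])
  qed
  have cl: "pset B (\<lambda>e. cl b (f e) (v e))" if f: "ptime B f" and v: "ptime B v" for b and f :: "'e::enc \<Rightarrow> 'c" and v :: "'e \<Rightarrow> nat"
  proof -
    have "ptime B (\<lambda>p. (st b (f (fst p)))\<^sup>*\<^sup>* (v (fst p)) (snd p))"
    proof (rule ptime_rtranclp_nat[where D = "\<lambda>p. U (f (fst p))"])
      show "a \<in> U (f (fst p)) \<and> a' \<in> U (f (fst p))" if "st b (f (fst p)) a a'" for p :: "'e \<times> nat" and a a'
        using that by (auto simp: st_def side_step_def)
    qed (intro st ptime_intros ptime_comp[OF _ f] ptime_comp[OF _ v])+
    then show ?thesis unfolding cl_def by (rule pset_Collect[OF pset_comp[OF U(1) f]])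
  qed
  \<comment> \<open>This is \<open>cut_inc\<close> with the side turned into a constant in each
    branch, because the rules for lists and for \<open>sol\<close> apply to one fixed side at a
    time.\<close>
  define inc where "inc p l m \<longleftrightarrow>
     (if fst l = fst m then snd l = snd m \<and>
        (if snd l then \<not> sol (del_edge H x y) (edge (E p)) (cl True p (fst l)) (?SL p True)
         else \<not> sol (del_edge H x y) (edge (E p)) (cl False p (fst l)) (?SL p False))
      else if snd l = snd m then
        (if snd l then x \<in> ?SL p True (fst l) \<and> x \<in> ?SL p True (fst m) \<and> \<not> hok H (edge (E p)) (fst l) (fst m) x x
         else y \<in> ?SL p False (fst l) \<and> y \<in> ?SL p False (fst m) \<and> \<not> hok H (edge (E p)) (fst l) (fst m) y y)
      else if snd l then
        (\<exists>c\<in>C. c \<in> ?SL p True (fst l) \<and> (\<exists>d\<in>C. d \<in> ?SL p False (fst m) \<and> \<not> hok H (edge (E p)) (fst l) (fst m) c d))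
      else
        (\<exists>c\<in>C. c \<in> ?SL p False (fst l) \<and> (\<exists>d\<in>C. d \<in> ?SL p True (fst m) \<and> \<not> hok H (edge (E p)) (fst l) (fst m) c d)))" for p l m
  have inc_eq: "cut_inc H (del_edge H x y) x y (edge (E p)) (U p) (L p) l m = inc p l m" if l: "fst l \<in> U p" for p l m
  proof -
    have "side_cluster (hok H (edge (E p))) (U p) (?SL p) ?sp b (fst l) = cl b p (fst l)" for b
    proof -
      have "w \<in> U p" if "(st b p)\<^sup>*\<^sup>* (fst l) w" for w
        using that l by induction (auto simp: st_def side_step_def)
      then show ?thesis by (auto simp: side_cluster_def cl_def st_def)
    qed
    note cl_eq = this
    have bex: "(\<exists>c\<in>?SL p b u. \<exists>d\<in>?SL p b' v. Q c d) \<longleftrightarrow>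
        (\<exists>c\<in>C. c \<in> ?SL p b u \<and> (\<exists>d\<in>C. d \<in> ?SL p b' v \<and> Q c d))" for b b' u v Q
      using plist_subset[OF SL, of p b u] plist_subset[OF SL, of p b' v] by blast
    show ?thesis
    proof (cases "snd l"; cases "snd m")
      assume "snd l" "snd m"
      then show ?thesis unfolding cut_inc_def inc_def Let_def cl_eq by simp
    next
      assume "snd l" "\<not> snd m"
      then show ?thesis unfolding cut_inc_def inc_def Let_def cl_eq by (simp add: bex)
    next
      assume "\<not> snd l" "snd m"
      then show ?thesis unfolding cut_inc_def inc_def Let_def cl_eq by (simp add: bex)
    next
      assume "\<not> snd l" "\<not> snd m"
      then show ?thesis unfolding cut_inc_def inc_def Let_def cl_eq by simp
    qed
  qed
  have cl_sub: "cl b p v \<subseteq> {..<length (E p)}" for b p v using U(2)[of p] by (auto simp: cl_def)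
  have inc: "ptime B (\<lambda>e. inc (f e) (l e) (m e))" if f: "ptime B f" "ptime B l" "ptime B m"
    for f :: "'e::enc \<Rightarrow> 'c" and l m :: "'e \<Rightarrow> nat \<times> bool"
    unfolding inc_def
    by (intro ptime_intros f ptime_bex_finite[OF C(1)] plist_mem[OF SL] ptime_sol[OF dec C(1) V] cl cl_sub plist_comp[OF SL])
  have step: "ptime B (\<lambda>q. (imp_step (U (fst q)) (cut_inc H (del_edge H x y) x y (edge (E (fst q))) (U (fst q)) (L (fst q))))\<^sup>*\<^sup>* (snd q, b) (snd q, c))" for b c
  proof -
    have eq: "imp_step (U p) (cut_inc H (del_edge H x y) x y (edge (E p)) (U p) (L p)) =
        (\<lambda>l m. fst l \<in> U p \<and> fst m \<in> U p \<and> inc p l (fst m, \<not> snd m))" for p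
      using inc_eq by (intro ext) (auto simp: imp_step_def)
    show ?thesis
      unfolding eq
      by (rule ptime_rtranclp_lit[where D = "\<lambda>q. U (fst q)"]) ((intro ptime_intros inc)+, blast, (intro ptime_intros)+)
  qed
  show ?thesis
    unfolding cut_solvable_def by (intro ptime_intros U(1) step)
qed

lemma plist_anchor:
  assumes C: "finite C" "verts H \<subseteq> C" and E: "ptime B E" and U: "pset B U" and L: "plist B C L"
    and \<rho>: "\<And>c. c \<in> C \<Longrightarrow> ptime B (\<lambda>e. \<rho> e c)"
  shows "plist B C (\<lambda>e. anchor H (edge (E e)) (U e) (\<rho> e) (L e))"
proof -
  have finV: "finite (verts H)" using C finite_subset by blast
  have \<rho>': "ptime B (\<lambda>e. \<rho> (f e) c)" if "c \<in> verts H" "ptime B f" for c and f :: "'e::enc \<Rightarrow> 'b"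
    using ptime_comp[OF that(2) \<rho>] that(1) C(2) by blast
  show ?thesis
    unfolding anchor_def
  proof (rule plist_Collect[OF L])
    fix c
    note [ptime_intros] = ptime_comp[OF _ E] pset_comp[OF U]
    have "ptime B (\<lambda>p. \<rho> (fst p) c \<in> U (fst p) \<and> (\<forall>d\<in>verts H. \<rho> (fst p) d \<in> U (fst p) \<longrightarrow>
          (if snd p = \<rho> (fst p) d then c = d else hok H (edge (E (fst p))) (snd p) (\<rho> (fst p) d) c d)))"
      if "c \<in> verts H"
      by (intro ptime_intros ptime_ball_finite[OF finV] \<rho>' that)
    then show "ptime B (\<lambda>p. c \<in> verts H \<and> \<rho> (fst p) c \<in> U (fst p) \<and> (\<forall>d\<in>verts H. \<rho> (fst p) d \<in> U (fst p) \<longrightarrow>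
          (if snd p = \<rho> (fst p) d then c = d else hok H (edge (E (fst p))) (snd p) (\<rho> (fst p) d) c d)))"
      by (cases "c \<in> verts H") (simp_all add: ptime_const)
  qed
qed

lemma plist_trim:
  assumes L: "plist B C L" and R: "pset B Rx" "pset B Ry"
  shows "plist B C (\<lambda>e. trim x y (Rx e) (Ry e) (L e))"
proof -
  note [ptime_intros] = pset_comp[OF R(1)] pset_comp[OF R(2)] plist_mem[OF L]
  show ?thesis unfolding trim_def by (intro plist_Collect[OF L] ptime_intros)
qed

text \<open>Guessing a map from a fixed finite set to the vertices amounts to trying polynomially many lists.\<close>

lemma ptime_guess:
  fixes P :: "'e::enc \<Rightarrow> ('a \<Rightarrow> nat) \<Rightarrow> bool"
  assumes C: "finite C" and U: "pset B U" and k: "ptime B k"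
    and P: "ptime B (\<lambda>p. P (fst p) (\<lambda>c. nthd 0 (snd p) (to_nat_on C c)))"
    and cong: "\<And>e \<rho> \<rho>'. (\<And>c. c \<in> C \<Longrightarrow> \<rho> c = \<rho>' c) \<Longrightarrow> P e \<rho> = P e \<rho>'"
  shows "ptime B (\<lambda>e. \<exists>\<rho>. (\<forall>c. \<rho> c \<in> insert (k e) (U e)) \<and> P e \<rho>)"
proof -
  obtain l where l: "ptime B l" "U = (\<lambda>e. set (l e))" using psetE[OF U] .
  let ?dec = "\<lambda>r c. nthd 0 r (to_nat_on C c)"
  have "ptime B (\<lambda>e. \<exists>r\<in>set (List.n_lists (card C) (k e # l e)). P e (?dec r))"
    by (intro ptime_intros k l P)
  moreover have "(\<exists>r\<in>set (List.n_lists (card C) (k e # l e)). P e (?dec r)) \<longleftrightarrow>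
      (\<exists>\<rho>. (\<forall>c. \<rho> c \<in> insert (k e) (U e)) \<and> P e \<rho>)" for e
  proof
    assume "\<exists>r\<in>set (List.n_lists (card C) (k e # l e)). P e (?dec r)"
    then obtain r where r: "length r = card C" "set r \<subseteq> insert (k e) (U e)" "P e (?dec r)"
      by (auto simp: set_n_lists l)
    \<comment> \<open>Outside \<open>C\<close> the guessed list has no entry; \<open>k e\<close> is
      a permitted value there, and by \<open>cong\<close> it does not affect
      \<open>P\<close>.\<close>
    let ?\<rho> = "\<lambda>c. if c \<in> C then ?dec r c else k e"
    have "?dec r c \<in> insert (k e) (U e)" if "c \<in> C" for c
    proof -
      have "to_nat_on C c < length r" using to_nat_on_finite[OF C] that r(1) by (auto simp: bij_betw_def)
      then show ?thesis using subsetD[OF r(2) nth_mem[of "to_nat_on C c" r]] by (simp add: nthd_def)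
    qed
    moreover have "P e ?\<rho>" using r(3) cong[of "?dec r" ?\<rho> e] by simp
    ultimately show "\<exists>\<rho>. (\<forall>c. \<rho> c \<in> insert (k e) (U e)) \<and> P e \<rho>" by (intro exI[of _ ?\<rho>]) auto
  next
    assume "\<exists>\<rho>. (\<forall>c. \<rho> c \<in> insert (k e) (U e)) \<and> P e \<rho>"
    then obtain \<rho> where \<rho>: "\<And>c. \<rho> c \<in> insert (k e) (U e)" "P e \<rho>" by blast
    let ?r = "map (\<lambda>i. \<rho> (from_nat_into C i)) [0..<card C]"
    have "?r \<in> set (List.n_lists (card C) (k e # l e))" using \<rho>(1) by (auto simp: set_n_lists l)
    moreover have "\<rho> c = ?dec ?r c" if "c \<in> C" for c
    proof -
      have "to_nat_on C c < card C" using to_nat_on_finite[OF C] that by (auto simp: bij_betw_def)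
      then show ?thesis using that C by (simp add: nthd_def countable_finite)
    qed
    then have "P e (?dec ?r)" using \<rho>(2) cong[of \<rho> "?dec ?r" e] by blast
    ultimately show "\<exists>r\<in>set (List.n_lists (card C) (k e # l e)). P e (?dec r)" by blast
  qed
  ultimately show ?thesis by simp
qed

lemma anchor_cong:
  "(\<And>c. c \<in> verts H \<Longrightarrow> \<rho> c = \<rho>' c) \<Longrightarrow> anchor H e U \<rho> L = anchor H e U \<rho>' L"
  unfolding anchor_def by (intro ext Collect_cong) auto



section \<open>Deciding list homomorphism problems\<close>

lemma sol_reindex:
  assumes h: "bij_betw h U' U" and L: "\<And>i. i \<in> U' \<Longrightarrow> L' i \<inter> verts H = L (h i) \<inter> verts H"
    and e: "\<And>i j. i \<in> U' \<Longrightarrow> j \<in> U' \<Longrightarrow> e' i j = e (h i) (h j)"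
  shows "sol H e' U' L' \<longleftrightarrow> sol H e U L"
proof
  have inj: "inj_on h U'" and U: "h ` U' = U" using h by (auto simp: bij_betw_def)
  have hok: "hok H e' i j c d \<longleftrightarrow> hok H e (h i) (h j) c d" if "i \<in> U'" "j \<in> U'" for i j c d
    using e that by (simp add: hok_def)
  {
    assume "sol H e U L"
    then obtain f where f: "\<And>u. u \<in> U \<Longrightarrow> f u \<in> L u" "\<And>u. u \<in> U \<Longrightarrow> f u \<in> verts H"
      "\<And>u v. u \<in> U \<Longrightarrow> v \<in> U \<Longrightarrow> u \<noteq> v \<Longrightarrow> hok H e u v (f u) (f v)" by (rule solE, blast)
    show "sol H e' U' L'"
    proof (rule solI[where f = "\<lambda>i. f (h i)"])
      fix i assume i: "i \<in> U'"
      show "f (h i) \<in> L' i \<inter> verts H" using f(1,2)[of "h i"] L[OF i] i U by auto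
      fix j assume j: "j \<in> U'" "i \<noteq> j"
      then have "h i \<noteq> h j" using inj i by (auto simp: inj_on_def)
      then show "hok H e' i j (f (h i)) (f (h j))" using f(3)[of "h i" "h j"] hok i j U by auto
    qed
  next
    assume "sol H e' U' L'"
    then obtain f where f: "\<And>u. u \<in> U' \<Longrightarrow> f u \<in> L' u" "\<And>u. u \<in> U' \<Longrightarrow> f u \<in> verts H"
      "\<And>u v. u \<in> U' \<Longrightarrow> v \<in> U' \<Longrightarrow> u \<noteq> v \<Longrightarrow> hok H e' u v (f u) (f v)" by (rule solE, blast)
    let ?g = "inv_into U' h"
    have g: "?g u \<in> U'" "h (?g u) = u" if "u \<in> U" for u
      using that U by (auto simp: inv_into_into f_inv_into_f)
    show "sol H e U L"
    proof (rule solI[where f = "\<lambda>u. f (?g u)"])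
      fix u assume u: "u \<in> U"
      show "f (?g u) \<in> L u \<inter> verts H" using f(1,2)[OF g(1)[OF u]] L[OF g(1)[OF u]] g(2)[OF u] by auto
      fix v assume v: "v \<in> U" "u \<noteq> v"
      then have "?g u \<noteq> ?g v" using g u by metis
      then show "hok H e u v (f (?g u)) (f (?g v))"
        using f(3)[OF g(1)[OF u] g(1)[OF v(1)]] hok[OF g(1)[OF u] g(1)[OF v(1)]] g(2)[OF u] g(2)[OF v(1)] by simp
    qed
  }
qed

lemma is_list_hom_iff_sol:
  "(\<exists>f. is_list_hom G L H f) \<longleftrightarrow> sol H (\<lambda>u v. (u, v) \<in> edges G) (verts G) L"
proof -
  have "is_list_hom G L H f \<longleftrightarrow> (\<forall>u\<in>verts G. f u \<in> L u \<inter> verts H) \<and>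
      (\<forall>u\<in>verts G. \<forall>v\<in>verts G. u \<noteq> v \<longrightarrow> hok H (\<lambda>u v. (u, v) \<in> edges G) u v (f u) (f v))" for f
    unfolding is_list_hom_def is_hom_def hok_def edges_def by (auto 0 3)
  then show ?thesis unfolding sol_def csp_def by simp
qed

section \<open>Encoded instances and their tables\<close>

lemma list_val_inj: "list_val xs = list_val ys \<longleftrightarrow> xs = ys"
proof (induction xs arbitrary: ys)
  case Nil
  then show ?case by (cases ys) auto
next
  case (Cons x xs)
  then show ?case by (cases ys) auto
qed

lemma bool_val_inj: "bool_val a = bool_val b \<longleftrightarrow> a = b"
  by (simp add: bool_val_def)

lemma inj_enc_bool: "inj (enc :: bool \<Rightarrow> val)"
  by (rule injI) (simp add: enc_bool_def bool_val_inj)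

lemma inj_enc_list: "inj (enc :: 'x::enc \<Rightarrow> val) \<Longrightarrow> inj (enc :: 'x list \<Rightarrow> val)"
  by (rule injI) (simp add: enc_list_def list_val_inj inj_map_eq_map)

text \<open>\<open>yes_instances\<close> asks for some graph with the given code, so the code must
  determine all data on which solvability depends.\<close>

lemma encode_inj:
  assumes G: "lhom_input H G L" and G': "lhom_input H G' L'" and fin: "finite (verts H)"
    and eq: "encode H G L = encode H G' L'"
  shows "verts G = verts G'" "\<And>u v. u \<in> verts G \<Longrightarrow> v \<in> verts G \<Longrightarrow> (u, v) \<in> edges G \<longleftrightarrow> (u, v) \<in> edges G'"
    "\<And>u. u \<in> verts G \<Longrightarrow> L u = L' u"
proof -
  obtain n n' where n: "verts G = {..<n}" "verts G' = {..<n'}" using G G' by (auto simp: lhom_input_def)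
  let ?row = "\<lambda>n G u. list_val (map (\<lambda>v. bool_val ((u, v) \<in> edges G)) [0..<n])"
  let ?lrow = "\<lambda>L u. list_val (map (\<lambda>i. bool_val (from_nat_into (verts H) i \<in> L u)) [0..<card (verts H)])"
  have e: "map (?row n G) [0..<n] = map (?row n' G') [0..<n']" "map (?lrow L) [0..<n] = map (?lrow L') [0..<n']"
    using eq unfolding encode_def Let_def n by (simp_all add: list_val_inj)
  from arg_cong[OF e(1), of length] have nn: "n = n'" by simp
  then show "verts G = verts G'" using n by simp
  show "(u, v) \<in> edges G \<longleftrightarrow> (u, v) \<in> edges G'" if "u \<in> verts G" "v \<in> verts G" for u v
    using e(1) that n nn by (auto simp: list_val_inj bool_val_inj)
  show "L u = L' u" if u: "u \<in> verts G" for u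
  proof -
    have "\<forall>i<card (verts H). from_nat_into (verts H) i \<in> L u \<longleftrightarrow> from_nat_into (verts H) i \<in> L' u"
      using e(2) u n nn by (auto simp: list_val_inj bool_val_inj)
    moreover have "L u \<subseteq> verts H" "L' u \<subseteq> verts H" using G G' u n nn by (auto simp: lhom_input_def)
    moreover have "\<exists>i<card (verts H). c = from_nat_into (verts H) i" if "c \<in> verts H" for c
      using to_nat_on_finite[OF fin] that fin
      by (intro exI[of _ "to_nat_on (verts H) c"]) (auto simp: bij_betw_def countable_finite)
    ultimately show ?thesis by blast
  qed
qed

lemma yes_iff_sol:
  assumes G: "lhom_input H G L" and fin: "finite (verts H)"
  shows "encode H G L \<in> yes_instances (L_HOM H) \<longleftrightarrow> sol H (\<lambda>u v. (u, v) \<in> edges G) (verts G) L"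
proof -
  have "encode H G L \<in> yes_instances (L_HOM H) \<longleftrightarrow>
      (\<exists>G' L'. encode H G L = encode H G' L' \<and> lhom_input H G' L' \<and> sol H (\<lambda>u v. (u, v) \<in> edges G') (verts G') L')"
    by (simp add: L_HOM_def is_list_hom_iff_sol)
  also have "\<dots> \<longleftrightarrow> sol H (\<lambda>u v. (u, v) \<in> edges G) (verts G) L"
  proof
    assume "\<exists>G' L'. encode H G L = encode H G' L' \<and> lhom_input H G' L' \<and> sol H (\<lambda>u v. (u, v) \<in> edges G') (verts G') L'"
    then obtain G' L' where G': "encode H G L = encode H G' L'" "lhom_input H G' L'"
      "sol H (\<lambda>u v. (u, v) \<in> edges G') (verts G') L'" by blast
    note inj = encode_inj[OF G G'(2) fin G'(1)]
    have "sol H (\<lambda>u v. (u, v) \<in> edges G) (verts G) L \<longleftrightarrow> sol H (\<lambda>u v. (u, v) \<in> edges G') (verts G') L'"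
      by (rule sol_reindex[where h = "\<lambda>u. u"]) (use inj in \<open>auto simp: bij_betw_def\<close>)
    then show "sol H (\<lambda>u v. (u, v) \<in> edges G) (verts G) L" using G'(3) by simp
  qed (use G in blast)
  finally show ?thesis .
qed

lemma enc_tables:
  fixes E T :: "bool list list"
  assumes E: "length E = n" "\<And>u. u < n \<Longrightarrow> length (E ! u) = n" and T: "length T = n" "\<And>u. u < n \<Longrightarrow> length (T ! u) = card (verts H)"
    and fin: "finite (verts H)"
  shows "enc (E, T) \<in> instances (L_HOM H)"
    "enc (E, T) \<in> yes_instances (L_HOM H) \<longleftrightarrow> sol H (edge E) {..<n} (lst (verts H) T)"
proof -
  define G :: "nat trigraph" where "G = \<lparr> verts = {..<n}, weak = {(u, v). u < n \<and> v < n \<and> edge E u v}, strong = {} \<rparr>"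
  have G: "lhom_input H G (lst (verts H) T)"
    by (auto simp: lhom_input_def is_digraph_def is_trigraph_def edges_def G_def lst_def)
  have ed: "(u, v) \<in> edges G \<longleftrightarrow> edge E u v" if "u < n" "v < n" for u v
    using that by (auto simp: edges_def G_def)
  have mem: "from_nat_into (verts H) i \<in> lst (verts H) T u \<longleftrightarrow> T ! u ! i" if "u < n" "i < card (verts H)" for u i
  proof -
    have "verts H \<noteq> {}" using that(2) by auto
    then have "from_nat_into (verts H) i \<in> verts H" by (rule from_nat_into)
    moreover have "to_nat_on (verts H) (from_nat_into (verts H) i) = i"
      using that(2) to_nat_on_finite[OF fin] by (intro to_nat_on_from_nat_into) (simp add: bij_betw_def)
    ultimately show ?thesis using that T by (auto simp: lst_def nthd_def)
  qed
  have rows: "map (\<lambda>u. map (\<lambda>v. (u, v) \<in> edges G) [0..<n]) [0..<n] = E"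
    by (rule nth_equalityI) (auto simp: E ed edge_def nthd_def intro!: nth_equalityI)
  have lrows: "map (\<lambda>u. map (\<lambda>i. from_nat_into (verts H) i \<in> lst (verts H) T u) [0..<card (verts H)]) [0..<n] = T"
    by (rule nth_equalityI) (auto simp: T mem intro!: nth_equalityI)
  have "encode H G (lst (verts H) T) =
      enc (map (\<lambda>u. map (\<lambda>v. (u, v) \<in> edges G) [0..<n]) [0..<n],
        map (\<lambda>u. map (\<lambda>i. from_nat_into (verts H) i \<in> lst (verts H) T u) [0..<card (verts H)]) [0..<n])"
    by (simp add: encode_def Let_def enc_Pair enc_list_def enc_bool_def G_def o_def)
  then have enc: "encode H G (lst (verts H) T) = enc (E, T)" by (simp only: rows lrows)
  show "enc (E, T) \<in> instances (L_HOM H)" using G enc by (force simp: L_HOM_def)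
  have "sol H (\<lambda>u v. (u, v) \<in> edges G) (verts G) (lst (verts H) T) \<longleftrightarrow> sol H (edge E) {..<n} (lst (verts H) T)"
    by (rule sol_reindex[where h = "\<lambda>u. u"]) (auto simp: ed G_def bij_betw_def edges_def)
  then show "enc (E, T) \<in> yes_instances (L_HOM H) \<longleftrightarrow> sol H (edge E) {..<n} (lst (verts H) T)"
    using yes_iff_sol[OF G fin] enc by simp
qed

lemma instance_tables:
  assumes "v \<in> instances (L_HOM H)"
  obtains E T :: "bool list list" where "v = enc (E, T)" "\<And>u. u < length E \<Longrightarrow> length (E ! u) = length E"
    "length T = length E" "\<And>u. u < length E \<Longrightarrow> length (T ! u) = card (verts H)"
proof -
  obtain G L where GL: "v = encode H G L" "lhom_input H G L" using assms by (auto simp: L_HOM_def)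
  obtain n where n: "verts G = {..<n}" using GL(2) by (auto simp: lhom_input_def)
  let ?E = "map (\<lambda>u. map (\<lambda>v. (u, v) \<in> edges G) [0..<n]) [0..<n]"
  let ?T = "map (\<lambda>u. map (\<lambda>i. from_nat_into (verts H) i \<in> L u) [0..<card (verts H)]) [0..<n]"
  have "v = enc (?E, ?T)"
    by (simp add: GL encode_def Let_def enc_Pair enc_list_def enc_bool_def n o_def)
  then show ?thesis by (rule that) auto
qed

text \<open>The active vertices are renumbered and both tables rewritten in the format of
  \<open>verts H\<close>, so the query is legal whatever the input tables look like.\<close>

lemma decidable_oracle:
  assumes C: "finite C" "verts H \<subseteq> C"
  shows "decidable (L_HOM H) C H"
proof -
  let ?B = "L_HOM H"
  have fin: "finite (verts H)" using C finite_subset by blast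
  define act where "act p = filter (\<lambda>u. \<exists>c\<in>C. c \<in> lst C (snd p) u) [0..<length (fst p)]" for p :: "bool list list \<times> bool list list"
  define E' where "E' p = map (\<lambda>u. map (\<lambda>v. edge (fst p) u v) (act p)) (act p)" for p :: "bool list list \<times> bool list list"
  define T' where "T' p = map (\<lambda>u. map (\<lambda>i. from_nat_into (verts H) i \<in> lst C (snd p) u) [0..<card (verts H)]) (act p)"
    for p :: "bool list list \<times> bool list list"
  have act: "ptime ?B act" unfolding act_def by (intro ptime_intros ptime_bex_finite[OF C(1)])
  have "ptime ?B E'" unfolding E'_def by (intro ptime_intros act ptime_comp[OF _ act])
  moreover have "ptime ?B T'"
    unfolding T'_def
    by (intro ptime_intros act ptime_map_const[where f = "\<lambda>i p. from_nat_into (verts H) i \<in> lst C (snd (fst p)) (snd p)"])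
  ultimately have q: "ptime ?B (\<lambda>p. (E' p, T' p))" by (intro ptime_intros)
  have len: "length (E' p) = length (act p)" "length (T' p) = length (act p)" for p by (auto simp: E'_def T'_def)
  have rows: "\<And>u. u < length (act p) \<Longrightarrow> length (E' p ! u) = length (act p)"
    "\<And>u. u < length (act p) \<Longrightarrow> length (T' p ! u) = card (verts H)" for p by (auto simp: E'_def T'_def)
  have tab: "enc (E' p, T' p) \<in> instances ?B"
    "enc (E' p, T' p) \<in> yes_instances ?B \<longleftrightarrow> sol H (edge (E' p)) {..<length (act p)} (lst (verts H) (T' p))" for p
    using enc_tables[where E = "E' p" and T = "T' p" and n = "length (act p)" and H = H,
        OF len(1) rows(1) len(2) rows(2) fin] by auto
  have "ptime ?B (\<lambda>p. enc (E' p, T' p) \<in> yes_instances ?B)"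
    by (rule ptime_query[OF q]) (rule tab(1))
  moreover have "enc (E' p, T' p) \<in> yes_instances ?B \<longleftrightarrow> sol H (edge (fst p)) (active C p) (lst C (snd p))" for p
    unfolding tab(2)
  proof (rule sol_reindex[where h = "\<lambda>i. act p ! i"])
    have "distinct (act p)" "set (act p) = active C p" by (auto simp: act_def active_def)
    then show "bij_betw (\<lambda>i. act p ! i) {..<length (act p)} (active C p)" by (intro bij_betw_nth) auto
    fix i assume i: "i \<in> {..<length (act p)}"
    have "c \<in> lst (verts H) (T' p) i \<longleftrightarrow> c \<in> lst C (snd p) (act p ! i)" if c: "c \<in> verts H" for c
    proof -
      have "to_nat_on (verts H) c < card (verts H)" using to_nat_on_finite[OF fin] c by (auto simp: bij_betw_def)
      then show ?thesis using c i fin by (simp add: lst_def[of "verts H"] nthd_def T'_def countable_finite)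
    qed
    then show "lst (verts H) (T' p) i \<inter> verts H = lst C (snd p) (act p ! i) \<inter> verts H" by blast
    fix j assume "j \<in> {..<length (act p)}"
    then show "edge (E' p) i j = edge (fst p) (act p ! i) (act p ! j)"
      using i unfolding edge_def[of "E' p"] by (simp add: nthd_def E'_def)
  qed
  ultimately show ?thesis unfolding decidable_def by simp
qed

text \<open>\<open>length (fst p)\<close> serves both as the bound \<open>n\<close> on the number of
  rounds and as the non-vertex \<open>k\<close> that marks colours not occurring.\<close>

lemma active_facts:
  "finite (active C p)" "active C p \<subseteq> {..<length (fst p)}" "card (active C p) \<le> length (fst p)"
  "length (fst p) \<notin> active C p"
  using card_mono[of "{..<length (fst p)}" "active C p"] by (auto simp: active_def)

lemma pset_active: "finite C \<Longrightarrow> pset B (active C)"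
  unfolding active_def by (intro ptime_intros ptime_bex_finite)

lemma plist_lst: "plist B C (\<lambda>p. lst C (snd p))"
  by (intro plistI ptime_intros) (auto simp: lst_def)

lemma decidable_strong_edge:
  assumes tri: "is_trigraph H" and ac: "acyclic_trigraph H" and xy: "(x, y) \<in> strong H" "x \<noteq> y"
    and C: "finite C" "verts H \<subseteq> C" and dec: "decidable B C (del_edge H x y)"
  shows "decidable B C H"
proof -
  have V: "verts (del_edge H x y) \<subseteq> C" using C by (simp add: del_edge_def)
  have xyC: "x \<in> C" "y \<in> C" using xy tri C by (auto simp: is_trigraph_def edges_def)
  note U = pset_active[OF C(1), of B] and L = plist_lst[of B C]
  note [ptime_intros] = pset_comp[OF U]
  have fst: "ptime B (\<lambda>p :: bool list list \<times> bool list list. fst p)" by (intro ptime_intros)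
  have del: "plist B C (\<lambda>p u. lst C (snd p) u - {z})" for z
  proof -
    have "plist B C (\<lambda>p u. {c \<in> lst C (snd p) u. c \<noteq> z})" by (intro plist_Collect L ptime_const)
    then show ?thesis by (simp add: set_diff_eq)
  qed
  let ?P = "\<lambda>p \<rho>. \<rho> x \<in> active C p \<and> \<rho> y \<in> active C p \<and>
    cut_solvable H (del_edge H x y) x y (edge (fst p)) (active C p) (anchor H (edge (fst p)) (active C p) \<rho> (lst C (snd p)))"
  have "ptime B (\<lambda>p. \<exists>\<rho>. (\<forall>c. \<rho> c \<in> insert (length (fst p)) (active C p)) \<and> ?P p \<rho>)"
  proof (rule ptime_guess[OF C(1) U])
    show "ptime B (\<lambda>p :: bool list list \<times> bool list list. length (fst p))" by (intro ptime_intros)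
    show "?P p \<rho> = ?P p \<rho>'" if eq: "\<And>c. c \<in> C \<Longrightarrow> \<rho> c = \<rho>' c" for p \<rho> \<rho>'
    proof -
      have "anchor H (edge (fst p)) (active C p) \<rho> (lst C (snd p)) = anchor H (edge (fst p)) (active C p) \<rho>' (lst C (snd p))"
        using eq C(2) by (intro anchor_cong) auto
      then show ?thesis using eq[OF xyC(1)] eq[OF xyC(2)] by simp
    qed
    show "ptime B (\<lambda>q. ?P (fst q) (\<lambda>c. nthd 0 (snd q) (to_nat_on C c)))"
      by (intro ptime_intros ptime_cut_solvable[OF dec C] plist_anchor[OF C] active_facts plist_comp[OF L])
  qed
  then have "ptime B (\<lambda>p. sol (del_edge H x y) (edge (fst p)) (active C p) (\<lambda>u. lst C (snd p) u - {x}) \<or>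
      sol (del_edge H x y) (edge (fst p)) (active C p) (\<lambda>u. lst C (snd p) u - {y}) \<or>
      (\<exists>\<rho>. (\<forall>c. \<rho> c \<in> insert (length (fst p)) (active C p)) \<and> ?P p \<rho>))"
    by (intro ptime_disj ptime_sol[OF dec C(1) V] fst U active_facts del)
  then show ?thesis
    unfolding decidable_def strong_edge_sol_iff[OF tri ac xy active_facts(1,4)] .
qed

lemma decidable_loops:
  assumes tri: "is_trigraph H" and ac: "acyclic_trigraph H"
    and loops: "\<And>a b. (a, b) \<in> strong H \<Longrightarrow> a = b" and ne: "strong H \<noteq> {}"
    and C: "finite C" "verts H \<subseteq> C"
    and dec: "\<And>x. x \<in> strong_loops H \<Longrightarrow> decidable B C (del_vertex H x)"
    and dec': "\<And>x y. x \<in> strong_loops H \<Longrightarrow> y \<in> strong_loops H \<Longrightarrow> underlying_adj H x y \<Longrightarrow> decidable B C (del_edge H x y)"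
  shows "decidable B C H"
proof -
  have finS: "finite (strong_loops H)" "strong_loops H \<subseteq> C"
    using C finite_subset[of "verts H" C] by (auto simp: strong_loops_def)
  have V: "verts (del_vertex H x) \<subseteq> C" for x using C by (auto simp: del_vertex_def)
  note U = pset_active[OF C(1), of B] and L = plist_lst[of B C]
  note [ptime_intros] = pset_comp[OF U]
  have fst: "ptime B (\<lambda>p :: bool list list \<times> bool list list. fst p)" by (intro ptime_intros)
  let ?P = "\<lambda>p \<rho>. loops_accept (length (fst p)) H (edge (fst p)) (active C p) (anchor H (edge (fst p)) (active C p) \<rho> (lst C (snd p))) \<rho>"
  have guess: "ptime B (\<lambda>p. \<exists>\<rho>. (\<forall>c. \<rho> c \<in> insert (length (fst p)) (active C p)) \<and> ?P p \<rho>)"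
  proof (rule ptime_guess[OF C(1) U])
    show "ptime B (\<lambda>p :: bool list list \<times> bool list list. length (fst p))" by (intro ptime_intros)
    show "?P p \<rho> = ?P p \<rho>'" if eq: "\<And>c. c \<in> C \<Longrightarrow> \<rho> c = \<rho>' c" for p \<rho> \<rho>'
    proof -
      have "anchor H (edge (fst p)) (active C p) \<rho> (lst C (snd p)) = anchor H (edge (fst p)) (active C p) \<rho>' (lst C (snd p))"
        using eq C(2) by (intro anchor_cong) auto
      moreover have "\<rho> x = \<rho>' x" if "x \<in> strong_loops H" for x using eq finS(2) that by blast
      ultimately show ?thesis unfolding loops_accept_def by simp
    qed
    let ?\<rho> = "\<lambda>q c. nthd 0 (snd q) (to_nat_on C c)"
    define LL where "LL q = anchor H (edge (fst (fst q))) (active C (fst q)) (?\<rho> q) (lst C (snd (fst q)))"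
      for q :: "(bool list list \<times> bool list list) \<times> nat list"
    have anch: "plist B C LL"
      unfolding LL_def by (intro plist_anchor[OF C] ptime_intros plist_comp[OF L])
    have adj: "ptime B (\<lambda>q :: (bool list list \<times> bool list list) \<times> nat list. underlying_adj H x y \<and>
      ?\<rho> q x \<in> active C (fst q) \<and> ?\<rho> q y \<in> active C (fst q) \<and>
      (\<exists>t\<in>{..length (fst (fst q))}. \<exists>v\<in>active C (fst q). \<exists>t'\<in>{..length (fst (fst q))}. \<exists>v'\<in>active C (fst q).
        cut_solvable H (del_edge H x y) x y (edge (fst (fst q))) (active C (fst q))
          (trim x y (region (length (fst (fst q))) (edge (fst (fst q))) (active C (fst q)) (LL q) x t v)
            (region (length (fst (fst q))) (edge (fst (fst q))) (active C (fst q)) (LL q) y t' v') (LL q))))"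
      if "x \<in> strong_loops H" "y \<in> strong_loops H" for x y
    proof (cases "underlying_adj H x y")
      case True
      show ?thesis
        by (intro ptime_intros ptime_cut_solvable[OF dec'[OF that True] C] plist_trim pset_region[where C = C] plist_comp[OF anch] active_facts)
    next
      case False
      then show ?thesis by (simp add: ptime_const)
    qed
    have "ptime B (\<lambda>q. loops_accept (length (fst (fst q))) H (edge (fst (fst q))) (active C (fst q)) (LL q) (?\<rho> q))"
      unfolding loops_accept_def
      by (intro ptime_disj ptime_bex_finite[OF finS(1)] adj)
        (intro ptime_intros ptime_region_accepts[OF dec C] pset_region[where C = C] plist_comp[OF anch] active_facts; assumption)+
    then show "ptime B (\<lambda>q. ?P (fst q) (?\<rho> q))" by (simp only: LL_def)
  qed
  have "ptime B (\<lambda>p. (\<exists>x\<in>strong_loops H. sol (del_vertex H x) (edge (fst p)) (active C p) (lst C (snd p))) \<or>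
      (\<exists>\<rho>. (\<forall>c. \<rho> c \<in> insert (length (fst p)) (active C p)) \<and> ?P p \<rho>))"
    by (intro ptime_disj guess ptime_bex_finite[OF finS(1)] ptime_sol[OF dec C(1) V] fst U active_facts L)
  moreover have "sol H (edge (fst p)) (active C p) (lst C (snd p)) \<longleftrightarrow>
      (\<exists>x\<in>strong_loops H. sol (del_vertex H x) (edge (fst p)) (active C p) (lst C (snd p))) \<or>
      (\<exists>\<rho>. (\<forall>c. \<rho> c \<in> insert (length (fst p)) (active C p)) \<and> ?P p \<rho>)" for p
    by (rule loops_sol_iff[OF tri ac _ ne active_facts(1,3,4)]) (rule loops)
  ultimately show ?thesis unfolding decidable_def by (simp only:)
qed

section \<open>Induction on the trigraph\<close>

lemma minus_digraph_id:
  assumes "is_trigraph H" "strong H = {}"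
  shows "minus_digraph H = H"
  using assms unfolding minus_digraph_def is_trigraph_def edges_def
  by (cases H) (auto simp: Let_def)

text \<open>The reduct discards this edge anyway, because it is strong or loses an end with a strong
  loop.\<close>

lemma minus_digraph_del_edge:
  assumes "(x, y) \<in> strong H \<or> (x, x) \<in> strong H" "x \<noteq> y"
  shows "minus_digraph (del_edge H x y) = minus_digraph H"
  using assms unfolding minus_digraph_def del_edge_def edges_def Let_def by auto

lemma minus_digraph_del_vertex:
  assumes "(x, x) \<in> strong H"
  shows "minus_digraph (del_vertex H x) = minus_digraph H"
  using assms unfolding minus_digraph_def del_vertex_def edges_def Let_def by auto

text \<open>Each deletion shrinks \<open>H\<close> and keeps the reduct, so the recursion ends
  there. Its depth is bounded by the fixed size of \<open>H\<close>, which keeps the composed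
  running time polynomial. Deletions may disconnect a tree, hence the induction over acyclic
  trigraphs.\<close>

lemma decidable_minus:
  assumes "is_trigraph H" "acyclic_trigraph H" "finite C" "verts H \<subseteq> C" "decidable B C (minus_digraph H)"
  shows "decidable B C H"
  using assms
proof (induction "card (verts H) + card (edges H)" arbitrary: H rule: less_induct)
  case less
  have finV: "finite (verts H)" "finite (edges H)" using less.prems(1)
    by (auto simp: is_trigraph_def intro: finite_subset[of _ "verts H \<times> verts H"])
  have edge: "decidable B C (del_edge H x y)"
    if xy: "(x, y) \<in> edges H \<or> (y, x) \<in> edges H" "(x, y) \<in> strong H \<or> (x, x) \<in> strong H" "x \<noteq> y" for x y
  proof (rule less.hyps)
    have sub: "edges (del_edge H x y) \<subset> edges H" using xy(1) by (auto simp: del_edge_def edges_def)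
    then have "card (edges (del_edge H x y)) < card (edges H)" using finV by (intro psubset_card_mono)
    then show "card (verts (del_edge H x y)) + card (edges (del_edge H x y)) < card (verts H) + card (edges H)"
      by (simp add: del_edge_def)
    show "is_trigraph (del_edge H x y)" using less.prems(1) by (auto simp: is_trigraph_def del_edge_def edges_def)
    show "acyclic_trigraph (del_edge H x y)" by (rule acyclic_mono[OF less.prems(2) psubset_imp_subset[OF sub]])
    show "verts (del_edge H x y) \<subseteq> C" using less.prems(4) by (simp add: del_edge_def)
    show "decidable B C (minus_digraph (del_edge H x y))"
      using less.prems(5) minus_digraph_del_edge[OF xy(2,3)] by simp
  qed (fact less.prems(3))
  have vertex: "decidable B C (del_vertex H x)" if x: "x \<in> strong_loops H" for x
  proof (rule less.hyps)
    have x': "x \<in> verts H" "(x, x) \<in> strong H" using x by (auto simp: strong_loops_def)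
    have sub: "edges (del_vertex H x) \<subseteq> edges H" by (auto simp: del_vertex_def edges_def)
    have "card (verts H - {x}) < card (verts H)" using finV x' by (intro psubset_card_mono) auto
    then show "card (verts (del_vertex H x)) + card (edges (del_vertex H x)) < card (verts H) + card (edges H)"
      using card_mono[OF finV(2) sub] by (simp add: del_vertex_def)
    show "is_trigraph (del_vertex H x)" using less.prems(1) by (auto simp: is_trigraph_def del_vertex_def edges_def)
    show "acyclic_trigraph (del_vertex H x)" by (rule acyclic_mono[OF less.prems(2) sub])
    show "verts (del_vertex H x) \<subseteq> C" using less.prems(4) by (auto simp: del_vertex_def)
    show "decidable B C (minus_digraph (del_vertex H x))"
      using less.prems(5) minus_digraph_del_vertex[OF x'(2)] by simp
  qed (fact less.prems(3))
  consider "strong H = {}" | x y where "(x, y) \<in> strong H" "x \<noteq> y"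
    | "strong H \<noteq> {}" "\<And>a b. (a, b) \<in> strong H \<Longrightarrow> a = b" by auto
  then show ?case
  proof cases
    case 1
    then show ?thesis using less.prems(5) minus_digraph_id[OF less.prems(1)] by simp
  next
    case 2
    then show ?thesis
      using edge[of x y] by (intro decidable_strong_edge[OF less.prems(1,2) 2 less.prems(3,4)]) (auto simp: edges_def)
  next
    case 3
    show ?thesis
    proof (rule decidable_loops[OF less.prems(1,2) 3(2,1) less.prems(3,4) vertex])
      fix x y assume "x \<in> strong_loops H" "y \<in> strong_loops H" "underlying_adj H x y"
      then show "decidable B C (del_edge H x y)" by (intro edge) (auto simp: underlying_adj_def strong_loops_def)
    qed
  qed
qed

lemma reducible_if_decidable:
  assumes "is_trigraph H" "decidable B (verts H) H"
  shows "poly_time_reducible (L_HOM H) B"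
proof -
  let ?C = "verts H"
  have fin: "finite ?C" using assms(1) by (simp add: is_trigraph_def)
  let ?P = "\<lambda>p :: bool list list \<times> bool list list. sol H (edge (fst p)) {..<length (fst p)} (lst ?C (snd p))"
  have "ptime B ?P"
    by (intro ptime_sol[OF assms(2) fin subset_refl] plist_lst ptime_intros subset_refl)
  then show ?thesis
  proof (rule ptime_imp_poly_time_reducible)
    show "instances (L_HOM H) \<subseteq> range (enc :: bool list list \<times> bool list list \<Rightarrow> val)"
      by (auto elim: instance_tables)
  next
    fix p :: "bool list list \<times> bool list list" assume "enc p \<in> instances (L_HOM H)"
    then obtain E T :: "bool list list" where ET: "enc p = enc (E, T)" "\<And>u. u < length E \<Longrightarrow> length (E ! u) = length E"
      "length T = length E" "\<And>u. u < length E \<Longrightarrow> length (T ! u) = card ?C"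
      using instance_tables by metis
    have "inj (enc :: bool list list \<Rightarrow> val)" by (intro inj_enc_list inj_enc_bool)
    then have "p = (E, T)" using ET(1) by (cases p) (simp add: enc_Pair inj_eq)
    then show "?P p \<longleftrightarrow> enc p \<in> yes_instances (L_HOM H)"
      using enc_tables(2)[OF refl ET(2-4) fin] by simp
  qed
qed


section \<open>From H to its reduct and back\<close>

definition component :: "('v \<Rightarrow> 'v \<Rightarrow> bool) \<Rightarrow> 'v set \<Rightarrow> 'v \<Rightarrow> 'v set" where
  "component e U u = {w\<in>U. (\<lambda>a b. adjE e a b \<and> a \<in> U \<and> b \<in> U)\<^sup>*\<^sup>* u w}"

lemma minus_digraph_facts:
  "verts (minus_digraph H) = {x \<in> verts H. (x, x) \<notin> strong H}"
  "(c, d) \<in> edges (minus_digraph H) \<longleftrightarrow> (c, d) \<in> edges H \<and> c \<in> verts (minus_digraph H) \<and> d \<in> verts (minus_digraph H) \<and>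
    (c, d) \<notin> strong H \<and> (d, c) \<notin> strong H"
  "strong (minus_digraph H) = {}"
  by (auto simp: minus_digraph_def Let_def edges_def)

text \<open>A strong edge inside a component of the reduct would close a cycle.\<close>

lemma no_strong_in_component:
  assumes ac: "acyclic_trigraph H" and path: "(underlying_adj (minus_digraph H))\<^sup>*\<^sup>* c d" and c: "c \<in> verts (minus_digraph H)"
  shows "(c, d) \<notin> strong H"
proof
  assume s: "(c, d) \<in> strong H"
  then have "c \<noteq> d" using c by (auto simp: minus_digraph_facts(1))
  then have adj: "underlying_adj H d c" using s by (auto simp: underlying_adj_def edges_def)
  have "underlying_adj H a b \<and> {a, b} \<noteq> {d, c}" if "underlying_adj (minus_digraph H) a b" for a b
    using that s by (auto simp: underlying_adj_def minus_digraph_facts(2) doubleton_eq_iff)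
  then have "(\<lambda>a b. underlying_adj H a b \<and> {a, b} \<noteq> {d, c})\<^sup>*\<^sup>* c d"
    using rtranclp_mono[THEN predicate2D, OF _ path, of "\<lambda>a b. underlying_adj H a b \<and> {a, b} \<noteq> {d, c}"] by auto
  then have "d \<in> side H d c" by (simp add: side_def)
  then show False using not_in_side[OF ac adj] by simp
qed

lemma underlying_path_sym: "(underlying_adj H)\<^sup>*\<^sup>* c d \<Longrightarrow> (underlying_adj H)\<^sup>*\<^sup>* d c"
proof (induction rule: rtranclp_induct)
  case (step y z)
  have "underlying_adj H z y" using step.hyps(2) by (simp add: underlying_adj_sym)
  then show ?case using step.IH by (rule converse_rtranclp_into_rtranclp)
qed simp

text \<open>Components of the input are tested separately because \<open>H\<close> may have strong
  edges between components of the reduct, and these would restrict non-adjacent vertices. Within one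
  \<open>D c\<close> both trigraphs impose the same constraints, by
  \<open>no_strong_in_component\<close>, and a connected piece of the input cannot leave
  \<open>D c\<close> when coloured by the reduct.\<close>

lemma minus_sol_iff:
  assumes ac: "acyclic_trigraph H"
  defines "D \<equiv> \<lambda>c. {d \<in> verts (minus_digraph H). (underlying_adj (minus_digraph H))\<^sup>*\<^sup>* c d}"
  shows "sol (minus_digraph H) e U L \<longleftrightarrow>
    (\<forall>u\<in>U. \<exists>c\<in>verts (minus_digraph H). sol H e (component e U u) (\<lambda>w. {d \<in> L w. d \<in> D c}))"
proof -
  let ?M = "minus_digraph H"
  have D_hok: "hok H e u v d d' \<longleftrightarrow> hok ?M e u v d d'" if c: "d \<in> D c" "d' \<in> D c" for u v c d d'
  proof -
    have 1: "(underlying_adj ?M)\<^sup>*\<^sup>* d d'" "d \<in> verts ?M" "d' \<in> verts ?M"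
      using c underlying_path_sym rtranclp_trans unfolding D_def by fast+
    have "(d, d') \<notin> strong H" "(d', d) \<notin> strong H"
      using no_strong_in_component[OF ac 1(1,2)] no_strong_in_component[OF ac underlying_path_sym[OF 1(1)] 1(3)] by auto
    then show ?thesis using 1(2,3) by (auto simp: hok_def minus_digraph_facts)
  qed
  have comp_self: "u \<in> component e U u" if "u \<in> U" for u using that by (simp add: component_def)
  have comp_eq: "component e U w = component e U u" if "w \<in> component e U u" for u w
  proof -
    let ?r = "\<lambda>a b. adjE e a b \<and> a \<in> U \<and> b \<in> U"
    have "?r\<^sup>*\<^sup>* b a" if "?r\<^sup>*\<^sup>* a b" for a b
      using that
    proof induction
      case (step y z)
      from step.hyps(2) have "?r z y" using adjE_sym[of e y z] by simp
      then show ?case using step.IH by (rule converse_rtranclp_into_rtranclp)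
    qed simp
    then show ?thesis using that unfolding component_def by (auto intro: rtranclp_trans)
  qed
  show ?thesis
  proof
    assume "sol ?M e U L"
    then obtain f where f: "\<And>u. u \<in> U \<Longrightarrow> f u \<in> L u" "\<And>u. u \<in> U \<Longrightarrow> f u \<in> verts ?M"
      "\<And>u v. u \<in> U \<Longrightarrow> v \<in> U \<Longrightarrow> u \<noteq> v \<Longrightarrow> hok ?M e u v (f u) (f v)" by (rule solE, blast)
    show "\<forall>u\<in>U. \<exists>c\<in>verts ?M. sol H e (component e U u) (\<lambda>w. {d \<in> L w. d \<in> D c})"
    proof (intro ballI bexI)
      fix u assume u: "u \<in> U"
      have fD: "f w \<in> D (f u)" if "w \<in> component e U u" for w
      proof -
        have "(\<lambda>a b. adjE e a b \<and> a \<in> U \<and> b \<in> U)\<^sup>*\<^sup>* u w" using that by (simp add: component_def)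
        then have "(underlying_adj ?M)\<^sup>*\<^sup>* (f u) (f w)"
        proof induction
          case (step y z)
          then have "hok ?M e y z (f y) (f z)" using f(3)[of y z] by (auto simp: adjE_def)
          then have "f y = f z \<or> underlying_adj ?M (f y) (f z)" using hok_adj step.hyps(2) by metis
          then show ?case using step.IH by (auto intro: rtranclp.rtrancl_into_rtrancl)
        qed simp
        then show ?thesis using f(2)[of w] that by (simp add: D_def component_def)
      qed
      show "f u \<in> verts ?M" using f(2) u by blast
      show "sol H e (component e U u) (\<lambda>w. {d \<in> L w. d \<in> D (f u)})"
      proof (rule solI[where f = f])
        fix w assume w: "w \<in> component e U u"
        have wU: "w \<in> U" using w by (simp add: component_def)
        then show "f w \<in> {d \<in> L w. d \<in> D (f u)} \<inter> verts H"
          using fD[OF w] f(1,2)[OF wU] by (auto simp: minus_digraph_facts(1))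
        fix v assume v: "v \<in> component e U u" "w \<noteq> v"
        then have "v \<in> U" by (simp add: component_def)
        then show "hok H e w v (f w) (f v)"
          using D_hok[OF fD[OF w] fD[OF v(1)]] f(3)[OF wU _ v(2)] by simp
      qed
    qed
  next
    assume A: "\<forall>u\<in>U. \<exists>c\<in>verts ?M. sol H e (component e U u) (\<lambda>w. {d \<in> L w. d \<in> D c})"
    define ext where "ext S cg \<longleftrightarrow> (\<forall>w\<in>S. snd cg w \<in> L w \<and> snd cg w \<in> D (fst cg)) \<and>
      (\<forall>w\<in>S. \<forall>v\<in>S. w \<noteq> v \<longrightarrow> hok H e w v (snd cg w) (snd cg v))" for S and cg :: "'a \<times> ('b \<Rightarrow> 'a)"
    define G where "G S = (SOME cg. ext S cg)" for S
    have G: "ext (component e U u) (G (component e U u))" if u: "u \<in> U" for u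
    proof -
      obtain c g where "\<And>w. w \<in> component e U u \<Longrightarrow> g w \<in> {d \<in> L w. d \<in> D c}"
        "\<And>w v. w \<in> component e U u \<Longrightarrow> v \<in> component e U u \<Longrightarrow> w \<noteq> v \<Longrightarrow> hok H e w v (g w) (g v)"
        using bspec[OF A u] by (elim bexE solE) blast
      then have "ext (component e U u) (c, g)" by (auto simp: ext_def)
      then have "\<exists>cg. ext (component e U u) cg" ..
      then show ?thesis unfolding G_def by (rule someI_ex)
    qed
    define f where "f u = snd (G (component e U u)) u" for u
    show "sol ?M e U L"
    proof (rule solI[where f = f])
      fix u assume u: "u \<in> U"
      have Gu: "f u \<in> L u" "f u \<in> D (fst (G (component e U u)))"
        using G[OF u] comp_self[OF u] unfolding ext_def f_def by blast+
      then show "f u \<in> L u \<inter> verts ?M" by (auto simp: D_def)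
      fix v assume v: "v \<in> U" "u \<noteq> v"
      show "hok ?M e u v (f u) (f v)"
      proof (cases "v \<in> component e U u")
        case True
        note eq = comp_eq[OF True]
        have "hok H e u v (f u) (f v)"
          using G[OF u] comp_self[OF u] True v(2) unfolding ext_def f_def eq by blast
        moreover have "f v \<in> D (fst (G (component e U u)))"
          using G[OF u] True unfolding ext_def f_def eq by blast
        ultimately show ?thesis using D_hok[OF Gu(2)] by blast
      next
        case False
        then have "\<not> adjE e u v" using u v by (auto simp: component_def)
        then show ?thesis using v(2) by (auto simp: adjE_def hok_def minus_digraph_facts(3))
      qed
    qed
  qed
qed

lemma is_trigraph_minus: "is_trigraph H \<Longrightarrow> is_trigraph (minus_digraph H)"
  by (auto simp: is_trigraph_def minus_digraph_def Let_def edges_def)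

lemma decidable_minus_from:
  assumes tri: "is_trigraph H" and ac: "acyclic_trigraph H" and dec: "decidable B (verts H) H"
  shows "decidable B (verts (minus_digraph H)) (minus_digraph H)"
proof -
  let ?M = "minus_digraph H" and ?C = "verts H" and ?D = "verts (minus_digraph H)"
  have fin: "finite ?C" "finite ?D" using tri is_trigraph_minus[OF tri] by (auto simp: is_trigraph_def)
  note U = pset_active[OF fin(2), of B]
  note [ptime_intros] = pset_comp[OF U]
  have comp: "pset B (\<lambda>e. component (edge (E e)) (active ?D (g e)) (v e))" if "ptime B E" "ptime B g" "ptime B v"
    for E :: "'e::enc \<Rightarrow> bool list list" and g and v
  proof -
    have "ptime B (\<lambda>p. (\<lambda>a b. adjE (edge (E (fst p))) a b \<and> a \<in> active ?D (g (fst p)) \<and> b \<in> active ?D (g (fst p)))\<^sup>*\<^sup>* (v (fst p)) (snd p))"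
      by (rule ptime_rtranclp_nat[where D = "\<lambda>p. active ?D (g (fst p))"])
        ((intro ptime_intros ptime_comp[OF _ that(1)] ptime_comp[OF _ that(2)] ptime_comp[OF _ that(3)])+, blast,
         (intro ptime_intros ptime_comp[OF _ that(3)])+)
    then show ?thesis unfolding component_def by (rule pset_Collect[OF pset_comp[OF U that(2)]])
  qed
  have lists: "plist B ?C (\<lambda>q :: (bool list list \<times> bool list list) \<times> nat. \<lambda>w. {d \<in> lst ?D (snd (fst q)) w. d \<in> S})" for S
  proof (rule plistI)
    show "{d \<in> lst ?D (snd (fst q)) w. d \<in> S} \<subseteq> ?C" for q :: "(bool list list \<times> bool list list) \<times> nat" and w
      by (auto simp: lst_def minus_digraph_facts(1))
    show "ptime B (\<lambda>p :: ((bool list list \<times> bool list list) \<times> nat) \<times> nat.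
        c \<in> {d \<in> lst ?D (snd (fst (fst p))) (snd p). d \<in> S})" for c
      unfolding mem_Collect_eq by (intro ptime_intros)
  qed
  show ?thesis
    unfolding decidable_def minus_sol_iff[OF ac]
    by (intro ptime_intros U ptime_bex_finite[OF fin(2)] ptime_sol[OF dec fin(1) subset_refl] comp lists)
      (auto simp: component_def active_def)
qed

theorem theorem1:
  fixes H :: "'a trigraph"
  assumes "trigraph_tree H"
  shows "polynomially_equivalent (L_HOM H) (L_HOM (minus_digraph H))"
proof -
  have tri: "is_trigraph H" and ac: "acyclic_trigraph H"
    using assms by (auto simp: trigraph_tree_def acyclic_trigraph_def)
  have fin: "finite (verts H)" using tri by (simp add: is_trigraph_def)
  have sub: "verts (minus_digraph H) \<subseteq> verts H" by (auto simp: minus_digraph_facts(1))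
  have "decidable (L_HOM (minus_digraph H)) (verts H) H"
    by (rule decidable_minus[OF tri ac fin subset_refl decidable_oracle[OF fin sub]])
  moreover have "decidable (L_HOM H) (verts (minus_digraph H)) (minus_digraph H)"
    by (rule decidable_minus_from[OF tri ac decidable_oracle[OF fin subset_refl]])
  ultimately show ?thesis
    unfolding polynomially_equivalent_def
    using reducible_if_decidable[OF tri] reducible_if_decidable[OF is_trigraph_minus[OF tri]] by blast
qed

end
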